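(* Let $R$ be a semiprime Goldie ring and, for $*\in\{l,r,\emptyset\}$, let $\mathcal{N}_*=\{S\in\max\mathbb{L}_*(R): \mathcal{C}_R\subseteq S\}$. Then \begin{enumerate} \item $\max\mathrm{Ore}(R)=\max\mathrm{Den}(R)=\{\mathcal{C}(\mathfrak{p}):\mathfrak{p}\in\min(R)\}=\mathcal{N}_*$ for all $*\in\{l,r,\emptyset\}$, where $\mathcal{C}(\mathfrak{p})=\{c\in R: c+\mathfrak{p}\in\mathcal{C}_{R/\mathfrak{p}}\}$. In particular every maximal Ore set of $R$ is a maximal denominator set, and vice versa. \item For all $S\in\max\mathrm{Ore}(R)$ the ring $S^{-1}R$ is a simple Artinian ring. \item $Q_{cl}(R)\simeq\prod_{S\in\max\mathrm{Ore}(R)}S^{-1}R$. \item The set of maximal elements of $\{\mathrm{ass}_R(S):S\in\mathrm{Ore}(R)\}$ equals $\{\mathrm{ass}_R(S): S\in\max\mathrm{Ore}(R)\}$, and both equal $\min(R)$. In particular the ideals $\mathrm{ass}_R(S)$, $S\in\max\mathrm{Ore}(R)$, are pairwise incomparable. \end{enumerate}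
   Context: Rings are associative with $1$. $\mathcal{C}_A$ is the set of regular elements (non-zero-divisors on both sides) of a ring $A$; $\min(R)$ is the set of minimal prime ideals; $Q_{cl}(R)=\mathcal{C}_R^{-1}R\simeq R\mathcal{C}_R^{-1}$ is the classical quotient ring. Multiplicative set: $SS\subseteq S$, $1\in S$, $0\notin S$. Ore set: $Sr\cap Rs\ne\emptyset$ and $rS\cap sR\ne\emptyset$ for all $r\in R,s\in S$; a denominator set is an Ore set $S$ such that $rs=0$ or $sr=0$ ($s\in S$) implies $tr=0$, resp. $rt=0$, for some $t\in S$. $\mathrm{Ore}(R)$, $\mathrm{Den}(R)$ are these sets and $\max$ denotes the set of maximal elements w.r.t. inclusion. $R\langle S^{-1}\rangle=R\langle X_S\rangle/I_S$ ($R\langle X_S\rangle$ freely generated by $R$ and noncommuting $x_s$; $I_S$ generated by $sx_s-1,x_ss-1$), $\mathrm{ass}_R(S)=\ker(R\to R\langle S^{-1}\rangle)$, and $S^{-1}R$ denotes $R\langle S^{-1}\rangle$. $S$ is left (resp. right) localizable if $R\langle S^{-1}\rangle\neq0$ and every element has the form $(x_s+I_S)(r+I_S)$ (resp. $(r+I_S)(x_s+I_S)$); localizable if both; $\mathbb{L}_l(R),\mathbb{L}_r(R),\mathbb{L}_\emptyset(R)$ are these sets. *)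

theory Defs
  imports "HOL-Algebra.Algebra"
begin

definition maxl :: "'b set set \<Rightarrow> 'b set set" where
  "maxl F = {S \<in> F. \<forall>T\<in>F. S \<subseteq> T \<longrightarrow> T = S}"

definition minl :: "'b set set \<Rightarrow> 'b set set" where
  "minl F = {S \<in> F. \<forall>T\<in>F. T \<subseteq> S \<longrightarrow> T = S}"

definition regular :: "('a, 'm) ring_scheme \<Rightarrow> 'a set" where
  "regular A = {c \<in> carrier A. \<forall>x\<in>carrier A.
      (c \<otimes>\<^bsub>A\<^esub> x = \<zero>\<^bsub>A\<^esub> \<longrightarrow> x = \<zero>\<^bsub>A\<^esub>) \<and> (x \<otimes>\<^bsub>A\<^esub> c = \<zero>\<^bsub>A\<^esub> \<longrightarrow> x = \<zero>\<^bsub>A\<^esub>)}"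

definition nc_prime :: "('a, 'm) ring_scheme \<Rightarrow> 'a set \<Rightarrow> bool" where
  "nc_prime R P \<longleftrightarrow> ideal P R \<and> P \<noteq> carrier R \<and>
     (\<forall>I J. ideal I R \<longrightarrow> ideal J R \<longrightarrow> (\<forall>i\<in>I. \<forall>j\<in>J. i \<otimes>\<^bsub>R\<^esub> j \<in> P) \<longrightarrow> I \<subseteq> P \<or> J \<subseteq> P)"

definition min_primes :: "('a, 'm) ring_scheme \<Rightarrow> 'a set set" where
  "min_primes R = minl {P. nc_prime R P}"

definition semiprime :: "('a, 'm) ring_scheme \<Rightarrow> bool" where
  "semiprime R \<longleftrightarrow> (\<forall>I. ideal I R \<longrightarrow> (\<forall>i\<in>I. \<forall>j\<in>I. i \<otimes>\<^bsub>R\<^esub> j = \<zero>\<^bsub>R\<^esub>) \<longrightarrow> I = {\<zero>\<^bsub>R\<^esub>})"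

definition left_ideal :: "'a set \<Rightarrow> ('a, 'm) ring_scheme \<Rightarrow> bool" where
  "left_ideal I R \<longleftrightarrow> additive_subgroup I R \<and> (\<forall>r\<in>carrier R. \<forall>a\<in>I. r \<otimes>\<^bsub>R\<^esub> a \<in> I)"

definition right_ideal :: "'a set \<Rightarrow> ('a, 'm) ring_scheme \<Rightarrow> bool" where
  "right_ideal I R \<longleftrightarrow> additive_subgroup I R \<and> (\<forall>r\<in>carrier R. \<forall>a\<in>I. a \<otimes>\<^bsub>R\<^esub> r \<in> I)"

definition l_ann :: "('a, 'm) ring_scheme \<Rightarrow> 'a set \<Rightarrow> 'a set" where
  "l_ann R Y = {r \<in> carrier R. \<forall>x\<in>Y. r \<otimes>\<^bsub>R\<^esub> x = \<zero>\<^bsub>R\<^esub>}"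

definition r_ann :: "('a, 'm) ring_scheme \<Rightarrow> 'a set \<Rightarrow> 'a set" where
  "r_ann R Y = {r \<in> carrier R. \<forall>x\<in>Y. x \<otimes>\<^bsub>R\<^esub> r = \<zero>\<^bsub>R\<^esub>}"

definition acc_on :: "'b set set \<Rightarrow> bool" where
  "acc_on F \<longleftrightarrow> \<not> (\<exists>f :: nat \<Rightarrow> 'b set. (\<forall>n. f n \<in> F) \<and> (\<forall>n. f n \<subset> f (Suc n)))"

definition dcc_on :: "'b set set \<Rightarrow> bool" where
  "dcc_on F \<longleftrightarrow> \<not> (\<exists>f :: nat \<Rightarrow> 'b set. (\<forall>n. f n \<in> F) \<and> (\<forall>n. f (Suc n) \<subset> f n))"

definition independent_family :: "('a, 'm) ring_scheme \<Rightarrow> (nat \<Rightarrow> 'a set) \<Rightarrow> bool" where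
  "independent_family R L \<longleftrightarrow> (\<forall>n f. (\<forall>i\<le>n. f i \<in> L i) \<longrightarrow> finsum R f {..n} = \<zero>\<^bsub>R\<^esub>
       \<longrightarrow> (\<forall>i\<le>n. f i = \<zero>\<^bsub>R\<^esub>))"

definition finite_left_udim :: "('a, 'm) ring_scheme \<Rightarrow> bool" where
  "finite_left_udim R \<longleftrightarrow> \<not> (\<exists>L. (\<forall>n. left_ideal (L n) R \<and> L n \<noteq> {\<zero>\<^bsub>R\<^esub>}) \<and> independent_family R L)"

definition finite_right_udim :: "('a, 'm) ring_scheme \<Rightarrow> bool" where
  "finite_right_udim R \<longleftrightarrow> \<not> (\<exists>L. (\<forall>n. right_ideal (L n) R \<and> L n \<noteq> {\<zero>\<^bsub>R\<^esub>}) \<and> independent_family R L)"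

definition left_goldie :: "('a, 'm) ring_scheme \<Rightarrow> bool" where
  "left_goldie R \<longleftrightarrow> finite_left_udim R \<and> acc_on {l_ann R Y | Y. Y \<subseteq> carrier R}"

definition right_goldie :: "('a, 'm) ring_scheme \<Rightarrow> bool" where
  "right_goldie R \<longleftrightarrow> finite_right_udim R \<and> acc_on {r_ann R Y | Y. Y \<subseteq> carrier R}"

definition goldie :: "('a, 'm) ring_scheme \<Rightarrow> bool" where
  "goldie R \<longleftrightarrow> left_goldie R \<and> right_goldie R"

definition simple_ring :: "('a, 'm) ring_scheme \<Rightarrow> bool" where
  "simple_ring A \<longleftrightarrow> \<one>\<^bsub>A\<^esub> \<noteq> \<zero>\<^bsub>A\<^esub> \<and>
     (\<forall>I. ideal I A \<longrightarrow> I = {\<zero>\<^bsub>A\<^esub>} \<or> I = carrier A)"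

definition artinian :: "('a, 'm) ring_scheme \<Rightarrow> bool" where
  "artinian A \<longleftrightarrow> dcc_on {I. left_ideal I A} \<and> dcc_on {I. right_ideal I A}"

definition mult_set :: "('a, 'm) ring_scheme \<Rightarrow> 'a set \<Rightarrow> bool" where
  "mult_set R S \<longleftrightarrow> S \<subseteq> carrier R \<and> (\<forall>s\<in>S. \<forall>t\<in>S. s \<otimes>\<^bsub>R\<^esub> t \<in> S) \<and>
     \<one>\<^bsub>R\<^esub> \<in> S \<and> \<zero>\<^bsub>R\<^esub> \<notin> S"

definition ore_set :: "('a, 'm) ring_scheme \<Rightarrow> 'a set \<Rightarrow> bool" where
  "ore_set R S \<longleftrightarrow> mult_set R S \<and>
     (\<forall>r\<in>carrier R. \<forall>s\<in>S.
        (\<exists>t\<in>S. \<exists>a\<in>carrier R. t \<otimes>\<^bsub>R\<^esub> r = a \<otimes>\<^bsub>R\<^esub> s) \<and>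
        (\<exists>t\<in>S. \<exists>a\<in>carrier R. r \<otimes>\<^bsub>R\<^esub> t = s \<otimes>\<^bsub>R\<^esub> a))"

definition den_set :: "('a, 'm) ring_scheme \<Rightarrow> 'a set \<Rightarrow> bool" where
  "den_set R S \<longleftrightarrow> ore_set R S \<and>
     (\<forall>r\<in>carrier R. \<forall>s\<in>S.
        (r \<otimes>\<^bsub>R\<^esub> s = \<zero>\<^bsub>R\<^esub> \<longrightarrow> (\<exists>t\<in>S. t \<otimes>\<^bsub>R\<^esub> r = \<zero>\<^bsub>R\<^esub>)) \<and>
        (s \<otimes>\<^bsub>R\<^esub> r = \<zero>\<^bsub>R\<^esub> \<longrightarrow> (\<exists>t\<in>S. r \<otimes>\<^bsub>R\<^esub> t = \<zero>\<^bsub>R\<^esub>)))"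

definition Ore :: "('a, 'm) ring_scheme \<Rightarrow> 'a set set" where
  "Ore R = {S. ore_set R S}"

definition Den :: "('a, 'm) ring_scheme \<Rightarrow> 'a set set" where
  "Den R = {S. den_set R S}"

(* Free ring (= free Z-algebra) on an alphabet Y: finitely supported integer
   functions on words over Y, with concatenation (convolution) product. *)
definition free_ring :: "'x set \<Rightarrow> ('x list \<Rightarrow> int) ring" where
  "free_ring Y = \<lparr>carrier = {f. finite {w. f w \<noteq> 0} \<and> (\<forall>w. f w \<noteq> 0 \<longrightarrow> set w \<subseteq> Y)},
     monoid.mult = (\<lambda>f g w. \<Sum>i\<le>length w. f (take i w) * g (drop i w)),
     one = (\<lambda>w. if w = [] then 1 else 0),
     ring.zero = (\<lambda>w. 0),
     add = (\<lambda>f g w. f w + g w)\<rparr>"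

definition word_gen :: "'x list \<Rightarrow> ('x list \<Rightarrow> int)" where
  "word_gen w = (\<lambda>v. if v = w then 1 else 0)"

(* Letters: Inl r stands for the element r \<in> R, Inr s for the variable x_s (s \<in> S). *)
definition loc_alphabet :: "('a, 'm) ring_scheme \<Rightarrow> 'a set \<Rightarrow> ('a + 'a) set" where
  "loc_alphabet R S = Inl ` carrier R \<union> Inr ` S"

definition loc_free :: "('a, 'm) ring_scheme \<Rightarrow> 'a set \<Rightarrow> (('a + 'a) list \<Rightarrow> int) ring" where
  "loc_free R S = free_ring (loc_alphabet R S)"

(* R<X_S>: the free ring on R \<union> X_S modulo the relations making R \<rightarrow> R<X_S> a unital
   ring homomorphism, i.e. the ring freely generated by R and the noncommuting x_s.
   The generators of I_S (sx_s - 1, x_s s - 1) are added to these relations below. *)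
definition loc_rels :: "('a, 'm) ring_scheme \<Rightarrow> 'a set \<Rightarrow> (('a + 'a) list \<Rightarrow> int) set" where
  "loc_rels R S =
     {(\<lambda>w. word_gen [Inl a] w + word_gen [Inl b] w - word_gen [Inl (a \<oplus>\<^bsub>R\<^esub> b)] w) | a b.
         a \<in> carrier R \<and> b \<in> carrier R}
   \<union> {(\<lambda>w. (word_gen [Inl a] \<otimes>\<^bsub>loc_free R S\<^esub> word_gen [Inl b]) w - word_gen [Inl (a \<otimes>\<^bsub>R\<^esub> b)] w) | a b.
         a \<in> carrier R \<and> b \<in> carrier R}
   \<union> {(\<lambda>w. word_gen [Inl \<one>\<^bsub>R\<^esub>] w - word_gen [] w)}"

definition loc_S_rels :: "('a, 'm) ring_scheme \<Rightarrow> 'a set \<Rightarrow> (('a + 'a) list \<Rightarrow> int) set" where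
  "loc_S_rels R S =
     {(\<lambda>w. (word_gen [Inl s] \<otimes>\<^bsub>loc_free R S\<^esub> word_gen [Inr s]) w - word_gen [] w) | s. s \<in> S}
   \<union> {(\<lambda>w. (word_gen [Inr s] \<otimes>\<^bsub>loc_free R S\<^esub> word_gen [Inl s]) w - word_gen [] w) | s. s \<in> S}"

definition loc_ideal :: "('a, 'm) ring_scheme \<Rightarrow> 'a set \<Rightarrow> (('a + 'a) list \<Rightarrow> int) set" where
  "loc_ideal R S = genideal (loc_free R S) (loc_rels R S \<union> loc_S_rels R S)"

definition Loc :: "('a, 'm) ring_scheme \<Rightarrow> 'a set \<Rightarrow> (('a + 'a) list \<Rightarrow> int) set ring" where
  "Loc R S = loc_free R S Quot loc_ideal R S"

definition loc_map :: "('a, 'm) ring_scheme \<Rightarrow> 'a set \<Rightarrow> 'a \<Rightarrow> (('a + 'a) list \<Rightarrow> int) set" where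
  "loc_map R S r = loc_ideal R S +>\<^bsub>loc_free R S\<^esub> word_gen [Inl r]"

definition loc_x :: "('a, 'm) ring_scheme \<Rightarrow> 'a set \<Rightarrow> 'a \<Rightarrow> (('a + 'a) list \<Rightarrow> int) set" where
  "loc_x R S s = loc_ideal R S +>\<^bsub>loc_free R S\<^esub> word_gen [Inr s]"

definition ass :: "('a, 'm) ring_scheme \<Rightarrow> 'a set \<Rightarrow> 'a set" where
  "ass R S = {r \<in> carrier R. loc_map R S r = \<zero>\<^bsub>Loc R S\<^esub>}"

definition Qcl :: "('a, 'm) ring_scheme \<Rightarrow> (('a + 'a) list \<Rightarrow> int) set ring" where
  "Qcl R = Loc R (regular R)"

definition left_localizable :: "('a, 'm) ring_scheme \<Rightarrow> 'a set \<Rightarrow> bool" where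
  "left_localizable R S \<longleftrightarrow> mult_set R S \<and> \<one>\<^bsub>Loc R S\<^esub> \<noteq> \<zero>\<^bsub>Loc R S\<^esub> \<and>
     (\<forall>u\<in>carrier (Loc R S). \<exists>s\<in>S. \<exists>r\<in>carrier R. u = loc_x R S s \<otimes>\<^bsub>Loc R S\<^esub> loc_map R S r)"

definition right_localizable :: "('a, 'm) ring_scheme \<Rightarrow> 'a set \<Rightarrow> bool" where
  "right_localizable R S \<longleftrightarrow> mult_set R S \<and> \<one>\<^bsub>Loc R S\<^esub> \<noteq> \<zero>\<^bsub>Loc R S\<^esub> \<and>
     (\<forall>u\<in>carrier (Loc R S). \<exists>s\<in>S. \<exists>r\<in>carrier R. u = loc_map R S r \<otimes>\<^bsub>Loc R S\<^esub> loc_x R S s)"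

definition localizable :: "('a, 'm) ring_scheme \<Rightarrow> 'a set \<Rightarrow> bool" where
  "localizable R S \<longleftrightarrow> left_localizable R S \<and> right_localizable R S"

definition L_l :: "('a, 'm) ring_scheme \<Rightarrow> 'a set set" where
  "L_l R = {S. left_localizable R S}"

definition L_r :: "('a, 'm) ring_scheme \<Rightarrow> 'a set set" where
  "L_r R = {S. right_localizable R S}"

definition L_lr :: "('a, 'm) ring_scheme \<Rightarrow> 'a set set" where
  "L_lr R = {S. localizable R S}"

definition Cp :: "('a, 'm) ring_scheme \<Rightarrow> 'a set \<Rightarrow> 'a set" where
  "Cp R P = {c \<in> carrier R. P +>\<^bsub>R\<^esub> c \<in> regular (R Quot P)}"

definition prod_ring :: "'i set \<Rightarrow> ('i \<Rightarrow> ('b, 'n) ring_scheme) \<Rightarrow> ('i \<Rightarrow> 'b) ring" where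
  "prod_ring I F = \<lparr>carrier = (\<Pi>\<^sub>E i\<in>I. carrier (F i)),
     monoid.mult = (\<lambda>f g. \<lambda>i\<in>I. f i \<otimes>\<^bsub>F i\<^esub> g i),
     one = (\<lambda>i\<in>I. \<one>\<^bsub>F i\<^esub>),
     ring.zero = (\<lambda>i\<in>I. \<zero>\<^bsub>F i\<^esub>),
     add = (\<lambda>f g. \<lambda>i\<in>I. f i \<oplus>\<^bsub>F i\<^esub> g i)\<rparr>"

end

theory Submission
  imports Defs
begin

text \<open>By Goldie's argument every essential one-sided ideal contains a regular element, so the regular
  elements form an Ore set. The minimal primes are the maximal annihilator ideals; for such a prime
  \<open>P\<close> the ideal \<open>P + ann P\<close> is essential, hence contains a regular element \<open>b + x\<close> with
  \<open>b \<in> ann P\<close> and \<open>x \<in> P\<close>. Multiplying by \<open>b\<close> kills \<open>P\<close>, which carries the Ore condition from the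
  regular elements over to \<open>\<C>(P)\<close> and shows that the torsion ideal of \<open>\<C>(P)\<close> is \<open>P\<close>.

  Conversely, if \<open>S\<close> is an Ore set, or becomes invertible in a nonzero ring together with all regular
  elements, then the elements that \<open>S\<close> annihilates, resp. the kernel of the localization map, form
  an annihilator ideal modulo which \<open>S\<close> is regular. Then \<open>S\<close> is also regular modulo every minimal
  prime above that ideal. All maximality statements follow, because \<open>\<C>(P)\<close> determines \<open>P\<close>.

  The localization at \<open>\<C>(P)\<close> is Artinian: complements of left ideals turn a descending chain into an
  infinite direct sum, which pulls back to \<open>R\<close>.\<close>

section \<open>Free rings\<close>

text \<open>\<open>Loc R S\<close> is a quotient of a free ring, so its elements have no normal form
  and it is not visible which elements of \<open>R\<close> survive in it. Two facts replace a
  construction of fractions: homomorphisms that invert \<open>S\<close> extend to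
  \<open>Loc R S\<close>, and the image of \<open>R\<close> together with the elements
  \<open>loc_x R S s\<close> generates it. To bound the kernel from above, a concrete ring is needed
  in which \<open>S\<close> becomes invertible; endomorphisms of germs supply one. Arguments are
  given for one side and carried to the other through the opposite ring. Hence fractions are
  described relative to an arbitrary homomorphism: the localization of \<open>opp R\<close> is not
  literally the opposite of the localization of \<open>R\<close>. For localizable sets, the
  inclusion of the regular elements in \<open>S\<close> makes the kernel an annihilator ideal,
  because regular elements then cancel modulo it. For Ore sets the chain conditions on annihilators
  do this job: a single element of \<open>S\<close> kills everything that any element of
  \<open>S\<close> kills on that side.\<close>

definition conv :: "('x list \<Rightarrow> int) \<Rightarrow> ('x list \<Rightarrow> int) \<Rightarrow> 'x list \<Rightarrow> int" where
  "conv f g w = (\<Sum>i\<le>length w. f (take i w) * g (drop i w))"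

lemma conv_Nil: "conv f g [] = f [] * g []"
  by (simp add: conv_def)

text \<open>Splitting off the empty prefix leaves a convolution with the left derivative of
  \<open>f\<close> by the letter \<open>x\<close>. This recursion turns identities for
  \<open>conv\<close> into inductions over words, valid for all integer functions because each word
  has finitely many splittings.\<close>

lemma conv_Cons: "conv f g (x # w) = f [] * g (x # w) + conv (\<lambda>v. f (x # v)) g w"
  unfolding conv_def by (simp add: sum.atMost_Suc_shift del: sum.atMost_Suc)

lemma conv_add_left: "conv (\<lambda>w. f w + g w) h w = conv f h w + conv g h w"
  by (simp add: conv_def distrib_right sum.distrib)

lemma conv_add_right: "conv h (\<lambda>w. f w + g w) w = conv h f w + conv h g w"
  by (simp add: conv_def distrib_left sum.distrib)

lemma conv_scale_left: "conv (\<lambda>w. k * f w) h w = k * conv f h w"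
  by (simp add: conv_def sum_distrib_left mult.assoc)

lemma conv_neg_left: "conv (\<lambda>w. - f w) h = (\<lambda>w. - conv f h w)"
  by (simp add: conv_def sum_negf fun_eq_iff)

lemma conv_neg_right: "conv h (\<lambda>w. - f w) = (\<lambda>w. - conv h f w)"
  by (simp add: conv_def sum_negf fun_eq_iff)

lemma conv_assoc: "conv (conv f g) h w = conv f (conv g h) w"
proof (induction w arbitrary: f g h)
  case Nil
  show ?case by (simp add: conv_Nil)
next
  case (Cons x w)
  \<comment> \<open>A product rule: the derivative of \<open>conv f g\<close> by \<open>x\<close> is
    a scalar multiple of the derivative of \<open>g\<close> plus a convolution with the derivative
    of \<open>f\<close>. This is why the induction generalizes over the functions.\<close>
  have "conv (\<lambda>v. conv f g (x # v)) h w
      = f [] * conv (\<lambda>v. g (x # v)) h w + conv (conv (\<lambda>v. f (x # v)) g) h w"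
    by (simp add: conv_Cons conv_add_left conv_scale_left)
  then show ?case
    by (simp add: conv_Cons conv_Nil Cons.IH algebra_simps)
qed

lemma conv_word_gen: "conv (word_gen u) (word_gen v) = word_gen (u @ v)"
proof
  fix w :: "'a list"
  have "conv (word_gen u) (word_gen v) w = (\<Sum>i\<le>length w. if i = length u then word_gen (u @ v) w else 0)"
    unfolding conv_def
  proof (rule sum.cong[OF refl])
    fix i assume "i \<in> {..length w}"
    then have "take i w = u \<and> drop i w = v \<longleftrightarrow> i = length u \<and> w = u @ v"
      by (auto simp: append_eq_conv_conj)
    then show "word_gen u (take i w) * word_gen v (drop i w) = (if i = length u then word_gen (u @ v) w else 0)"
      unfolding word_gen_def
      by (cases "take i w = u"; cases "drop i w = v"; cases "i = length u"; cases "w = u @ v") simp_all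
  qed
  also have "\<dots> = word_gen (u @ v) w"
    by (auto simp: word_gen_def)
  finally show "conv (word_gen u) (word_gen v) w = word_gen (u @ v) w" .
qed

lemma conv_one_left: "conv (word_gen []) f = f"
proof
  fix w show "conv (word_gen []) f w = f w"
  proof (cases w)
    case (Cons x v)
    have "conv (\<lambda>v. word_gen [] (x # v)) f v = 0" by (simp add: conv_def word_gen_def)
    then show ?thesis by (simp add: Cons conv_Cons word_gen_def)
  qed (simp add: conv_Nil word_gen_def)
qed

lemma conv_one_right: "conv f (word_gen []) = f"
proof
  fix w show "conv f (word_gen []) w = f w"
    by (induction w arbitrary: f) (simp_all add: conv_Nil conv_Cons word_gen_def)
qed

lemma conv_support: "{w. conv f g w \<noteq> 0} \<subseteq> (\<lambda>(u, v). u @ v) ` ({w. f w \<noteq> 0} \<times> {w. g w \<noteq> 0})"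
proof
  fix w assume "w \<in> {w. conv f g w \<noteq> 0}"
  then obtain i where "f (take i w) * g (drop i w) \<noteq> 0"
    unfolding conv_def by (auto elim: sum.not_neutral_contains_not_neutral)
  then show "w \<in> (\<lambda>(u, v). u @ v) ` ({w. f w \<noteq> 0} \<times> {w. g w \<noteq> 0})"
    by (intro image_eqI[where x = "(take i w, drop i w)"]) auto
qed

lemma free_ring_simps:
  "carrier (free_ring Y) = {f. finite {w. f w \<noteq> 0} \<and> (\<forall>w. f w \<noteq> 0 \<longrightarrow> set w \<subseteq> Y)}"
  "f \<otimes>\<^bsub>free_ring Y\<^esub> g = conv f g"
  "\<one>\<^bsub>free_ring Y\<^esub> = word_gen []"
  "\<zero>\<^bsub>free_ring Y\<^esub> = (\<lambda>w. 0)"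
  "f \<oplus>\<^bsub>free_ring Y\<^esub> g = (\<lambda>w. f w + g w)"
  by (auto simp: free_ring_def conv_def word_gen_def fun_eq_iff)

lemma free_ring_closed:
  assumes "f \<in> carrier (free_ring Y)" "g \<in> carrier (free_ring Y)"
  shows "(\<lambda>w. f w + g w) \<in> carrier (free_ring Y)" "(\<lambda>w. - f w) \<in> carrier (free_ring Y)"
    "conv f g \<in> carrier (free_ring Y)"
proof -
  have "{w. f w + g w \<noteq> 0} \<subseteq> {w. f w \<noteq> 0} \<union> {w. g w \<noteq> 0}" by auto
  then have "finite {w. f w + g w \<noteq> 0}"
    by (rule finite_subset) (use assms in \<open>simp add: free_ring_simps\<close>)
  moreover have "set w \<subseteq> Y" if "f w + g w \<noteq> 0" for w
    using assms that by (cases "f w = 0") (auto simp: free_ring_simps)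
  ultimately show "(\<lambda>w. f w + g w) \<in> carrier (free_ring Y)"
    by (simp add: free_ring_simps)
  show "(\<lambda>w. - f w) \<in> carrier (free_ring Y)" using assms by (simp add: free_ring_simps)
  have "finite {w. conv f g w \<noteq> 0}"
    by (rule finite_subset[OF conv_support]) (use assms in \<open>auto simp: free_ring_simps\<close>)
  moreover have "set w \<subseteq> Y" if "conv f g w \<noteq> 0" for w
  proof -
    obtain u v where "w = u @ v" "f u \<noteq> 0" "g v \<noteq> 0"
      using conv_support[of f g] \<open>conv f g w \<noteq> 0\<close> by auto
    then show ?thesis using assms by (simp add: free_ring_simps)
  qed
  ultimately show "conv f g \<in> carrier (free_ring Y)"
    by (simp add: free_ring_simps)
qed

lemma word_gen_closed: "set w \<subseteq> Y \<Longrightarrow> word_gen w \<in> carrier (free_ring Y)"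
  by (auto simp: free_ring_simps word_gen_def)

lemma free_ring_ring: "ring (free_ring Y)"
proof (rule ringI)
  have inv: "\<exists>g\<in>carrier (free_ring Y). (\<lambda>w. f w + g w) = (\<lambda>w. 0)" if "f \<in> carrier (free_ring Y)" for f
    by (rule bexI[where x = "\<lambda>w. - f w"]) (use free_ring_closed(2)[OF that that] in auto)
  show "abelian_group (free_ring Y)"
    by (rule abelian_groupI, unfold free_ring_simps(4,5))
      (auto simp: free_ring_closed inv algebra_simps, simp add: free_ring_simps)
  show "Group.monoid (free_ring Y)"
    by (rule monoidI)
      (auto simp: free_ring_simps(2,3) free_ring_closed conv_one_left conv_one_right word_gen_closed
        fun_eq_iff conv_assoc)
qed (auto simp: free_ring_simps(2,5) fun_eq_iff conv_add_left conv_add_right)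

text \<open>The words generate the additive group of the free ring. With words as the base case,
  additive and biadditive identities need to be checked only on words.\<close>

lemma free_ring_induct [consumes 1, case_names zero add neg word]:
  assumes f: "f \<in> carrier (free_ring Y)"
    and zero: "P (\<lambda>w. 0)"
    and add: "\<And>f g. f \<in> carrier (free_ring Y) \<Longrightarrow> g \<in> carrier (free_ring Y) \<Longrightarrow> P f \<Longrightarrow> P g \<Longrightarrow>
      P (\<lambda>w. f w + g w)"
    and neg: "\<And>f. f \<in> carrier (free_ring Y) \<Longrightarrow> P f \<Longrightarrow> P (\<lambda>w. - f w)"
    and word: "\<And>w. set w \<subseteq> Y \<Longrightarrow> P (word_gen w)"
  shows "P f"
proof -
  have mult: "(\<lambda>v. k * word_gen w v) \<in> carrier (free_ring Y) \<and> P (\<lambda>v. k * word_gen w v)"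
    if w: "set w \<subseteq> Y" for k :: int and w
  proof -
    note W = word_gen_closed[OF w] word[OF w]
    have nonneg: "(\<lambda>v. int n * word_gen w v) \<in> carrier (free_ring Y) \<and> P (\<lambda>v. int n * word_gen w v)" for n
    proof (induction n)
      case 0
      show ?case using zero by (simp add: free_ring_simps)
    next
      case (Suc n)
      have "(\<lambda>v. int (Suc n) * word_gen w v) = (\<lambda>v. word_gen w v + int n * word_gen w v)"
        by (simp add: algebra_simps)
      then show ?case
        using Suc W add[OF W(1) _ W(2), of "\<lambda>v. int n * word_gen w v"] free_ring_closed(1)[OF W(1)] by simp
    qed
    show ?thesis
    proof (cases k)
      case (neg n)
      then have "(\<lambda>v. k * word_gen w v) = (\<lambda>v. - (int (Suc n) * word_gen w v))"
        by (simp only: mult_minus_left)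
      then show ?thesis
        using nonneg[of "Suc n"] assms(4)[of "\<lambda>v. int (Suc n) * word_gen w v"] 
          free_ring_closed(2)[of "\<lambda>v. int (Suc n) * word_gen w v" Y "\<lambda>v. int (Suc n) * word_gen w v"]
        by (simp del: of_nat_Suc)
    qed (use nonneg in simp)
  qed
  \<comment> \<open>Containment of the support in \<open>A\<close>, not equality, is what the
    induction carries: clearing the coefficient at the new word leaves a function supported in the
    smaller set.\<close>
  have "\<forall>f\<in>carrier (free_ring Y). {w. f w \<noteq> 0} \<subseteq> A \<longrightarrow> P f" if "finite A" for A
    using that
  proof induction
    case empty
    show ?case
    proof (intro ballI impI)
      fix f :: "'a list \<Rightarrow> int" assume "{w. f w \<noteq> 0} \<subseteq> {}"
      then have "f = (\<lambda>w. 0)" by auto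
      show "P f" unfolding \<open>f = (\<lambda>w. 0)\<close> by (rule zero)
    qed
  next
    case (insert w A)
    show ?case
    proof (intro ballI impI)
      fix f assume f: "f \<in> carrier (free_ring Y)" and sub: "{v. f v \<noteq> 0} \<subseteq> insert w A"
      have g: "f(w := 0) \<in> carrier (free_ring Y)"
        using f by (auto simp: free_ring_simps elim!: rev_finite_subset)
      have "{v. (f(w := 0)) v \<noteq> 0} \<subseteq> A" using sub by auto
      then have "P (f(w := 0))" using insert.IH g by blast
      show "P f"
      proof (cases "f w = 0")
        case True
        then show ?thesis using \<open>P (f(w := 0))\<close> by (simp add: fun_upd_idem)
      next
        case False
        then have "set w \<subseteq> Y" using f by (simp add: free_ring_simps)
        note m = mult[OF this, of "f w"]
        have "f = (\<lambda>v. (f(w := 0)) v + f w * word_gen w v)" by (auto simp: word_gen_def fun_eq_iff)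
        then show ?thesis using add[OF g _ \<open>P (f(w := 0))\<close>, of "\<lambda>v. f w * word_gen w v"] m by simp
      qed
    qed
  qed
  then show ?thesis using f by (auto simp: free_ring_simps)
qed

section \<open>Evaluation of free ring elements in an arbitrary ring\<close>

definition word_val :: "('b, 'n) ring_scheme \<Rightarrow> ('x \<Rightarrow> 'b) \<Rightarrow> 'x list \<Rightarrow> 'b" where
  "word_val A \<eta> w = foldr (\<lambda>x a. \<eta> x \<otimes>\<^bsub>A\<^esub> a) w \<one>\<^bsub>A\<^esub>"

definition free_ev :: "('b, 'n) ring_scheme \<Rightarrow> ('x \<Rightarrow> 'b) \<Rightarrow> ('x list \<Rightarrow> int) \<Rightarrow> 'b" where
  "free_ev A \<eta> f = (\<Oplus>\<^bsub>A\<^esub>w\<in>{w. f w \<noteq> 0}. add_pow A (f w) (word_val A \<eta> w))"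

context ring
begin

lemma word_val_closed: "\<eta> \<in> Y \<rightarrow> carrier R \<Longrightarrow> set w \<subseteq> Y \<Longrightarrow> word_val R \<eta> w \<in> carrier R"
  by (induction w) (auto simp: word_val_def)

lemma word_val_append:
  "\<eta> \<in> Y \<rightarrow> carrier R \<Longrightarrow> set u \<subseteq> Y \<Longrightarrow> set v \<subseteq> Y \<Longrightarrow> word_val R \<eta> (u @ v) = word_val R \<eta> u \<otimes> word_val R \<eta> v"
proof (induction u)
  case Nil
  then show ?case using word_val_closed[of \<eta> Y v] by (simp add: word_val_def)
next
  case (Cons x u)
  then have "\<eta> x \<in> carrier R" by auto
  then show ?case using Cons word_val_closed[of \<eta> Y v] word_val_closed[of \<eta> Y u]
    by (simp add: word_val_def m_assoc)
qed

text \<open>Terms with coefficient zero vanish, so evaluations of functions with different supports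
  can be compared over one common finite index set.\<close>

lemma free_ev_superset:
  assumes "\<eta> \<in> Y \<rightarrow> carrier R" "f \<in> carrier (free_ring Y)" "finite W" "{w. f w \<noteq> 0} \<subseteq> W"
    "\<And>w. w \<in> W \<Longrightarrow> set w \<subseteq> Y"
  shows "free_ev R \<eta> f = (\<Oplus>w\<in>W. add_pow R (f w) (word_val R \<eta> w))"
  unfolding free_ev_def
proof (rule add.finprod_mono_neutral_cong_left)
  show "add_pow R (f w) (word_val R \<eta> w) = \<zero>" if "w \<in> W - {w. f w \<noteq> 0}" for w
    using that by (auto simp: add_pow_def)
  show "(\<lambda>w. add_pow R (f w) (word_val R \<eta> w)) \<in> W \<rightarrow> carrier R"
    using assms(5) word_val_closed[OF assms(1)] by simp
qed (use assms in auto)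

lemma free_ev_add:
  assumes \<eta>: "\<eta> \<in> Y \<rightarrow> carrier R" and f: "f \<in> carrier (free_ring Y)" and g: "g \<in> carrier (free_ring Y)"
  shows "free_ev R \<eta> (\<lambda>w. f w + g w) = free_ev R \<eta> f \<oplus> free_ev R \<eta> g"
proof -
  let ?W = "{w. f w \<noteq> 0} \<union> {w. g w \<noteq> 0}"
  have W: "finite ?W" "\<And>w. w \<in> ?W \<Longrightarrow> set w \<subseteq> Y" using f g by (auto simp: free_ring_simps)
  have "free_ev R \<eta> (\<lambda>w. f w + g w) = (\<Oplus>w\<in>?W. add_pow R (f w + g w) (word_val R \<eta> w))"
    by (rule free_ev_superset[OF \<eta> free_ring_closed(1)[OF f g] W(1) _ W(2)]) auto
  also have "\<dots> = (\<Oplus>w\<in>?W. add_pow R (f w) (word_val R \<eta> w) \<oplus> add_pow R (g w) (word_val R \<eta> w))"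
    by (rule finsum_cong') (use W(2) word_val_closed[OF \<eta>] in \<open>simp_all add: add.int_pow_mult Pi_def\<close>)
  also have "\<dots> = (\<Oplus>w\<in>?W. add_pow R (f w) (word_val R \<eta> w)) \<oplus> (\<Oplus>w\<in>?W. add_pow R (g w) (word_val R \<eta> w))"
    by (rule finsum_addf) (use W(2) word_val_closed[OF \<eta>] in \<open>simp_all add: Pi_def\<close>)
  also have "\<dots> = free_ev R \<eta> f \<oplus> free_ev R \<eta> g"
    using free_ev_superset[OF \<eta> f W(1) _ W(2)] free_ev_superset[OF \<eta> g W(1) _ W(2)] by auto
  finally show ?thesis .
qed

lemma free_ev_closed:
  assumes "\<eta> \<in> Y \<rightarrow> carrier R" "f \<in> carrier (free_ring Y)"
  shows "free_ev R \<eta> f \<in> carrier R"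
proof -
  have "word_val R \<eta> w \<in> carrier R" if "f w \<noteq> 0" for w
    using assms that by (intro word_val_closed) (auto simp: free_ring_simps)
  then show ?thesis unfolding free_ev_def by (intro finsum_closed) simp
qed

lemma free_ev_word_gen:
  assumes "\<eta> \<in> Y \<rightarrow> carrier R" "set w \<subseteq> Y"
  shows "free_ev R \<eta> (word_gen w) = word_val R \<eta> w"
proof -
  have "{v. word_gen w v \<noteq> 0} = {w}" by (auto simp: word_gen_def)
  then show ?thesis using word_val_closed[OF assms]
    by (simp add: free_ev_def word_gen_def finsum_insert add.int_pow_1)
qed

lemma free_ev_zero: "free_ev R \<eta> (\<lambda>w. 0) = \<zero>"
  by (simp add: free_ev_def)

lemma free_ev_neg:
  assumes "\<eta> \<in> Y \<rightarrow> carrier R" "f \<in> carrier (free_ring Y)"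
  shows "free_ev R \<eta> (\<lambda>w. - f w) = \<ominus> free_ev R \<eta> f"
proof -
  note m = free_ev_closed[OF assms(1) free_ring_closed(2)[OF assms(2) assms(2)]]
  have "free_ev R \<eta> (\<lambda>w. - f w) \<oplus> free_ev R \<eta> f = \<zero>"
    using free_ev_add[OF assms(1) free_ring_closed(2)[OF assms(2) assms(2)] assms(2)] by (simp add: free_ev_zero)
  then show ?thesis using minus_equality[OF _ free_ev_closed[OF assms] m] by simp
qed

text \<open>Both sides are biadditive. The second factor is reduced to words while the first is a
  fixed word, then the first factor is reduced; on words the claim is concatenation.\<close>

lemma free_ev_conv:
  assumes \<eta>: "\<eta> \<in> Y \<rightarrow> carrier R" and f: "f \<in> carrier (free_ring Y)" and g: "g \<in> carrier (free_ring Y)"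
  shows "free_ev R \<eta> (conv f g) = free_ev R \<eta> f \<otimes> free_ev R \<eta> g"
proof -
  have word: "free_ev R \<eta> (conv (word_gen u) g) = free_ev R \<eta> (word_gen u) \<otimes> free_ev R \<eta> g"
    if u: "set u \<subseteq> Y" for u
    using g
  proof (induction rule: free_ring_induct)
    case zero
    have "conv (word_gen u) (\<lambda>w. 0) = (\<lambda>w. 0)" by (simp add: conv_def fun_eq_iff)
    then show ?case using free_ev_closed[OF \<eta> word_gen_closed[OF u]] by (simp add: free_ev_zero)
  next
    case (add g h)
    note c = word_gen_closed[OF u]
    have "free_ev R \<eta> (conv (word_gen u) (\<lambda>w. g w + h w))
      = free_ev R \<eta> (conv (word_gen u) g) \<oplus> free_ev R \<eta> (conv (word_gen u) h)"
      unfolding conv_add_right using free_ev_add[OF \<eta>] free_ring_closed(3)[OF c] add by simp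
    then show ?case using add free_ev_closed[OF \<eta>] c free_ev_add[OF \<eta>] by (simp add: r_distr)
  next
    case (neg g)
    note c = word_gen_closed[OF u]
    show ?case using neg free_ev_neg[OF \<eta>] free_ring_closed(3)[OF c] free_ev_closed[OF \<eta>] c
      by (simp add: conv_neg_right r_minus)
  next
    case (word v)
    have "set (u @ v) \<subseteq> Y" using u word by simp
    then show ?case
      using u word by (simp only: conv_word_gen free_ev_word_gen[OF \<eta>] word_val_append[OF \<eta>])
  qed
  show ?thesis using f
  proof (induction rule: free_ring_induct)
    case zero
    have "conv (\<lambda>w. 0) g = (\<lambda>w. 0)" by (simp add: conv_def fun_eq_iff)
    then show ?case using free_ev_closed[OF \<eta> g] by (simp add: free_ev_zero)
  next
    case (add f h)
    have "free_ev R \<eta> (conv (\<lambda>w. f w + h w) g) = free_ev R \<eta> (conv f g) \<oplus> free_ev R \<eta> (conv h g)"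
      unfolding conv_add_left using free_ev_add[OF \<eta>] free_ring_closed(3)[OF _ g] add by simp
    then show ?case using add free_ev_closed[OF \<eta>] g free_ev_add[OF \<eta>] by (simp add: l_distr)
  next
    case (neg f)
    show ?case using neg free_ev_neg[OF \<eta>] free_ring_closed(3)[OF _ g] free_ev_closed[OF \<eta>] g
      by (simp add: conv_neg_left l_minus)
  next
    case (word u)
    then show ?case by (rule \<open>\<And>u. set u \<subseteq> Y \<Longrightarrow> free_ev R \<eta> (conv (word_gen u) g) = free_ev R \<eta> (word_gen u) \<otimes> free_ev R \<eta> g\<close>)
  qed
qed

lemma free_ev_hom:
  assumes "\<eta> \<in> Y \<rightarrow> carrier R"
  shows "free_ev R \<eta> \<in> ring_hom (free_ring Y) R"
  by (rule ring_hom_memI)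
    (use assms free_ev_word_gen[OF assms, of "[]"] in
      \<open>auto simp: free_ring_simps(2,3,5) free_ev_closed free_ev_conv free_ev_add word_val_def\<close>)

end

section \<open>Universal localization\<close>

lemma free_ring_minus:
  assumes "f \<in> carrier (free_ring Y)" "g \<in> carrier (free_ring Y)"
  shows "f \<ominus>\<^bsub>free_ring Y\<^esub> g = (\<lambda>w. f w - g w)"
proof -
  interpret ring "free_ring Y" by (rule free_ring_ring)
  have "\<ominus>\<^bsub>free_ring Y\<^esub> g = (\<lambda>w. - g w)"
    by (rule minus_equality) (use assms free_ring_closed(2)[of g] in \<open>auto simp: free_ring_simps(4,5)\<close>)
  then show ?thesis by (simp add: a_minus_def free_ring_simps(5))
qed

locale localization = ring R for R (structure) + fixes S
  assumes S_carrier: "S \<subseteq> carrier R"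
begin

abbreviation "F \<equiv> loc_free R S"
abbreviation "I \<equiv> loc_ideal R S"
abbreviation "L \<equiv> Loc R S"

sublocale F: ring F
  unfolding loc_free_def by (rule free_ring_ring)

lemma letter_closed:
  "r \<in> carrier R \<Longrightarrow> word_gen [Inl r] \<in> carrier F" "s \<in> S \<Longrightarrow> word_gen [Inr s] \<in> carrier F"
  "word_gen [] \<in> carrier F"
  by (auto simp: loc_free_def loc_alphabet_def intro!: word_gen_closed)

lemma F_simps:
  "f \<otimes>\<^bsub>F\<^esub> g = conv f g" "\<one>\<^bsub>F\<^esub> = word_gen []" "\<zero>\<^bsub>F\<^esub> = (\<lambda>w. 0)" "f \<oplus>\<^bsub>F\<^esub> g = (\<lambda>w. f w + g w)"
  by (simp_all add: loc_free_def free_ring_simps)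

lemma F_minus: "f \<in> carrier F \<Longrightarrow> g \<in> carrier F \<Longrightarrow> f \<ominus>\<^bsub>F\<^esub> g = (\<lambda>w. f w - g w)"
  by (simp add: loc_free_def free_ring_minus)

text \<open>The relations are given pointwise as integer functions. Writing them with the operations
  of the ring \<open>F\<close> lets homomorphisms and cosets act on them by the general ring
  laws.\<close>

lemma loc_rels_alt:
  "loc_rels R S = {(word_gen [Inl a] \<oplus>\<^bsub>F\<^esub> word_gen [Inl b]) \<ominus>\<^bsub>F\<^esub> word_gen [Inl (a \<oplus> b)] | a b. a \<in> carrier R \<and> b \<in> carrier R}
   \<union> {(word_gen [Inl a] \<otimes>\<^bsub>F\<^esub> word_gen [Inl b]) \<ominus>\<^bsub>F\<^esub> word_gen [Inl (a \<otimes> b)] | a b. a \<in> carrier R \<and> b \<in> carrier R}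
   \<union> {word_gen [Inl \<one>] \<ominus>\<^bsub>F\<^esub> \<one>\<^bsub>F\<^esub>}"
proof -
  have "(\<lambda>w. word_gen [Inl a] w + word_gen [Inl b] w - word_gen [Inl (a \<oplus> b)] w)
      = (word_gen [Inl a] \<oplus>\<^bsub>F\<^esub> word_gen [Inl b]) \<ominus>\<^bsub>F\<^esub> word_gen [Inl (a \<oplus> b)]"
    if "a \<in> carrier R" "b \<in> carrier R" for a b
    using F_minus[OF F.a_closed[OF letter_closed(1) letter_closed(1)] letter_closed(1), of a b "a \<oplus> b"] that
    by (simp add: F_simps(4))
  moreover have "(\<lambda>w. (word_gen [Inl a] \<otimes>\<^bsub>F\<^esub> word_gen [Inl b]) w - word_gen [Inl (a \<otimes> b)] w)
      = (word_gen [Inl a] \<otimes>\<^bsub>F\<^esub> word_gen [Inl b]) \<ominus>\<^bsub>F\<^esub> word_gen [Inl (a \<otimes> b)]"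
    if "a \<in> carrier R" "b \<in> carrier R" for a b
    using F_minus[OF F.m_closed[OF letter_closed(1) letter_closed(1)] letter_closed(1), of a b "a \<otimes> b"] that
    by simp
  moreover have "(\<lambda>w. word_gen [Inl \<one>] w - word_gen [] w) = word_gen [Inl \<one>] \<ominus>\<^bsub>F\<^esub> \<one>\<^bsub>F\<^esub>"
    using F_minus[OF letter_closed(1) letter_closed(3)] by (simp add: F_simps(2))
  ultimately show ?thesis
    unfolding loc_rels_def by (simp cong: rev_conj_cong)
qed

lemma loc_S_rels_alt:
  "loc_S_rels R S = {(word_gen [Inl s] \<otimes>\<^bsub>F\<^esub> word_gen [Inr s]) \<ominus>\<^bsub>F\<^esub> \<one>\<^bsub>F\<^esub> | s. s \<in> S}
   \<union> {(word_gen [Inr s] \<otimes>\<^bsub>F\<^esub> word_gen [Inl s]) \<ominus>\<^bsub>F\<^esub> \<one>\<^bsub>F\<^esub> | s. s \<in> S}"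
proof -
  have "(\<lambda>w. (word_gen [Inl s] \<otimes>\<^bsub>F\<^esub> word_gen [Inr s]) w - word_gen [] w)
      = (word_gen [Inl s] \<otimes>\<^bsub>F\<^esub> word_gen [Inr s]) \<ominus>\<^bsub>F\<^esub> \<one>\<^bsub>F\<^esub>"
    "(\<lambda>w. (word_gen [Inr s] \<otimes>\<^bsub>F\<^esub> word_gen [Inl s]) w - word_gen [] w)
      = (word_gen [Inr s] \<otimes>\<^bsub>F\<^esub> word_gen [Inl s]) \<ominus>\<^bsub>F\<^esub> \<one>\<^bsub>F\<^esub>"
    if "s \<in> S" for s
    using F_minus[OF F.m_closed[OF letter_closed(1) letter_closed(2)] letter_closed(3), of s s]
      F_minus[OF F.m_closed[OF letter_closed(2) letter_closed(1)] letter_closed(3), of s s] that S_carrier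
    by (auto simp: F_simps(2))
  then show ?thesis
    unfolding loc_S_rels_def by (simp cong: rev_conj_cong)
qed

lemma rels_closed: "loc_rels R S \<union> loc_S_rels R S \<subseteq> carrier F"
  unfolding loc_rels_alt loc_S_rels_alt
  using S_carrier by (auto intro!: F.minus_closed F.a_closed F.m_closed letter_closed)

sublocale I: ideal I F
  unfolding loc_ideal_def by (rule F.genideal_ideal[OF rels_closed])

sublocale L: ring L
  unfolding Loc_def by (rule I.quotient_is_ring)

lemma coset_eqI: "f \<in> carrier F \<Longrightarrow> g \<in> carrier F \<Longrightarrow> f \<ominus>\<^bsub>F\<^esub> g \<in> I \<Longrightarrow> I +>\<^bsub>F\<^esub> f = I +>\<^bsub>F\<^esub> g"
  using F.quotient_eq_iff_same_a_r_cos[OF I.ideal_axioms] by simp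

lemma rel_mem: "f \<in> loc_rels R S \<union> loc_S_rels R S \<Longrightarrow> f \<in> I"
  unfolding loc_ideal_def using F.genideal_self[OF rels_closed] by blast

lemma L_simps:
  "f \<in> carrier F \<Longrightarrow> g \<in> carrier F \<Longrightarrow> (I +>\<^bsub>F\<^esub> f) \<otimes>\<^bsub>L\<^esub> (I +>\<^bsub>F\<^esub> g) = I +>\<^bsub>F\<^esub> (f \<otimes>\<^bsub>F\<^esub> g)"
  "f \<in> carrier F \<Longrightarrow> g \<in> carrier F \<Longrightarrow> (I +>\<^bsub>F\<^esub> f) \<oplus>\<^bsub>L\<^esub> (I +>\<^bsub>F\<^esub> g) = I +>\<^bsub>F\<^esub> (f \<oplus>\<^bsub>F\<^esub> g)"
  "\<one>\<^bsub>L\<^esub> = I +>\<^bsub>F\<^esub> \<one>\<^bsub>F\<^esub>"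
  "f \<in> carrier F \<Longrightarrow> I +>\<^bsub>F\<^esub> f \<in> carrier L"
  "\<zero>\<^bsub>L\<^esub> = I +>\<^bsub>F\<^esub> \<zero>\<^bsub>F\<^esub>"
  unfolding Loc_def
  by (simp_all add: FactRing_def I.rcoset_mult_add I.a_rcos_sum F.a_rcosetsI[OF I.a_subset]
      F.a_coset_add_zero[OF I.a_subset])

lemma L_cases:
  assumes "u \<in> carrier L" obtains f where "f \<in> carrier F" "u = I +>\<^bsub>F\<^esub> f"
  using assms unfolding Loc_def FactRing_simps by auto

lemma loc_map_hom: "loc_map R S \<in> ring_hom R L"
proof (rule ring_hom_memI)
  fix a b assume ab: "a \<in> carrier R" "b \<in> carrier R"
  show "loc_map R S a \<in> carrier L" using ab by (simp add: loc_map_def L_simps letter_closed)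
  show "loc_map R S (a \<otimes> b) = loc_map R S a \<otimes>\<^bsub>L\<^esub> loc_map R S b"
    unfolding loc_map_def using ab
    by (subst L_simps, simp_all add: letter_closed, intro coset_eqI[symmetric] rel_mem)
      (auto simp: letter_closed loc_rels_alt)
  show "loc_map R S (a \<oplus> b) = loc_map R S a \<oplus>\<^bsub>L\<^esub> loc_map R S b"
    unfolding loc_map_def using ab
    by (subst L_simps, simp_all add: letter_closed, intro coset_eqI[symmetric] rel_mem)
      (auto simp: letter_closed loc_rels_alt)
next
  show "loc_map R S \<one> = \<one>\<^bsub>L\<^esub>"
    unfolding loc_map_def L_simps
    by (intro coset_eqI rel_mem) (auto simp: letter_closed loc_rels_alt)
qed

lemma loc_x_closed: "s \<in> S \<Longrightarrow> loc_x R S s \<in> carrier L"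
  by (simp add: loc_x_def L_simps letter_closed)

lemma loc_map_x:
  assumes "s \<in> S"
  shows "loc_map R S s \<otimes>\<^bsub>L\<^esub> loc_x R S s = \<one>\<^bsub>L\<^esub>" "loc_x R S s \<otimes>\<^bsub>L\<^esub> loc_map R S s = \<one>\<^bsub>L\<^esub>"
proof -
  have s: "s \<in> carrier R" using assms S_carrier by auto
  show "loc_map R S s \<otimes>\<^bsub>L\<^esub> loc_x R S s = \<one>\<^bsub>L\<^esub>"
    unfolding loc_map_def loc_x_def L_simps(1)[OF letter_closed(1)[OF s] letter_closed(2)[OF assms]] L_simps(3)
    using assms s by (intro coset_eqI rel_mem) (auto simp: letter_closed loc_S_rels_alt)
  show "loc_x R S s \<otimes>\<^bsub>L\<^esub> loc_map R S s = \<one>\<^bsub>L\<^esub>"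
    unfolding loc_map_def loc_x_def L_simps(1)[OF letter_closed(2)[OF assms] letter_closed(1)[OF s]] L_simps(3)
    using assms s by (intro coset_eqI rel_mem) (auto simp: letter_closed loc_S_rels_alt)
qed

lemma loc_map_Units: "loc_map R S ` S \<subseteq> Units L"
  using loc_map_x loc_x_closed ring_hom_closed[OF loc_map_hom] S_carrier
  unfolding Units_def by blast

text \<open>The substitute for a normal form: the image of \<open>R\<close> and the formal inverses
  generate the quotient as a ring, since the letters generate the free ring.\<close>

lemma Loc_induct [consumes 1, case_names add neg mult map inverse]:
  assumes u: "u \<in> carrier L"
    and add: "\<And>x y. x \<in> carrier L \<Longrightarrow> y \<in> carrier L \<Longrightarrow> P x \<Longrightarrow> P y \<Longrightarrow> P (x \<oplus>\<^bsub>L\<^esub> y)"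
    and neg: "\<And>x. x \<in> carrier L \<Longrightarrow> P x \<Longrightarrow> P (\<ominus>\<^bsub>L\<^esub> x)"
    and mult: "\<And>x y. x \<in> carrier L \<Longrightarrow> y \<in> carrier L \<Longrightarrow> P x \<Longrightarrow> P y \<Longrightarrow> P (x \<otimes>\<^bsub>L\<^esub> y)"
    and map: "\<And>r. r \<in> carrier R \<Longrightarrow> P (loc_map R S r)"
    and inverse: "\<And>s. s \<in> S \<Longrightarrow> P (loc_x R S s)"
  shows "P u"
proof -
  obtain f where f: "f \<in> carrier F" "u = I +>\<^bsub>F\<^esub> f" using L_cases[OF u] by blast
  from f(1) have "P (I +>\<^bsub>F\<^esub> f)"
    unfolding loc_free_def
  proof (induction f rule: free_ring_induct)
    case zero
    \<comment> \<open>There is no zero case among the closure assumptions, so zero is produced as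
      \<open>1 - 1\<close>.\<close>
    have "loc_map R S \<one> \<ominus>\<^bsub>L\<^esub> loc_map R S \<one> = I +>\<^bsub>F\<^esub> \<zero>\<^bsub>F\<^esub>"
      using ring_hom_closed[OF loc_map_hom one_closed]
      by (simp add: L.r_neg a_minus_def L_simps(5))
    moreover have "P (loc_map R S \<one> \<ominus>\<^bsub>L\<^esub> loc_map R S \<one>)"
      unfolding a_minus_def using ring_hom_closed[OF loc_map_hom one_closed]
      by (intro add neg map) simp_all
    ultimately show ?case by (simp add: free_ring_simps(4) loc_free_def)
  next
    case (add f g)
    then show ?case
      using assms(2)[of "I +>\<^bsub>F\<^esub> f" "I +>\<^bsub>F\<^esub> g"] L_simps(2,4)[of f, folded F_simps] L_simps(4)[of g]
      by (simp add: loc_free_def free_ring_simps(5))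
  next
    case (neg f)
    have f: "f \<in> carrier F" "(\<lambda>w. - f w) \<in> carrier F"
      using neg free_ring_closed(2) by (auto simp: loc_free_def)
    have "(\<lambda>w. - f w) \<oplus>\<^bsub>F\<^esub> f = \<zero>\<^bsub>F\<^esub>" by (simp add: F_simps)
    then have "(I +>\<^bsub>F\<^esub> (\<lambda>w. - f w)) \<oplus>\<^bsub>L\<^esub> (I +>\<^bsub>F\<^esub> f) = \<zero>\<^bsub>L\<^esub>"
      using L_simps(2)[OF f(2,1)] by (simp add: L_simps(5))
    then have "I +>\<^bsub>F\<^esub> (\<lambda>w. - f w) = \<ominus>\<^bsub>L\<^esub> (I +>\<^bsub>F\<^esub> f)"
      using L.minus_equality[OF _ L_simps(4)[OF f(1)] L_simps(4)[OF f(2)]] by simp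
    then show ?case using assms(3)[OF L_simps(4)[OF f(1)]] neg by (simp add: loc_free_def)
  next
    case (word w)
    then show ?case
    proof (induction w)
      case Nil
      then show ?case using map[OF one_closed] ring_hom_one[OF loc_map_hom] L_simps(3)
        by (simp add: free_ring_simps(3) loc_free_def)
    next
      case (Cons x w)
      have w: "word_gen w \<in> carrier F" using Cons.prems by (simp add: word_gen_closed loc_free_def)
      have x: "word_gen [x] \<in> carrier F" using Cons.prems by (simp add: word_gen_closed loc_free_def)
      have "P (I +>\<^bsub>F\<^esub> word_gen [x])"
        using Cons.prems map inverse unfolding loc_map_def loc_x_def by (auto simp: loc_alphabet_def)
      then have "P ((I +>\<^bsub>F\<^esub> word_gen [x]) \<otimes>\<^bsub>L\<^esub> (I +>\<^bsub>F\<^esub> word_gen w))"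
        using Cons mult L_simps(4) x w by (simp add: loc_free_def)
      then show ?case
        using L_simps(1)[OF x w] by (simp add: conv_word_gen loc_free_def free_ring_simps(2))
    qed
  qed
  then show ?thesis using f(2) by simp
qed

text \<open>The universal property. Evaluating letters of \<open>R\<close> by \<open>\<phi>\<close>
  and formal inverses by the inverses in \<open>A\<close> kills every defining relation, so the
  evaluation factors through the quotient.\<close>

lemma Loc_lift:
  assumes A: "ring A" and \<phi>: "\<phi> \<in> ring_hom R A" and unit: "\<phi> ` S \<subseteq> Units A"
  obtains \<psi> where "\<psi> \<in> ring_hom L A" "\<And>r. r \<in> carrier R \<Longrightarrow> \<psi> (loc_map R S r) = \<phi> r"
proof -
  interpret A: ring A by fact
  define \<eta> where "\<eta> = case_sum \<phi> (\<lambda>s. inv\<^bsub>A\<^esub> (\<phi> s))"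
  have \<eta>: "\<eta> \<in> loc_alphabet R S \<rightarrow> carrier A"
    using unit ring_hom_closed[OF \<phi>] by (auto simp: \<eta>_def loc_alphabet_def)
  define h where "h = free_ev A \<eta>"
  have h: "h \<in> ring_hom F A" unfolding h_def loc_free_def by (rule A.free_ev_hom[OF \<eta>])
  interpret h: ring_hom_ring F A h
    by (rule ring_hom_ringI2[OF F.ring_axioms A h])
  have hmap: "h (word_gen [Inl r]) = \<phi> r" if "r \<in> carrier R" for r
    using A.free_ev_word_gen[OF \<eta>, of "[Inl r]"] that ring_hom_closed[OF \<phi>]
    by (simp add: h_def loc_alphabet_def word_val_def \<eta>_def)
  have hx: "h (word_gen [Inr s]) = inv\<^bsub>A\<^esub> (\<phi> s)" if "s \<in> S" for s
    using A.free_ev_word_gen[OF \<eta>, of "[Inr s]"] that unit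
    by (auto simp: h_def loc_alphabet_def word_val_def \<eta>_def)
  have ker: "f \<ominus>\<^bsub>F\<^esub> g \<in> a_kernel F A h" if "f \<in> carrier F" "g \<in> carrier F" "h f = h g" for f g
  proof -
    have "h (f \<ominus>\<^bsub>F\<^esub> g) = h f \<oplus>\<^bsub>A\<^esub> \<ominus>\<^bsub>A\<^esub> h g" using that(1,2) by (simp add: a_minus_def)
    also have "\<dots> = \<zero>\<^bsub>A\<^esub>" using that by (simp add: A.r_neg)
    finally show ?thesis unfolding a_kernel_def' using F.minus_closed[OF that(1,2)] by blast
  qed
  have "I \<subseteq> a_kernel F A h"
    unfolding loc_ideal_def
  proof (rule F.genideal_minimal[OF h.kernel_is_ideal], rule subsetI)
    fix f assume "f \<in> loc_rels R S \<union> loc_S_rels R S"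
    then show "f \<in> a_kernel F A h"
    proof
      assume "f \<in> loc_rels R S"
      then show ?thesis unfolding loc_rels_alt
        using \<phi> by (auto intro!: ker simp: letter_closed hmap ring_hom_add ring_hom_mult ring_hom_one)
    next
      assume "f \<in> loc_S_rels R S"
      then show ?thesis unfolding loc_S_rels_alt
        using S_carrier unit
        by (auto intro!: ker F.m_closed letter_closed simp: letter_closed hmap hx subset_iff)
    qed
  qed
  then have hI: "h i = \<zero>\<^bsub>A\<^esub>" if "i \<in> I" for i
    using that unfolding a_kernel_def' by blast
  \<comment> \<open>Since \<open>h\<close> vanishes on \<open>I\<close>, its image of a coset is a
    singleton; \<open>the_elem\<close> reads off that value without choosing a
    representative.\<close>
  define \<psi> where "\<psi> = (\<lambda>C. the_elem (h ` C))"
  have \<psi>: "\<psi> (I +>\<^bsub>F\<^esub> f) = h f" if "f \<in> carrier F" for f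
  proof -
    have "h ` (I +>\<^bsub>F\<^esub> f) = {h f}"
    proof
      show "h ` (I +>\<^bsub>F\<^esub> f) \<subseteq> {h f}"
        using that hI I.a_Hcarr by (auto simp: a_r_coset_def r_coset_def)
      show "{h f} \<subseteq> h ` (I +>\<^bsub>F\<^esub> f)" using I.a_rcos_self[OF that] by blast
    qed
    then show ?thesis by (simp add: \<psi>_def)
  qed
  show thesis
  proof
    show "\<psi> (loc_map R S r) = \<phi> r" if "r \<in> carrier R" for r
      using that by (simp add: loc_map_def \<psi> letter_closed hmap)
    show "\<psi> \<in> ring_hom L A"
    proof (rule ring_hom_memI)
      fix x y assume "x \<in> carrier L" "y \<in> carrier L"
      then obtain f g where fg: "f \<in> carrier F" "x = I +>\<^bsub>F\<^esub> f" "g \<in> carrier F" "y = I +>\<^bsub>F\<^esub> g"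
        using L_cases by metis
      show "\<psi> x \<in> carrier A" "\<psi> (x \<otimes>\<^bsub>L\<^esub> y) = \<psi> x \<otimes>\<^bsub>A\<^esub> \<psi> y" "\<psi> (x \<oplus>\<^bsub>L\<^esub> y) = \<psi> x \<oplus>\<^bsub>A\<^esub> \<psi> y"
        using fg by (simp_all add: L_simps \<psi>)
    qed (simp add: L_simps(3) \<psi>)
  qed
qed

lemma ass_ideal: "ideal (ass R S) R"
proof -
  interpret h: ring_hom_ring R L "loc_map R S"
    by (rule ring_hom_ringI2[OF ring_axioms L.ring_axioms loc_map_hom])
  show ?thesis using h.kernel_is_ideal unfolding ass_def a_kernel_def' .
qed

end

section \<open>Opposite rings and one-sided fractions\<close>

text \<open>Only the multiplication field is replaced, so additive notions transfer by
  simplification and the double opposite is equal to the ring itself, not merely isomorphic to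
  it.\<close>

definition opp :: "('a, 'm) ring_scheme \<Rightarrow> ('a, 'm) ring_scheme" where
  "opp R = R\<lparr>monoid.mult := \<lambda>x y. y \<otimes>\<^bsub>R\<^esub> x\<rparr>"

lemma opp_simps [simp]:
  "carrier (opp R) = carrier R" "x \<otimes>\<^bsub>opp R\<^esub> y = y \<otimes>\<^bsub>R\<^esub> x" "\<one>\<^bsub>opp R\<^esub> = \<one>\<^bsub>R\<^esub>"
  "\<zero>\<^bsub>opp R\<^esub> = \<zero>\<^bsub>R\<^esub>" "add (opp R) = add R" "opp (opp R) = R"
  by (simp_all add: opp_def)

lemma opp_finsum [simp]: "finsum (opp R) = finsum R"
  by (simp add: finsum_def fun_eq_iff)

lemma opp_a_inv [simp]: "a_inv (opp R) = a_inv R"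
  by (simp add: a_inv_def fun_eq_iff)

lemma opp_ring: "ring R \<Longrightarrow> ring (opp R)"
proof -
  assume "ring R"
  then interpret ring R .
  show ?thesis
  proof (rule ringI)
    show "abelian_group (opp R)"
      using abelian_group_axioms
      unfolding abelian_group_def abelian_monoid_def abelian_group_axioms_def by simp
    show "Group.monoid (opp R)" by (rule monoidI) (simp_all add: m_assoc)
  qed (simp_all add: l_distr r_distr)
qed

lemma opp_additive_subgroup [simp]: "additive_subgroup I (opp R) \<longleftrightarrow> additive_subgroup I R"
  by (simp add: additive_subgroup_def)

lemma opp_ideal [simp]: "ideal I (opp R) \<longleftrightarrow> ideal I R"
proof -
  have "ideal I (opp R)" if "ideal I R" for I and R :: "('a, 'm) ring_scheme"
  proof -
    interpret ideal I R by fact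
    show ?thesis
      using opp_ring[OF ring_axioms] additive_subgroup_axioms I_l_closed I_r_closed
      unfolding ideal_def ideal_axioms_def by simp
  qed
  from this[of I R] this[of I "opp R"] show ?thesis by auto
qed

lemma opp_left_ideal [simp]: "left_ideal I (opp R) \<longleftrightarrow> right_ideal I R"
  by (simp add: left_ideal_def right_ideal_def)

lemma opp_right_ideal [simp]: "right_ideal I (opp R) \<longleftrightarrow> left_ideal I R"
  by (simp add: left_ideal_def right_ideal_def)

lemma opp_ann [simp]: "l_ann (opp R) Y = r_ann R Y" "r_ann (opp R) Y = l_ann R Y"
  by (simp_all add: l_ann_def r_ann_def)

lemma opp_regular [simp]: "regular (opp R) = regular R"
  by (auto simp: regular_def)

lemma opp_mult_set [simp]: "mult_set (opp R) S \<longleftrightarrow> mult_set R S"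
  by (auto simp: mult_set_def)

lemma opp_semiprime [simp]: "semiprime (opp R) \<longleftrightarrow> semiprime R"
  by (auto simp: semiprime_def)

lemma opp_independent_family [simp]: "independent_family (opp R) L \<longleftrightarrow> independent_family R L"
  by (simp add: independent_family_def)

lemma opp_left_goldie [simp]: "left_goldie (opp R) \<longleftrightarrow> right_goldie R" "right_goldie (opp R) \<longleftrightarrow> left_goldie R"
  by (simp_all add: left_goldie_def right_goldie_def finite_left_udim_def finite_right_udim_def)

lemma opp_goldie [simp]: "goldie (opp R) \<longleftrightarrow> goldie R"
  by (auto simp: goldie_def)

lemma opp_ring_hom [simp]: "ring_hom (opp R) (opp A) = ring_hom R A"
  by (auto simp: ring_hom_def)

text \<open>One half of the Ore condition. The right half is this predicate for
  \<open>opp R\<close>, so each statement about Ore sets can be proved on one side.\<close>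

definition left_ore_set :: "('a, 'm) ring_scheme \<Rightarrow> 'a set \<Rightarrow> bool" where
  "left_ore_set R S \<longleftrightarrow> mult_set R S \<and>
     (\<forall>r\<in>carrier R. \<forall>s\<in>S. \<exists>t\<in>S. \<exists>a\<in>carrier R. t \<otimes>\<^bsub>R\<^esub> r = a \<otimes>\<^bsub>R\<^esub> s)"

lemma ore_set_iff: "ore_set R S \<longleftrightarrow> left_ore_set R S \<and> left_ore_set (opp R) S"
  by (auto simp: ore_set_def left_ore_set_def)

lemma mult_setD:
  assumes "mult_set R S"
  shows "S \<subseteq> carrier R" "s \<in> S \<Longrightarrow> t \<in> S \<Longrightarrow> s \<otimes>\<^bsub>R\<^esub> t \<in> S" "\<one>\<^bsub>R\<^esub> \<in> S" "\<zero>\<^bsub>R\<^esub> \<notin> S"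
  using assms by (auto simp: mult_set_def)

lemma left_ore_setE:
  assumes "left_ore_set R S" "r \<in> carrier R" "s \<in> S"
  obtains t a where "t \<in> S" "a \<in> carrier R" "t \<otimes>\<^bsub>R\<^esub> r = a \<otimes>\<^bsub>R\<^esub> s"
  using assms unfolding left_ore_set_def by blast

text \<open>Membership is stated by clearing the denominator, so no inverse of
  \<open>\<phi> s\<close> has to be written and closure under the ring operations uses only the Ore
  condition.\<close>

definition left_fractions :: "('a, 'm) ring_scheme \<Rightarrow> ('b, 'n) ring_scheme \<Rightarrow> ('a \<Rightarrow> 'b) \<Rightarrow> 'a set \<Rightarrow> 'b set" where
  "left_fractions R A \<phi> S = {x \<in> carrier A. \<exists>s\<in>S. \<exists>r\<in>carrier R. \<phi> s \<otimes>\<^bsub>A\<^esub> x = \<phi> r}"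

context ring_hom_ring
begin

lemma left_fractions_closed:
  assumes ore: "left_ore_set R T" and x: "x \<in> left_fractions R S h T" and y: "y \<in> left_fractions R S h T"
  shows "x \<oplus>\<^bsub>S\<^esub> y \<in> left_fractions R S h T" "\<ominus>\<^bsub>S\<^esub> x \<in> left_fractions R S h T"
    "x \<otimes>\<^bsub>S\<^esub> y \<in> left_fractions R S h T"
proof -
  have T: "mult_set R T" using ore by (simp add: left_ore_set_def)
  note T_carrier = mult_setD(1)[OF T, THEN subsetD]
  obtain s r where sr: "s \<in> T" "r \<in> carrier R" "h s \<otimes>\<^bsub>S\<^esub> x = h r" and x': "x \<in> carrier S"
    using x by (auto simp: left_fractions_def)
  obtain t q where tq: "t \<in> T" "q \<in> carrier R" "h t \<otimes>\<^bsub>S\<^esub> y = h q" and y': "y \<in> carrier S"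
    using y by (auto simp: left_fractions_def)
  note st = T_carrier[OF sr(1)] T_carrier[OF tq(1)]
  have "h s \<otimes>\<^bsub>S\<^esub> (\<ominus>\<^bsub>S\<^esub> x) = h (\<ominus> r)"
    using sr st x' by (simp add: S.r_minus)
  then show "\<ominus>\<^bsub>S\<^esub> x \<in> left_fractions R S h T"
    unfolding left_fractions_def using sr x' by blast
  \<comment> \<open>A common denominator for the sum: \<open>u \<otimes> s = a \<otimes> t\<close>
    clears both fractions at once.\<close>
  obtain u a where ua: "u \<in> T" "a \<in> carrier R" "u \<otimes> s = a \<otimes> t"
    using left_ore_setE[OF ore st(1) tq(1)] by blast
  note u = T_carrier[OF ua(1)]
  have hus: "h (u \<otimes> s) = h u \<otimes>\<^bsub>S\<^esub> h s" "h (u \<otimes> s) = h a \<otimes>\<^bsub>S\<^esub> h t"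
    using hom_mult[OF u st(1)] hom_mult[OF ua(2) st(2)] ua(3) by simp_all
  have "h (u \<otimes> s) \<otimes>\<^bsub>S\<^esub> x = h (u \<otimes> r)"
    unfolding hus(1) using u st sr x' by (simp add: S.m_assoc)
  moreover have "h (u \<otimes> s) \<otimes>\<^bsub>S\<^esub> y = h (a \<otimes> q)"
    unfolding hus(2) using ua(2) st tq y' by (simp add: S.m_assoc)
  ultimately have "h (u \<otimes> s) \<otimes>\<^bsub>S\<^esub> (x \<oplus>\<^bsub>S\<^esub> y) = h ((u \<otimes> r) \<oplus> (a \<otimes> q))"
    using u st ua(2) sr(2) tq(2) x' y' by (simp add: S.r_distr del: hom_mult)
  moreover have "u \<otimes> s \<in> T" "(u \<otimes> r) \<oplus> (a \<otimes> q) \<in> carrier R"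
    using mult_setD(2)[OF T ua(1) sr(1)] u ua(2) sr(2) tq(2) by simp_all
  ultimately show "x \<oplus>\<^bsub>S\<^esub> y \<in> left_fractions R S h T"
    unfolding left_fractions_def using x' y' S.a_closed by blast
  \<comment> \<open>For the product the denominator \<open>t\<close> of \<open>y\<close> has to be
    moved past the numerator \<open>r\<close> of \<open>x\<close>; the Ore condition for
    \<open>r\<close> and \<open>t\<close> does this.\<close>
  obtain v b where vb: "v \<in> T" "b \<in> carrier R" "v \<otimes> r = b \<otimes> t"
    using left_ore_setE[OF ore sr(2) tq(1)] by blast
  note v = T_carrier[OF vb(1)]
  have "h (v \<otimes> s) \<otimes>\<^bsub>S\<^esub> (x \<otimes>\<^bsub>S\<^esub> y) = h v \<otimes>\<^bsub>S\<^esub> (h s \<otimes>\<^bsub>S\<^esub> x) \<otimes>\<^bsub>S\<^esub> y"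
    using v st x' y' by (simp add: S.m_assoc)
  also have "\<dots> = h (v \<otimes> r) \<otimes>\<^bsub>S\<^esub> y" using v sr by simp
  also have "\<dots> = h b \<otimes>\<^bsub>S\<^esub> (h t \<otimes>\<^bsub>S\<^esub> y)" unfolding vb(3) using vb(2) st y' by (simp add: S.m_assoc)
  also have "\<dots> = h (b \<otimes> q)" using vb(2) tq by simp
  finally have "h (v \<otimes> s) \<otimes>\<^bsub>S\<^esub> (x \<otimes>\<^bsub>S\<^esub> y) = h (b \<otimes> q)" .
  moreover have "v \<otimes> s \<in> T" "b \<otimes> q \<in> carrier R"
    using mult_setD(2)[OF T vb(1) sr(1)] vb(2) tq(2) by simp_all
  ultimately show "x \<otimes>\<^bsub>S\<^esub> y \<in> left_fractions R S h T"
    unfolding left_fractions_def using x' y' S.m_closed by blast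
qed

lemma opp_ring_hom_ring: "ring_hom_ring (opp R) (opp S) h"
  by (rule ring_hom_ringI2) (use opp_ring R.ring_axioms S.ring_axioms homh in simp_all)

end

context localization
begin

sublocale loc_map: ring_hom_ring R L "loc_map R S"
  by (rule ring_hom_ringI2[OF ring_axioms L.ring_axioms loc_map_hom])

text \<open>The left fractions contain the generators and are closed under the operations, hence
  they exhaust the localization by \<open>Loc_induct\<close>.\<close>

lemma Loc_left_fractions:
  assumes ore: "left_ore_set R S"
  shows "left_fractions R L (loc_map R S) S = carrier L"
proof
  show "carrier L \<subseteq> left_fractions R L (loc_map R S) S"
  proof
    fix u assume "u \<in> carrier L"
    then show "u \<in> left_fractions R L (loc_map R S) S"
    proof (induction rule: Loc_induct)
      case (map r)
      have "loc_map R S \<one> \<otimes>\<^bsub>L\<^esub> loc_map R S r = loc_map R S r" using map by simp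
      moreover have "\<one> \<in> S" using ore by (simp add: left_ore_set_def mult_set_def)
      ultimately show ?case unfolding left_fractions_def using loc_map.hom_closed[OF map] map by blast
    next
      case (inverse s)
      have "loc_map R S s \<otimes>\<^bsub>L\<^esub> loc_x R S s = loc_map R S \<one>" using inverse loc_map_x by simp
      then show ?case using inverse loc_x_closed unfolding left_fractions_def by blast
    qed (use loc_map.left_fractions_closed[OF ore] in blast)+
  qed
qed (auto simp: left_fractions_def)

lemma Loc_right_fractions:
  assumes ore: "left_ore_set (opp R) S"
  shows "left_fractions (opp R) (opp L) (loc_map R S) S = carrier L"
proof
  interpret opp: ring_hom_ring "opp R" "opp L" "loc_map R S" by (rule loc_map.opp_ring_hom_ring)
  show "carrier L \<subseteq> left_fractions (opp R) (opp L) (loc_map R S) S"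
  proof
    fix u assume "u \<in> carrier L"
    then show "u \<in> left_fractions (opp R) (opp L) (loc_map R S) S"
    proof (induction rule: Loc_induct)
      case (map r)
      have "loc_map R S \<one> \<otimes>\<^bsub>opp L\<^esub> loc_map R S r = loc_map R S r" using map by simp
      moreover have "\<one> \<in> S" using ore by (simp add: left_ore_set_def mult_set_def)
      ultimately show ?case unfolding left_fractions_def opp_simps using loc_map.hom_closed[OF map] map by blast
    next
      case (inverse s)
      have "loc_x R S s \<otimes>\<^bsub>L\<^esub> loc_map R S s = loc_map R S \<one>" using inverse loc_map_x by simp
      then show ?case using inverse loc_x_closed[OF inverse] one_closed
        unfolding left_fractions_def opp_simps by blast
    qed (use opp.left_fractions_closed[OF ore, unfolded opp_simps opp_a_inv] in blast)+
  qed
qed (auto simp: left_fractions_def)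

lemma left_localizableI:
  assumes ore: "left_ore_set R S" and nz: "\<one>\<^bsub>L\<^esub> \<noteq> \<zero>\<^bsub>L\<^esub>"
  shows "left_localizable R S"
proof -
  have "\<exists>s\<in>S. \<exists>r\<in>carrier R. u = loc_x R S s \<otimes>\<^bsub>L\<^esub> loc_map R S r" if u: "u \<in> carrier L" for u
  proof -
    have "u \<in> left_fractions R L (loc_map R S) S" using u Loc_left_fractions[OF ore] by simp
    then obtain s r where sr: "s \<in> S" "r \<in> carrier R" "loc_map R S s \<otimes>\<^bsub>L\<^esub> u = loc_map R S r"
      unfolding left_fractions_def by blast
    have "loc_x R S s \<otimes>\<^bsub>L\<^esub> loc_map R S r = (loc_x R S s \<otimes>\<^bsub>L\<^esub> loc_map R S s) \<otimes>\<^bsub>L\<^esub> u"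
      unfolding sr(3)[symmetric] using sr(1) S_carrier loc_x_closed u
      by (intro L.m_assoc[symmetric]) auto
    then show ?thesis using sr loc_map_x u by (intro bexI[of _ s] bexI[of _ r]) simp_all
  qed
  then show ?thesis using ore nz by (simp add: left_localizable_def left_ore_set_def)
qed

lemma right_localizableI:
  assumes ore: "left_ore_set (opp R) S" and nz: "\<one>\<^bsub>L\<^esub> \<noteq> \<zero>\<^bsub>L\<^esub>"
  shows "right_localizable R S"
proof -
  have "\<exists>s\<in>S. \<exists>r\<in>carrier R. u = loc_map R S r \<otimes>\<^bsub>L\<^esub> loc_x R S s" if u: "u \<in> carrier L" for u
  proof -
    have "u \<in> left_fractions (opp R) (opp L) (loc_map R S) S" using u Loc_right_fractions[OF ore] by simp
    then obtain s r where sr: "s \<in> S" "r \<in> carrier R" "u \<otimes>\<^bsub>L\<^esub> loc_map R S s = loc_map R S r"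
      unfolding left_fractions_def opp_simps by blast
    have "loc_map R S r \<otimes>\<^bsub>L\<^esub> loc_x R S s = u \<otimes>\<^bsub>L\<^esub> (loc_map R S s \<otimes>\<^bsub>L\<^esub> loc_x R S s)"
      unfolding sr(3)[symmetric] using sr(1) S_carrier loc_x_closed u
      by (intro L.m_assoc) auto
    then show ?thesis using sr loc_map_x u by (intro bexI[of _ s] bexI[of _ r]) simp_all
  qed
  then show ?thesis using ore nz by (simp add: right_localizable_def left_ore_set_def)
qed

end

lemma Loc_mono:
  assumes "localization R T" "S \<subseteq> T"
  obtains \<psi> where "\<psi> \<in> ring_hom (Loc R S) (Loc R T)"
    "\<And>r. r \<in> carrier R \<Longrightarrow> \<psi> (loc_map R S r) = loc_map R T r"
proof -
  interpret T: localization R T by fact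
  interpret S: localization R S by unfold_locales (use assms T.S_carrier in blast)
  have "loc_map R T ` S \<subseteq> Units (Loc R T)" using assms(2) T.loc_map_Units by blast
  from S.Loc_lift[OF T.L.ring_axioms T.loc_map_hom this] that show thesis by blast
qed

text \<open>The elements of \<open>S\<close> become units in \<open>Loc R T\<close>, so the map to
  \<open>Loc R T\<close> factors through \<open>Loc R S\<close> and its kernel can only
  grow.\<close>

lemma ass_mono:
  assumes "localization R T" "S \<subseteq> T"
  shows "ass R S \<subseteq> ass R T"
proof
  interpret T: localization R T by fact
  interpret S: localization R S by unfold_locales (use assms T.S_carrier in blast)
  obtain \<psi> where \<psi>: "\<psi> \<in> ring_hom (Loc R S) (Loc R T)"
    "\<And>r. r \<in> carrier R \<Longrightarrow> \<psi> (loc_map R S r) = loc_map R T r"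
    using Loc_mono[OF assms] by blast
  fix r assume "r \<in> ass R S"
  then have "r \<in> carrier R" "loc_map R S r = \<zero>\<^bsub>Loc R S\<^esub>" by (auto simp: ass_def)
  moreover have "\<psi> \<zero>\<^bsub>Loc R S\<^esub> = \<zero>\<^bsub>Loc R T\<^esub>"
    by (rule ring_hom_zero[OF \<psi>(1) S.L.ring_axioms T.L.ring_axioms])
  ultimately show "r \<in> ass R T" using \<psi>(2)[of r] by (simp add: ass_def)
qed

section \<open>The kernel of the localization at a denominator set\<close>

text \<open>Endomorphisms are restricted to extensional functions so that two of them are equal as
  soon as they agree on the carrier.\<close>

definition End_ring :: "('h, 'k) monoid_scheme \<Rightarrow> ('h \<Rightarrow> 'h) ring" where
  "End_ring H = \<lparr>carrier = hom H H \<inter> extensional (carrier H),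
     monoid.mult = (\<lambda>e f. \<lambda>x\<in>carrier H. e (f x)), one = (\<lambda>x\<in>carrier H. x),
     ring.zero = (\<lambda>x\<in>carrier H. \<one>\<^bsub>H\<^esub>), add = (\<lambda>e f. \<lambda>x\<in>carrier H. e x \<otimes>\<^bsub>H\<^esub> f x)\<rparr>"

context comm_group
begin

lemma End_ringI: "e \<in> hom G G \<Longrightarrow> restrict e (carrier G) \<in> carrier (End_ring G)"
  by (auto simp: End_ring_def hom_def Pi_def)

lemma End_ringD:
  assumes "e \<in> carrier (End_ring G)"
  shows "e \<in> hom G G" "x \<in> carrier G \<Longrightarrow> e x \<in> carrier G"
    "x \<in> carrier G \<Longrightarrow> y \<in> carrier G \<Longrightarrow> e (x \<otimes> y) = e x \<otimes> e y" "e \<in> extensional (carrier G)"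
  using assms by (auto simp: End_ring_def hom_def Pi_def)

lemma End_ring_eqI:
  assumes "e \<in> carrier (End_ring G)" "f \<in> carrier (End_ring G)" "\<And>x. x \<in> carrier G \<Longrightarrow> e x = f x"
  shows "e = f"
  using assms End_ringD(4) by (intro extensionalityI[of e "carrier G"]) auto

lemma End_ring_apply:
  assumes "x \<in> carrier G"
  shows "(e \<otimes>\<^bsub>End_ring G\<^esub> f) x = e (f x)" "(e \<oplus>\<^bsub>End_ring G\<^esub> f) x = e x \<otimes> f x"
    "\<one>\<^bsub>End_ring G\<^esub> x = x" "\<zero>\<^bsub>End_ring G\<^esub> x = \<one>"
  using assms by (simp_all add: End_ring_def)

lemma End_ring_one_zero_closed:
  "\<one>\<^bsub>End_ring G\<^esub> \<in> carrier (End_ring G)" "\<zero>\<^bsub>End_ring G\<^esub> \<in> carrier (End_ring G)"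
proof -
  have "(\<lambda>x. x) \<in> hom G G" "(\<lambda>x. \<one>) \<in> hom G G" by (auto intro!: homI)
  note this[THEN End_ringI]
  then show "\<one>\<^bsub>End_ring G\<^esub> \<in> carrier (End_ring G)" "\<zero>\<^bsub>End_ring G\<^esub> \<in> carrier (End_ring G)"
    by (simp_all add: End_ring_def)
qed

lemma End_ring_closed:
  assumes "e \<in> carrier (End_ring G)" "f \<in> carrier (End_ring G)"
  shows "e \<otimes>\<^bsub>End_ring G\<^esub> f \<in> carrier (End_ring G)" "e \<oplus>\<^bsub>End_ring G\<^esub> f \<in> carrier (End_ring G)"
    "(\<lambda>x\<in>carrier G. inv (e x)) \<in> carrier (End_ring G)"
proof -
  note e = End_ringD[OF assms(1)] and f = End_ringD[OF assms(2)]
  have "(\<lambda>x. e (f x)) \<in> hom G G" "(\<lambda>x. e x \<otimes> f x) \<in> hom G G" "(\<lambda>x. inv (e x)) \<in> hom G G"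
    by (auto intro!: homI simp: e(2,3) f(2,3) m_ac inv_mult)
  note this[THEN End_ringI]
  then show "e \<otimes>\<^bsub>End_ring G\<^esub> f \<in> carrier (End_ring G)" "e \<oplus>\<^bsub>End_ring G\<^esub> f \<in> carrier (End_ring G)"
    "(\<lambda>x\<in>carrier G. inv (e x)) \<in> carrier (End_ring G)"
    by (simp_all add: End_ring_def)
qed

lemmas End_ring_closures = End_ring_one_zero_closed End_ring_closed(1,2)

lemma End_ring_ring: "ring (End_ring G)"
proof (rule ringI)
  show "abelian_group (End_ring G)"
  proof (rule abelian_groupI)
    fix e assume e: "e \<in> carrier (End_ring G)"
    show "\<exists>f\<in>carrier (End_ring G). f \<oplus>\<^bsub>End_ring G\<^esub> e = \<zero>\<^bsub>End_ring G\<^esub>"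
    proof (rule bexI)
      show "(\<lambda>x\<in>carrier G. inv (e x)) \<oplus>\<^bsub>End_ring G\<^esub> e = \<zero>\<^bsub>End_ring G\<^esub>"
        by (rule End_ring_eqI[OF End_ring_closed(2)[OF End_ring_closed(3)[OF e e] e] End_ring_one_zero_closed(2)])
          (simp add: End_ring_apply End_ringD(2)[OF e])
    qed (rule End_ring_closed(3)[OF e e])
  qed (auto intro!: End_ring_eqI simp: End_ring_closures End_ring_apply End_ringD(2) m_ac)
  show "Group.monoid (End_ring G)"
    by (rule monoidI) (auto intro!: End_ring_eqI simp: End_ring_closures End_ring_apply End_ringD(2))
qed (auto intro!: End_ring_eqI simp: End_ring_closures End_ring_apply End_ringD(2,3))

lemma End_ring_Units:
  assumes e: "e \<in> carrier (End_ring G)" and bij: "bij_betw e (carrier G) (carrier G)"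
  shows "e \<in> Units (End_ring G)"
proof -
  interpret E: ring "End_ring G" by (rule End_ring_ring)
  let ?i = "inv_into (carrier G) e"
  have "e \<in> iso G G" using End_ringD(1)[OF e] bij by (simp add: iso_def)
  then have "?i \<in> hom G G" using iso_set_sym iso_imp_homomorphism by blast
  note i = End_ringI[OF this]
  have "restrict ?i (carrier G) \<otimes>\<^bsub>End_ring G\<^esub> e = \<one>\<^bsub>End_ring G\<^esub>"
    by (rule End_ring_eqI)
      (use bij in \<open>simp_all add: i e End_ring_closures End_ring_apply End_ringD(2) bij_betw_inv_into_left\<close>)
  moreover have "e \<otimes>\<^bsub>End_ring G\<^esub> restrict ?i (carrier G) = \<one>\<^bsub>End_ring G\<^esub>"
    by (rule End_ring_eqI)
      (use bij in \<open>simp_all add: i e End_ring_closures End_ring_apply End_ringD(2) bij_betw_inv_into_right\<close>)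
  ultimately show ?thesis using i e unfolding Units_def by blast
qed

end

text \<open>The localization at a right denominator set \<open>S\<close> with torsion ideal \<open>J\<close> acts on the group of germs
  of right linear maps \<open>tR \<rightarrow> R/J\<close>, \<open>t \<in> S\<close>, where two maps are identified when they agree on some
  \<open>tR\<close>. This bounds the kernel of the localization map without constructing the ring of fractions.\<close>

locale right_denominators = ring R for R (structure) + fixes S
  assumes ore: "left_ore_set (opp R) S"
    and reversible: "r \<in> carrier R \<Longrightarrow> s \<in> S \<Longrightarrow> s \<otimes> r = \<zero> \<Longrightarrow> \<exists>t\<in>S. r \<otimes> t = \<zero>"
begin

lemma S_mult: "mult_set R S" using ore by (simp add: left_ore_set_def)

lemma S_mem [simp]: "s \<in> S \<Longrightarrow> s \<in> carrier R" using mult_setD(1)[OF S_mult] by blast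

lemma S_closed: "s \<in> S \<Longrightarrow> t \<in> S \<Longrightarrow> s \<otimes> t \<in> S" using mult_setD(2)[OF S_mult] .

lemma right_ore:
  assumes "r \<in> carrier R" "s \<in> S" obtains t a where "t \<in> S" "a \<in> carrier R" "r \<otimes> t = s \<otimes> a"
  using left_ore_setE[OF ore, of r s] assms by auto

lemma common_multiple:
  assumes "s \<in> S" "t \<in> S"
  obtains a b where "a \<in> carrier R" "b \<in> carrier R" "s \<otimes> a \<in> S" "s \<otimes> a = t \<otimes> b"
proof -
  obtain v b where v: "v \<in> S" "b \<in> carrier R" "s \<otimes> v = t \<otimes> b" using right_ore[of s t] assms by auto
  show thesis by (rule that[OF S_mem[OF v(1)] v(2) S_closed[OF assms(1) v(1)] v(3)])
qed

section \<open>The torsion ideal of a right denominator set\<close>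

definition torsion :: "'a set" where
  "torsion = {r \<in> carrier R. \<exists>t\<in>S. r \<otimes> t = \<zero>}"

lemma torsion_ideal: "ideal torsion R"
proof (rule idealI[OF ring_axioms])
  show "subgroup torsion (add_monoid R)"
  proof (rule subgroup.intro)
    fix x y assume "x \<in> torsion" "y \<in> torsion"
    then obtain s t where st: "x \<in> carrier R" "y \<in> carrier R" "s \<in> S" "t \<in> S" "x \<otimes> s = \<zero>" "y \<otimes> t = \<zero>"
      by (auto simp: torsion_def)
    obtain a b where ab: "a \<in> carrier R" "b \<in> carrier R" "s \<otimes> a \<in> S" "s \<otimes> a = t \<otimes> b"
      using common_multiple[OF st(3,4)] by blast
    have "x \<otimes> (s \<otimes> a) = \<zero>" using st ab(1) by (simp flip: m_assoc)
    moreover have "y \<otimes> (s \<otimes> a) = \<zero>" unfolding ab(4) using st ab(2) by (simp flip: m_assoc)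
    ultimately have "(x \<oplus> y) \<otimes> (s \<otimes> a) = \<zero>" using st ab(1) by (simp add: l_distr)
    then show "x \<otimes>\<^bsub>add_monoid R\<^esub> y \<in> torsion" using st ab(3) by (auto simp: torsion_def)
    have "\<ominus> x \<in> torsion" using st by (auto simp: torsion_def l_minus)
    then show "inv\<^bsub>add_monoid R\<^esub> x \<in> torsion" by (simp add: a_inv_def)
  qed (use mult_setD(3)[OF S_mult] in \<open>auto simp: torsion_def\<close>)
next
  fix r x assume "r \<in> torsion" and x: "x \<in> carrier R"
  then obtain t where t: "r \<in> carrier R" "t \<in> S" "r \<otimes> t = \<zero>" by (auto simp: torsion_def)
  then have "x \<otimes> r \<otimes> t = \<zero>" using x by (simp add: m_assoc)
  then show "x \<otimes> r \<in> torsion" using t x by (auto simp: torsion_def)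
  \<comment> \<open>The right Ore condition moves \<open>x\<close> past the element \<open>t\<close>
    that kills \<open>r\<close>: \<open>r x v\<close> becomes \<open>r t a\<close>.\<close>
  obtain v a where va: "v \<in> S" "a \<in> carrier R" "x \<otimes> v = t \<otimes> a" using right_ore[OF x t(2)] by blast
  have "r \<otimes> x \<otimes> v = (r \<otimes> t) \<otimes> a" using t(1,2) x va by (simp add: m_assoc)
  then have "r \<otimes> x \<otimes> v = \<zero>" using t va by simp
  then show "r \<otimes> x \<in> torsion" using t x va by (auto simp: torsion_def)
qed

sublocale J: ideal torsion R by (rule torsion_ideal)

text \<open>Reversibility converts \<open>s (r v) = 0\<close> into \<open>r v w = 0\<close>. Modulo
  the torsion ideal the elements of \<open>S\<close> are thus cancellable on the left, which later
  makes their action on germs injective and division by them well defined.\<close>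

lemma torsion_cancel:
  assumes s: "s \<in> S" and r: "r \<in> carrier R" and sr: "s \<otimes> r \<in> torsion"
  shows "r \<in> torsion"
proof -
  obtain v where v: "v \<in> S" "s \<otimes> r \<otimes> v = \<zero>" using sr unfolding torsion_def by blast
  have "s \<otimes> (r \<otimes> v) = \<zero>" using v s r by (simp add: m_assoc)
  then obtain w where w: "w \<in> S" "r \<otimes> v \<otimes> w = \<zero>"
    using reversible[OF m_closed[OF r S_mem[OF v(1)]] s] by blast
  then have "r \<otimes> (v \<otimes> w) = \<zero>" using r v by (simp add: m_assoc)
  then show ?thesis using r S_closed[OF v(1) w(1)] unfolding torsion_def by blast
qed

text \<open>A right linear map from \<open>tR\<close> to \<open>R\<close> modulo torsion, encoded by
  a lift to \<open>R\<close>: modulo torsion it is determined by its value at \<open>t\<close>. The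
  cases \<open>x = 0\<close> and \<open>t x = 0\<close> show that \<open>f t\<close> sends the right
  annihilator of \<open>t\<close> into the torsion ideal.\<close>

definition lin_on :: "'a \<Rightarrow> ('a \<Rightarrow> 'a) \<Rightarrow> bool" where
  "lin_on t f \<longleftrightarrow> (\<forall>x\<in>carrier R. f (t \<otimes> x) \<ominus> f t \<otimes> x \<in> torsion)"

definition zero_on :: "'a \<Rightarrow> ('a \<Rightarrow> 'a) \<Rightarrow> bool" where
  "zero_on t f \<longleftrightarrow> (\<forall>x\<in>carrier R. f (t \<otimes> x) \<in> torsion)"

definition lin_maps :: "('a \<Rightarrow> 'a) set" where
  "lin_maps = {f. (\<forall>x. f x \<in> carrier R) \<and> (\<exists>t\<in>S. lin_on t f)}"

definition null_maps :: "('a \<Rightarrow> 'a) set" where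
  "null_maps = {f \<in> lin_maps. \<exists>t\<in>S. zero_on t f}"

definition maps :: "('a \<Rightarrow> 'a) monoid" where
  "maps = \<lparr>carrier = lin_maps, monoid.mult = (\<lambda>f g x. f x \<oplus> g x), one = (\<lambda>x. \<zero>)\<rparr>"

text \<open>Restriction of a linear map from \<open>tR\<close> to the smaller right ideal
  \<open>taR\<close>; with common multiples in \<open>S\<close> this gives two maps a common
  domain.\<close>

lemma lin_on_mult:
  assumes f: "lin_on t f" "\<And>x. f x \<in> carrier R" and t: "t \<in> carrier R" and a: "a \<in> carrier R"
  shows "lin_on (t \<otimes> a) f"
  unfolding lin_on_def
proof
  fix x assume x: "x \<in> carrier R"
  have "f (t \<otimes> (a \<otimes> x)) \<ominus> f t \<otimes> (a \<otimes> x) \<in> torsion"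
    using f(1) a x unfolding lin_on_def by simp
  moreover have "f (t \<otimes> a) \<ominus> f t \<otimes> a \<in> torsion"
    using f(1) a unfolding lin_on_def by simp
  then have "\<ominus> ((f (t \<otimes> a) \<ominus> f t \<otimes> a) \<otimes> x) \<in> torsion"
    using x by (simp add: J.I_r_closed)
  ultimately have "(f (t \<otimes> (a \<otimes> x)) \<ominus> f t \<otimes> (a \<otimes> x)) \<oplus> \<ominus> ((f (t \<otimes> a) \<ominus> f t \<otimes> a) \<otimes> x) \<in> torsion"
    by (rule J.a_closed)
  moreover have "(u \<ominus> w \<otimes> (a \<otimes> x)) \<oplus> \<ominus> ((v \<ominus> w \<otimes> a) \<otimes> x) = u \<ominus> v \<otimes> x"
    if "u \<in> carrier R" "v \<in> carrier R" "w \<in> carrier R" for u v w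
    using that a x by algebra
  ultimately show "f (t \<otimes> a \<otimes> x) \<ominus> f (t \<otimes> a) \<otimes> x \<in> torsion"
    using f(2) t a x by (simp add: m_assoc)
qed

lemma zero_on_mult: "zero_on t f \<Longrightarrow> t \<in> carrier R \<Longrightarrow> a \<in> carrier R \<Longrightarrow> zero_on (t \<otimes> a) f"
  by (simp add: zero_on_def m_assoc)

lemma lin_maps_carrier: "f \<in> lin_maps \<Longrightarrow> f x \<in> carrier R"
  by (simp add: lin_maps_def)

lemma lin_maps_common:
  assumes f: "f \<in> lin_maps" and g: "g \<in> lin_maps"
  obtains m where "m \<in> S" "lin_on m f" "lin_on m g"
proof -
  obtain s t where st: "s \<in> S" "t \<in> S" "lin_on s f" "lin_on t g" using assms by (auto simp: lin_maps_def)
  obtain a b where ab: "a \<in> carrier R" "b \<in> carrier R" "s \<otimes> a \<in> S" "s \<otimes> a = t \<otimes> b"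
    using common_multiple[OF st(1,2)] by blast
  have "lin_on (s \<otimes> a) f" by (rule lin_on_mult[OF st(3) lin_maps_carrier[OF f] S_mem[OF st(1)] ab(1)])
  moreover have "lin_on (t \<otimes> b) g" by (rule lin_on_mult[OF st(4) lin_maps_carrier[OF g] S_mem[OF st(2)] ab(2)])
  ultimately show thesis using that ab by simp
qed

lemma zero_lin_map: "(\<lambda>x. \<zero>) \<in> lin_maps"
  using mult_setD(3)[OF S_mult] by (auto simp: lin_maps_def lin_on_def a_minus_def)

lemma lin_maps_closed:
  assumes "f \<in> lin_maps" "g \<in> lin_maps"
  shows "(\<lambda>x. f x \<oplus> g x) \<in> lin_maps" "r \<in> carrier R \<Longrightarrow> (\<lambda>x. r \<otimes> f x) \<in> lin_maps"
    "(\<lambda>x. \<ominus> f x) \<in> lin_maps"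
proof -
  note c = assms[THEN lin_maps_carrier]
  obtain m where m: "m \<in> S" "lin_on m f" "lin_on m g" using lin_maps_common[OF assms] by blast
  have d: "f (m \<otimes> x) \<ominus> f m \<otimes> x \<in> torsion" "g (m \<otimes> x) \<ominus> g m \<otimes> x \<in> torsion" if "x \<in> carrier R" for x
    using m that unfolding lin_on_def by simp_all
  have "lin_on m (\<lambda>x. f x \<oplus> g x)"
    unfolding lin_on_def
  proof
    fix x assume x: "x \<in> carrier R"
    have "(u \<ominus> v \<otimes> x) \<oplus> (u' \<ominus> v' \<otimes> x) = u \<oplus> u' \<ominus> (v \<oplus> v') \<otimes> x"
      if "u \<in> carrier R" "v \<in> carrier R" "u' \<in> carrier R" "v' \<in> carrier R" for u v u' v'
      using that x by algebra
    then show "f (m \<otimes> x) \<oplus> g (m \<otimes> x) \<ominus> (f m \<oplus> g m) \<otimes> x \<in> torsion"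
      using J.a_closed[OF d(1)[OF x] d(2)[OF x]] c by simp
  qed
  moreover have "lin_on m (\<lambda>x. r \<otimes> f x)" if r: "r \<in> carrier R"
    unfolding lin_on_def
  proof
    fix x assume x: "x \<in> carrier R"
    have "r \<otimes> (u \<ominus> v \<otimes> x) = r \<otimes> u \<ominus> r \<otimes> v \<otimes> x"
      if "u \<in> carrier R" "v \<in> carrier R" for u v
      using that x r by algebra
    then show "r \<otimes> f (m \<otimes> x) \<ominus> r \<otimes> f m \<otimes> x \<in> torsion"
      using J.I_l_closed[OF d(1)[OF x] r] c by simp
  qed
  moreover have "lin_on m (\<lambda>x. \<ominus> f x)"
    unfolding lin_on_def
  proof
    fix x assume x: "x \<in> carrier R"
    have "\<ominus> (u \<ominus> v \<otimes> x) = \<ominus> u \<ominus> (\<ominus> v) \<otimes> x"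
      if "u \<in> carrier R" "v \<in> carrier R" for u v
      using that x by algebra
    then show "\<ominus> f (m \<otimes> x) \<ominus> (\<ominus> f m) \<otimes> x \<in> torsion"
      using J.a_inv_closed[OF d(1)[OF x]] c by simp
  qed
  ultimately show "(\<lambda>x. f x \<oplus> g x) \<in> lin_maps" "r \<in> carrier R \<Longrightarrow> (\<lambda>x. r \<otimes> f x) \<in> lin_maps"
    "(\<lambda>x. \<ominus> f x) \<in> lin_maps"
    using c m(1) by (auto simp: lin_maps_def)
qed

lemma null_maps_closed:
  assumes "f \<in> null_maps" "g \<in> null_maps"
  shows "(\<lambda>x. f x \<oplus> g x) \<in> null_maps" "r \<in> carrier R \<Longrightarrow> (\<lambda>x. r \<otimes> f x) \<in> null_maps"
    "(\<lambda>x. \<ominus> f x) \<in> null_maps"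
proof -
  have l: "f \<in> lin_maps" "g \<in> lin_maps" using assms by (simp_all add: null_maps_def)
  obtain s t where st: "s \<in> S" "t \<in> S" "zero_on s f" "zero_on t g" using assms by (auto simp: null_maps_def)
  obtain a b where ab: "a \<in> carrier R" "b \<in> carrier R" "s \<otimes> a \<in> S" "s \<otimes> a = t \<otimes> b"
    using common_multiple[OF st(1,2)] by blast
  define m where "m = s \<otimes> a"
  have m: "m \<in> S" "zero_on m f" "zero_on m g"
    using ab zero_on_mult[OF st(3) _ ab(1)] zero_on_mult[OF st(4) _ ab(2)] st by (auto simp: m_def)
  have "zero_on m (\<lambda>x. f x \<oplus> g x)" "r \<in> carrier R \<Longrightarrow> zero_on m (\<lambda>x. r \<otimes> f x)" "zero_on m (\<lambda>x. \<ominus> f x)"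
    using m by (simp_all add: zero_on_def J.I_l_closed)
  then show "(\<lambda>x. f x \<oplus> g x) \<in> null_maps" "r \<in> carrier R \<Longrightarrow> (\<lambda>x. r \<otimes> f x) \<in> null_maps"
    "(\<lambda>x. \<ominus> f x) \<in> null_maps"
    using m(1) lin_maps_closed[OF l] by (auto simp: null_maps_def)
qed

lemma maps_comm_group: "comm_group maps"
proof (rule comm_groupI)
  fix f assume f: "f \<in> carrier maps"
  show "\<exists>g\<in>carrier maps. g \<otimes>\<^bsub>maps\<^esub> f = \<one>\<^bsub>maps\<^esub>"
    using f lin_maps_closed(3) lin_maps_carrier
    by (intro bexI[of _ "\<lambda>x. \<ominus> f x"]) (auto simp: maps_def l_neg)
qed (auto simp: maps_def lin_maps_closed zero_lin_map lin_maps_carrier a_ac)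

sublocale maps: comm_group maps by (rule maps_comm_group)

lemma maps_inv: "f \<in> lin_maps \<Longrightarrow> inv\<^bsub>maps\<^esub> f = (\<lambda>x. \<ominus> f x)"
  by (rule maps.inv_equality) (auto simp: maps_def lin_maps_closed lin_maps_carrier l_neg)

lemma null_maps_subgroup: "subgroup null_maps maps"
proof (rule subgroup.intro)
  show "\<one>\<^bsub>maps\<^esub> \<in> null_maps"
    using mult_setD(3)[OF S_mult] by (auto simp: maps_def null_maps_def zero_on_def lin_maps_def lin_on_def a_minus_def)
  show "inv\<^bsub>maps\<^esub> f \<in> null_maps" if "f \<in> null_maps" for f
    using that null_maps_closed(3)[OF that that] by (simp add: maps_inv null_maps_def)
qed (auto simp: maps_def null_maps_closed(1), auto simp: null_maps_def)

section \<open>The group of germs and the action of the ring on it\<close>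

definition germ :: "('a \<Rightarrow> 'a) \<Rightarrow> ('a \<Rightarrow> 'a) set" where
  "germ f = null_maps #>\<^bsub>maps\<^esub> f"

definition germs :: "('a \<Rightarrow> 'a) set monoid" where
  "germs = maps Mod null_maps"

lemma germs_comm_group: "comm_group germs"
  unfolding germs_def by (rule maps.abelian_FactGroup[OF null_maps_subgroup])

sublocale germs: comm_group germs by (rule germs_comm_group)

lemma germ_eq_iff:
  assumes "f \<in> lin_maps" "g \<in> lin_maps"
  shows "germ f = germ g \<longleftrightarrow> (\<lambda>x. f x \<oplus> \<ominus> g x) \<in> null_maps"
proof -
  have fg: "f \<in> carrier maps" "g \<in> carrier maps" using assms by (simp_all add: maps_def)
  have eq: "f \<otimes>\<^bsub>maps\<^esub> inv\<^bsub>maps\<^esub> g = (\<lambda>x. f x \<oplus> \<ominus> g x)"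
    using assms by (simp add: maps_inv) (simp add: maps_def)
  have "germ f = germ g \<longleftrightarrow> f \<in> null_maps #>\<^bsub>maps\<^esub> g"
    unfolding germ_def using maps.repr_independence[OF _ fg(2) null_maps_subgroup]
      maps.rcos_self[OF fg(1) null_maps_subgroup]
    by auto
  also have "\<dots> \<longleftrightarrow> f \<otimes>\<^bsub>maps\<^esub> inv\<^bsub>maps\<^esub> g \<in> null_maps"
    using subgroup.rcos_module[OF null_maps_subgroup maps.is_group fg(2,1)] .
  finally show ?thesis unfolding eq .
qed

lemma germ_closed: "f \<in> lin_maps \<Longrightarrow> germ f \<in> carrier germs"
  by (auto simp: germ_def germs_def FactGroup_def RCOSETS_def maps_def)

lemma germ_cases:
  assumes "C \<in> carrier germs" obtains f where "f \<in> lin_maps" "C = germ f"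
  using assms by (auto simp: germ_def germs_def FactGroup_def RCOSETS_def maps_def)

lemma germ_mult:
  "f \<in> lin_maps \<Longrightarrow> g \<in> lin_maps \<Longrightarrow> germ f \<otimes>\<^bsub>germs\<^esub> germ g = germ (\<lambda>x. f x \<oplus> g x)"
  using normal.rcos_sum[OF maps.subgroup_imp_normal[OF null_maps_subgroup], of f g]
  by (simp add: germ_def germs_def FactGroup_def) (simp add: maps_def)

lemma germ_one: "\<one>\<^bsub>germs\<^esub> = germ (\<lambda>x. \<zero>)"
proof -
  have "germ \<one>\<^bsub>maps\<^esub> = null_maps"
    unfolding germ_def by (rule maps.coset_mult_one[OF subgroup.subset[OF null_maps_subgroup]])
  then show ?thesis by (simp add: germs_def FactGroup_def) (simp add: maps_def)
qed

text \<open>Left multiplication on the values of a representative. The representative is an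
  arbitrary choice, justified by \<open>act_germ\<close>: null maps are stable under left
  multiplication.\<close>

definition act :: "'a \<Rightarrow> ('a \<Rightarrow> 'a) set \<Rightarrow> ('a \<Rightarrow> 'a) set" where
  "act r = (\<lambda>C\<in>carrier germs. germ (\<lambda>x. r \<otimes> (SOME f. f \<in> lin_maps \<and> C = germ f) x))"

lemma act_germ:
  assumes r: "r \<in> carrier R" and f: "f \<in> lin_maps"
  shows "act r (germ f) = germ (\<lambda>x. r \<otimes> f x)"
proof -
  define g where "g = (SOME g. g \<in> lin_maps \<and> germ f = germ g)"
  have g: "g \<in> lin_maps" "germ f = germ g"
    unfolding atomize_conj g_def by (rule someI[of _ f]) (simp add: f)
  have "(\<lambda>x. g x \<oplus> \<ominus> f x) \<in> null_maps" using germ_eq_iff[OF g(1) f] g(2) by simp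
  from null_maps_closed(2)[OF this this r]
  have "(\<lambda>x. r \<otimes> g x \<oplus> \<ominus> (r \<otimes> f x)) \<in> null_maps"
    using r lin_maps_carrier[OF f] lin_maps_carrier[OF g(1)] by (simp add: r_distr r_minus)
  then have "germ (\<lambda>x. r \<otimes> g x) = germ (\<lambda>x. r \<otimes> f x)"
    using germ_eq_iff lin_maps_closed(2)[OF f f r] lin_maps_closed(2)[OF g(1) g(1) r] by blast
  then show ?thesis using germ_closed[OF f] by (simp add: act_def g_def)
qed

lemma act_closed:
  assumes r: "r \<in> carrier R" shows "act r \<in> carrier (End_ring germs)"
proof -
  have "act r \<in> hom germs germs"
  proof (rule homI)
    fix C assume "C \<in> carrier germs"
    then obtain f where f: "f \<in> lin_maps" "C = germ f" using germ_cases by blast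
    show "act r C \<in> carrier germs"
      unfolding f(2) act_germ[OF r f(1)] by (rule germ_closed[OF lin_maps_closed(2)[OF f(1) f(1) r]])
    fix D assume "D \<in> carrier germs"
    then obtain g where g: "g \<in> lin_maps" "D = germ g" using germ_cases by blast
    show "act r (C \<otimes>\<^bsub>germs\<^esub> D) = act r C \<otimes>\<^bsub>germs\<^esub> act r D"
      unfolding f(2) g(2) germ_mult[OF f(1) g(1)] act_germ[OF r f(1)] act_germ[OF r g(1)]
        act_germ[OF r lin_maps_closed(1)[OF f(1) g(1)]]
        germ_mult[OF lin_maps_closed(2)[OF f(1) f(1) r] lin_maps_closed(2)[OF g(1) g(1) r]]
      using r lin_maps_carrier[OF f(1)] lin_maps_carrier[OF g(1)] by (simp add: r_distr)
  qed
  then show ?thesis by (simp add: End_ring_def act_def)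
qed

lemma act_hom: "act \<in> ring_hom R (End_ring germs)"
proof (rule ring_hom_memI)
  fix a b assume ab: "a \<in> carrier R" "b \<in> carrier R"
  show "act a \<in> carrier (End_ring germs)" by (rule act_closed[OF ab(1)])
  show "act (a \<otimes> b) = act a \<otimes>\<^bsub>End_ring germs\<^esub> act b"
  proof (rule germs.End_ring_eqI)
    fix C assume C: "C \<in> carrier germs"
    then obtain f where f: "f \<in> lin_maps" "C = germ f" using germ_cases by blast
    show "act (a \<otimes> b) C = (act a \<otimes>\<^bsub>End_ring germs\<^esub> act b) C"
      unfolding germs.End_ring_apply[OF C] unfolding f(2)
      using ab f(1) lin_maps_closed(2)[OF f(1) f(1)] lin_maps_carrier[OF f(1)]
      by (simp add: act_germ m_assoc)
  qed (use ab act_closed germs.End_ring_closures in simp_all)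
  show "act (a \<oplus> b) = act a \<oplus>\<^bsub>End_ring germs\<^esub> act b"
  proof (rule germs.End_ring_eqI)
    fix C assume C: "C \<in> carrier germs"
    then obtain f where f: "f \<in> lin_maps" "C = germ f" using germ_cases by blast
    show "act (a \<oplus> b) C = (act a \<oplus>\<^bsub>End_ring germs\<^esub> act b) C"
      unfolding germs.End_ring_apply[OF C] unfolding f(2)
      using ab f(1) lin_maps_closed(2)[OF f(1) f(1)] lin_maps_carrier[OF f(1)]
      by (simp add: act_germ germ_mult l_distr)
  qed (use ab act_closed germs.End_ring_closures in simp_all)
next
  show "act \<one> = \<one>\<^bsub>End_ring germs\<^esub>"
  proof (rule germs.End_ring_eqI)
    fix C assume C: "C \<in> carrier germs"
    then obtain f where f: "f \<in> lin_maps" "C = germ f" using germ_cases by blast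
    show "act \<one> C = \<one>\<^bsub>End_ring germs\<^esub> C"
      unfolding germs.End_ring_apply[OF C] unfolding f(2)
      using f(1) lin_maps_carrier[OF f(1)] by (simp add: act_germ)
  qed (use act_closed germs.End_ring_closures in simp_all)
qed

lemma germ_eq_one_iff: "f \<in> lin_maps \<Longrightarrow> germ f = \<one>\<^bsub>germs\<^esub> \<longleftrightarrow> (\<exists>t\<in>S. zero_on t f)"
  using germ_eq_iff[OF _ zero_lin_map] lin_maps_carrier by (simp add: germ_one null_maps_def)

lemma act_inj:
  assumes s: "s \<in> S" and f: "f \<in> lin_maps" and z: "act s (germ f) = \<one>\<^bsub>germs\<^esub>"
  shows "germ f = \<one>\<^bsub>germs\<^esub>"
proof -
  have sf: "(\<lambda>x. s \<otimes> f x) \<in> lin_maps" using lin_maps_closed(2)[OF f f] s by simp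
  have "germ (\<lambda>x. s \<otimes> f x) = \<one>\<^bsub>germs\<^esub>" using z act_germ[OF _ f, of s] s by simp
  then obtain t where t: "t \<in> S" "zero_on t (\<lambda>x. s \<otimes> f x)" using germ_eq_one_iff[OF sf] by blast
  have "zero_on t f"
    using t s torsion_cancel[OF s lin_maps_carrier[OF f]] unfolding zero_on_def by blast
  then show ?thesis using germ_eq_one_iff[OF f] t(1) by blast
qed

text \<open>Division by \<open>s\<close>: the right Ore condition writes
  \<open>f(u) t = s a\<close>, and then \<open>ut y \<mapsto> a y\<close> is the quotient of
  \<open>f\<close> by \<open>s\<close> on the smaller right ideal \<open>utR\<close>.\<close>

lemma act_surj:
  assumes s: "s \<in> S" and f: "f \<in> lin_maps"
  obtains g where "g \<in> lin_maps" "act s (germ g) = germ f"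
proof -
  note c = lin_maps_carrier[OF f]
  obtain u where u: "u \<in> S" "lin_on u f" using f by (auto simp: lin_maps_def)
  obtain t a where ta: "t \<in> S" "a \<in> carrier R" "f u \<otimes> t = s \<otimes> a"
    using right_ore[OF c s] by blast
  define m where "m = u \<otimes> t"
  have m: "m \<in> S" using S_closed u ta by (simp add: m_def)
  have fm: "f (m \<otimes> y) \<ominus> s \<otimes> (a \<otimes> y) \<in> torsion" if y: "y \<in> carrier R" for y
  proof -
    have "f (u \<otimes> (t \<otimes> y)) \<ominus> f u \<otimes> (t \<otimes> y) \<in> torsion"
      using u(2) ta(1) y unfolding lin_on_def by simp
    moreover have "f u \<otimes> (t \<otimes> y) = s \<otimes> (a \<otimes> y)"
      using ta u s y c by (simp flip: m_assoc)
    ultimately show ?thesis using u(1) ta(1) y by (simp add: m_def m_assoc)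
  qed
  \<comment> \<open>Well-definedness of \<open>m y \<mapsto> a y\<close> modulo torsion: if
    \<open>m y\<close> is zero then \<open>s a y\<close> is congruent to \<open>f 0\<close>, which
    is torsion, and \<open>s\<close> cancels.\<close>
  have ker: "a \<otimes> y \<in> torsion" if y: "y \<in> carrier R" "m \<otimes> y = \<zero>" for y
  proof -
    have "f \<zero> \<in> torsion" using fm[OF zero_closed] m s ta(2) c by (simp add: a_minus_def)
    have "f \<zero> \<ominus> s \<otimes> (a \<otimes> y) \<in> torsion" using fm[OF y(1)] y(2) by simp
    from J.a_closed[OF \<open>f \<zero> \<in> torsion\<close> J.a_inv_closed[OF this]]
    have "f \<zero> \<oplus> \<ominus> (f \<zero> \<ominus> s \<otimes> (a \<otimes> y)) \<in> torsion" .
    moreover have "f0 \<oplus> \<ominus> (f0 \<ominus> z) = z" if "f0 \<in> carrier R" "z \<in> carrier R" for f0 z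
      using that by algebra
    ultimately have "s \<otimes> (a \<otimes> y) \<in> torsion" using c s ta(2) y(1) by simp
    then show ?thesis using torsion_cancel[OF s] ta(2) y(1) by simp
  qed
  \<comment> \<open>A chosen preimage under left multiplication by \<open>m\<close>. Different
    preimages differ by an annihilated element, which \<open>ker\<close> sends to torsion.\<close>
  define p where "p z = (SOME x. x \<in> carrier R \<and> m \<otimes> x = z)" for z
  have p: "p (m \<otimes> x) \<in> carrier R \<and> m \<otimes> p (m \<otimes> x) = m \<otimes> x" if "x \<in> carrier R" for x
    unfolding p_def by (rule someI_ex) (use that in auto)
  have p1: "p m \<in> carrier R \<and> m \<otimes> p m = m" using p[OF one_closed] m by simp
  define g where "g z = (if z \<in> (\<lambda>x. m \<otimes> x) ` carrier R then a \<otimes> p z else \<zero>)" for z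
  have gc: "g z \<in> carrier R" for z using p ta(2) by (auto simp: g_def)
  have gm: "g (m \<otimes> x) = a \<otimes> p (m \<otimes> x)" if "x \<in> carrier R" for x using that by (auto simp: g_def)
  have gm1: "g m = a \<otimes> p m" using gm[OF one_closed] m by simp
  have "lin_on m g"
    unfolding lin_on_def
  proof
    fix x assume x: "x \<in> carrier R"
    note px = p[OF x]
    have "m \<otimes> (p (m \<otimes> x) \<ominus> p m \<otimes> x) = m \<otimes> p (m \<otimes> x) \<ominus> (m \<otimes> p m) \<otimes> x"
      using px[THEN conjunct1] p1[THEN conjunct1] m x by (simp add: a_minus_def r_distr r_minus m_assoc)
    also have "\<dots> = \<zero>" using px p1 m x by (simp add: a_minus_def r_neg)
    finally have "a \<otimes> (p (m \<otimes> x) \<ominus> p m \<otimes> x) \<in> torsion" using ker px p1 x by simp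
    moreover have "a \<otimes> (p (m \<otimes> x) \<ominus> p m \<otimes> x) = g (m \<otimes> x) \<ominus> g m \<otimes> x"
      unfolding gm[OF x] gm1 using px p1 x ta(2) by (simp add: a_minus_def r_distr r_minus m_assoc)
    ultimately show "g (m \<otimes> x) \<ominus> g m \<otimes> x \<in> torsion" by simp
  qed
  then have g: "g \<in> lin_maps" using m gc by (auto simp: lin_maps_def)
  have sg: "(\<lambda>x. s \<otimes> g x) \<in> lin_maps" using lin_maps_closed(2)[OF g g] s by simp
  have "zero_on m (\<lambda>x. s \<otimes> g x \<oplus> \<ominus> f x)"
    unfolding zero_on_def
  proof
    fix x assume x: "x \<in> carrier R"
    have "f (m \<otimes> x) \<ominus> s \<otimes> g (m \<otimes> x) \<in> torsion"
      using fm[of "p (m \<otimes> x)"] p[OF x] by (simp add: gm[OF x])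
    from J.a_inv_closed[OF this]
    show "s \<otimes> g (m \<otimes> x) \<oplus> \<ominus> f (m \<otimes> x) \<in> torsion"
      using s c gc by (simp add: a_minus_def minus_add a_comm)
  qed
  then have "(\<lambda>x. s \<otimes> g x \<oplus> \<ominus> f x) \<in> null_maps"
    using m lin_maps_closed(1)[OF sg lin_maps_closed(3)[OF f f]] by (auto simp: null_maps_def)
  then show thesis using that[OF g] germ_eq_iff[OF sg f] act_germ[OF _ g, of s] s by simp
qed

lemma act_Units: "act ` S \<subseteq> Units (End_ring germs)"
proof
  fix e assume "e \<in> act ` S"
  then obtain s where s: "s \<in> S" "e = act s" by blast
  have e: "act s \<in> carrier (End_ring germs)" using act_closed s by simp
  interpret h: group_hom germs germs "act s"
    by (rule group_hom.intro) (use germs.is_group germs.End_ringD(1)[OF e] in \<open>auto simp: group_hom_axioms_def\<close>)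
  have "inj_on (act s) (carrier germs)"
    unfolding h.inj_iff_trivial_ker
  proof
    show "kernel germs germs (act s) \<subseteq> {\<one>\<^bsub>germs\<^esub>}"
    proof
      fix C assume "C \<in> kernel germs germs (act s)"
      then have C: "C \<in> carrier germs" "act s C = \<one>\<^bsub>germs\<^esub>" by (auto simp: kernel_def)
      obtain f where "f \<in> lin_maps" "C = germ f" using germ_cases[OF C(1)] by blast
      then show "C \<in> {\<one>\<^bsub>germs\<^esub>}" using act_inj[OF s(1)] C(2) by blast
    qed
    show "{\<one>\<^bsub>germs\<^esub>} \<subseteq> kernel germs germs (act s)" using h.hom_one by (simp add: kernel_def)
  qed
  moreover have "act s ` carrier germs = carrier germs"
  proof
    show "act s ` carrier germs \<subseteq> carrier germs" using germs.End_ringD(2)[OF e] by blast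
    show "carrier germs \<subseteq> act s ` carrier germs"
    proof
      fix C assume "C \<in> carrier germs"
      then obtain f where "f \<in> lin_maps" "C = germ f" using germ_cases by blast
      then obtain g where "g \<in> lin_maps" "act s (germ g) = C" using act_surj[OF s(1)] by blast
      then show "C \<in> act s ` carrier germs" using germ_closed by blast
    qed
  qed
  ultimately show "e \<in> Units (End_ring germs)"
    unfolding s(2) using germs.End_ring_Units[OF e] by (simp add: bij_betw_def)
qed

text \<open>An element of the kernel acts as zero on all germs; tested on the germ of the identity,
  this yields \<open>t \<in> S\<close> with \<open>r t\<close> torsion. Conversely, killing by an
  element of \<open>S\<close> forces zero once that element is a unit.\<close>

lemma ass_eq_torsion: "ass R S = torsion"
proof
  interpret localization R S by unfold_locales auto
  show "ass R S \<subseteq> torsion"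
  proof
    fix r assume "r \<in> ass R S"
    then have r: "r \<in> carrier R" "loc_map R S r = \<zero>\<^bsub>L\<^esub>" by (auto simp: ass_def)
    obtain \<psi> where \<psi>: "\<psi> \<in> ring_hom L (End_ring germs)" "\<And>r. r \<in> carrier R \<Longrightarrow> \<psi> (loc_map R S r) = act r"
      using Loc_lift[OF germs.End_ring_ring act_hom act_Units] by blast
    have act: "act r = \<zero>\<^bsub>End_ring germs\<^esub>"
      using \<psi>(2)[OF r(1)] r(2) ring_hom_zero[OF \<psi>(1) L.ring_axioms germs.End_ring_ring] by simp
    \<comment> \<open>The identity map, set to zero off the carrier because \<open>lin_maps\<close>
      requires values in the ring for every argument of the type.\<close>
    define f where "f x = (if x \<in> carrier R then x else \<zero>)" for x
    have "lin_on \<one> f" by (simp add: lin_on_def f_def a_minus_def r_neg)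
    then have f: "f \<in> lin_maps" using mult_setD(3)[OF S_mult] by (auto simp: lin_maps_def f_def)
    have "germ (\<lambda>x. r \<otimes> f x) = \<one>\<^bsub>germs\<^esub>"
      using act_germ[OF r(1) f] act germs.End_ring_apply(4)[OF germ_closed[OF f]] by simp
    then obtain t where "t \<in> S" "zero_on t (\<lambda>x. r \<otimes> f x)"
      using germ_eq_one_iff[OF lin_maps_closed(2)[OF f f r(1)]] by blast
    then have t: "t \<in> S" "r \<otimes> t \<in> torsion" unfolding zero_on_def by (auto simp: f_def dest: bspec[of _ _ \<one>])
    then obtain v where "v \<in> S" "r \<otimes> t \<otimes> v = \<zero>" unfolding torsion_def by blast
    then show "r \<in> torsion" using r(1) t(1) S_closed[OF t(1), of v] unfolding torsion_def by (auto simp: m_assoc)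
  qed
  show "torsion \<subseteq> ass R S"
  proof
    fix r assume "r \<in> torsion"
    then obtain t where t: "r \<in> carrier R" "t \<in> S" "r \<otimes> t = \<zero>" unfolding torsion_def by blast
    have "loc_map R S r = loc_map R S r \<otimes>\<^bsub>L\<^esub> (loc_map R S t \<otimes>\<^bsub>L\<^esub> loc_x R S t)"
      using t loc_map_x by simp
    also have "\<dots> = loc_map R S (r \<otimes> t) \<otimes>\<^bsub>L\<^esub> loc_x R S t"
      using t(1,2) loc_x_closed by (simp add: L.m_assoc)
    also have "\<dots> = \<zero>\<^bsub>L\<^esub>" unfolding t(3) using loc_x_closed[OF t(2)] by simp
    finally show "r \<in> ass R S" using t by (simp add: ass_def)
  qed
qed

end

section \<open>Goldie's theorem\<close>

lemma acc_on_maximal: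
  assumes acc: "acc_on F" and sub: "G \<subseteq> F" and ne: "A \<in> G"
  obtains M where "M \<in> G" "\<And>B. B \<in> G \<Longrightarrow> M \<subseteq> B \<Longrightarrow> B = M"
proof (rule ccontr)
  note max = that
  assume "\<not> thesis"
  have step: "\<exists>B\<in>G. M \<subset> B" if M: "M \<in> G" for M
  proof (rule ccontr)
    assume "\<not> (\<exists>B\<in>G. M \<subset> B)"
    then have "\<And>B. B \<in> G \<Longrightarrow> M \<subseteq> B \<Longrightarrow> B = M" by blast
    with \<open>\<not> thesis\<close> M max show False by blast
  qed
  have "\<exists>f. \<forall>n. f n \<in> G \<and> f n \<subset> f (Suc n)"
    by (rule dependent_nat_choice) (use ne step in auto)
  then obtain f where f: "\<And>n. f n \<in> G" "\<And>n. f n \<subset> f (Suc n)" by (metis (no_types))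
  have "(\<forall>n. f n \<in> F) \<and> (\<forall>n. f n \<subset> f (Suc n))" using f sub by (intro conjI allI) auto
  then show False using acc unfolding acc_on_def by (elim notE) (rule exI)
qed

context ring
begin

lemma left_ideal_by_closure:
  assumes "I \<subseteq> carrier R" "\<zero> \<in> I" "\<And>x y. x \<in> I \<Longrightarrow> y \<in> I \<Longrightarrow> x \<oplus> y \<in> I"
    "\<And>r x. r \<in> carrier R \<Longrightarrow> x \<in> I \<Longrightarrow> r \<otimes> x \<in> I"
  shows "left_ideal I R"
  unfolding left_ideal_def
proof
  show "additive_subgroup I R"
  proof (rule additive_subgroup.intro, rule subgroup.intro)
    fix x assume x: "x \<in> I"
    have "(\<ominus> \<one>) \<otimes> x = \<ominus> x" using x assms(1) by (auto simp: l_minus)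
    then have "\<ominus> x \<in> I" using assms(4)[of "\<ominus> \<one>" x] x by simp
    then show "inv\<^bsub>add_monoid R\<^esub> x \<in> I" by (simp add: a_inv_def)
  qed (use assms in simp_all)
qed (use assms in blast)

lemma ideal_by_closure:
  assumes "I \<subseteq> carrier R" "\<zero> \<in> I" "\<And>x y. x \<in> I \<Longrightarrow> y \<in> I \<Longrightarrow> x \<oplus> y \<in> I"
    "\<And>r x. r \<in> carrier R \<Longrightarrow> x \<in> I \<Longrightarrow> r \<otimes> x \<in> I" "\<And>r x. r \<in> carrier R \<Longrightarrow> x \<in> I \<Longrightarrow> x \<otimes> r \<in> I"
  shows "ideal I R"
proof (rule idealI[OF ring_axioms])
  have "left_ideal I R" by (rule left_ideal_by_closure) (fact assms)+
  then show "subgroup I (add_monoid R)" by (simp add: left_ideal_def additive_subgroup_def)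
qed (use assms in simp_all)

lemma left_idealD:
  assumes "left_ideal I R"
  shows "x \<in> I \<Longrightarrow> x \<in> carrier R" "\<zero> \<in> I" "x \<in> I \<Longrightarrow> y \<in> I \<Longrightarrow> x \<oplus> y \<in> I"
    "r \<in> carrier R \<Longrightarrow> x \<in> I \<Longrightarrow> r \<otimes> x \<in> I" "x \<in> I \<Longrightarrow> \<ominus> x \<in> I"
    "x \<in> I \<Longrightarrow> y \<in> I \<Longrightarrow> x \<ominus> y \<in> I"
proof -
  interpret additive_subgroup I R using assms by (simp add: left_ideal_def)
  show "x \<in> I \<Longrightarrow> x \<in> carrier R" "\<zero> \<in> I" "x \<in> I \<Longrightarrow> y \<in> I \<Longrightarrow> x \<oplus> y \<in> I"
    "r \<in> carrier R \<Longrightarrow> x \<in> I \<Longrightarrow> r \<otimes> x \<in> I"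
    using assms by (auto simp: left_ideal_def)
  show inv: "x \<in> I \<Longrightarrow> \<ominus> x \<in> I" for x
    using a_subgroup subgroup.m_inv_closed[of I "add_monoid R" x] by (simp add: a_inv_def)
  show "x \<in> I \<Longrightarrow> y \<in> I \<Longrightarrow> x \<ominus> y \<in> I" unfolding a_minus_def using inv a_closed by blast
qed

lemma left_ideal_principal:
  assumes d: "d \<in> carrier R" shows "left_ideal {r \<otimes> d | r. r \<in> carrier R} R"
proof (rule left_ideal_by_closure)
  show "\<zero> \<in> {r \<otimes> d | r. r \<in> carrier R}" using d by (intro CollectI exI[of _ \<zero>]) simp
  fix x assume "x \<in> {r \<otimes> d | r. r \<in> carrier R}"
  then obtain r where r: "r \<in> carrier R" "x = r \<otimes> d" by blast
  show "s \<otimes> x \<in> {r \<otimes> d | r. r \<in> carrier R}" if "s \<in> carrier R" for s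
    using r d that by (intro CollectI exI[of _ "s \<otimes> r"]) (simp add: m_assoc)
  fix y assume "y \<in> {r \<otimes> d | r. r \<in> carrier R}"
  then obtain s where s: "s \<in> carrier R" "y = s \<otimes> d" by blast
  show "x \<oplus> y \<in> {r \<otimes> d | r. r \<in> carrier R}"
    using r s d by (intro CollectI exI[of _ "r \<oplus> s"]) (simp add: l_distr)
qed (use d in auto)

lemma left_ideal_sum:
  assumes I: "left_ideal I R" and J: "left_ideal J R"
  shows "left_ideal {x \<oplus> y | x y. x \<in> I \<and> y \<in> J} R"
proof (rule left_ideal_by_closure)
  note ID = left_idealD[OF I] and JD = left_idealD[OF J]
  let ?E = "{x \<oplus> y | x y. x \<in> I \<and> y \<in> J}"
  have memI: "x \<oplus> y \<in> ?E" if "x \<in> I" "y \<in> J" for x y using that by blast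
  show "?E \<subseteq> carrier R" using ID(1) JD(1) by blast
  show "\<zero> \<in> ?E" using memI[OF ID(2) JD(2)] by simp
  fix y assume "y \<in> ?E"
  then obtain x b where y: "x \<in> I" "b \<in> J" "y = x \<oplus> b" by blast
  show "r \<otimes> y \<in> ?E" if "r \<in> carrier R" for r
    using memI[OF ID(4)[OF that y(1)] JD(4)[OF that y(2)]] that ID(1)[OF y(1)] JD(1)[OF y(2)]
    unfolding y(3) by (simp only: r_distr)
  fix z assume "z \<in> ?E"
  then obtain x' b' where z: "x' \<in> I" "b' \<in> J" "z = x' \<oplus> b'" by blast
  have "y \<oplus> z = (x \<oplus> x') \<oplus> (b \<oplus> b')"
    unfolding y(3) z(3) using ID(1)[OF y(1)] JD(1)[OF y(2)] ID(1)[OF z(1)] JD(1)[OF z(2)] by (simp add: a_ac)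
  then show "y \<oplus> z \<in> ?E" using memI[OF ID(3)[OF y(1) z(1)] JD(3)[OF y(2) z(2)]] by simp
qed

lemma idealD:
  assumes "ideal I R"
  shows "x \<in> I \<Longrightarrow> x \<in> carrier R" "\<zero> \<in> I" "x \<in> I \<Longrightarrow> y \<in> I \<Longrightarrow> x \<oplus> y \<in> I"
    "r \<in> carrier R \<Longrightarrow> x \<in> I \<Longrightarrow> r \<otimes> x \<in> I" "r \<in> carrier R \<Longrightarrow> x \<in> I \<Longrightarrow> x \<otimes> r \<in> I"
    "x \<in> I \<Longrightarrow> \<ominus> x \<in> I"
proof -
  interpret ideal I R by fact
  show "x \<in> I \<Longrightarrow> x \<in> carrier R" "\<zero> \<in> I" "x \<in> I \<Longrightarrow> y \<in> I \<Longrightarrow> x \<oplus> y \<in> I"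
    "r \<in> carrier R \<Longrightarrow> x \<in> I \<Longrightarrow> r \<otimes> x \<in> I" "r \<in> carrier R \<Longrightarrow> x \<in> I \<Longrightarrow> x \<otimes> r \<in> I"
    using I_l_closed I_r_closed by auto
  show "x \<in> I \<Longrightarrow> \<ominus> x \<in> I" using a_inv_closed by blast
qed

lemma ideal_imp_left_ideal: "ideal I R \<Longrightarrow> left_ideal I R"
  by (rule left_ideal_by_closure) (use idealD in blast)+

lemma left_ideal_proper: "left_ideal I R \<Longrightarrow> \<one> \<in> I \<Longrightarrow> I = carrier R"
proof
  assume I: "left_ideal I R" "\<one> \<in> I"
  show "carrier R \<subseteq> I"
  proof
    fix x assume "x \<in> carrier R"
    then show "x \<in> I" using left_idealD(4)[OF I(1), of x \<one>] I(2) by simp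
  qed
qed (use left_idealD(1) in blast)

lemma left_ideal_unit:
  assumes I: "left_ideal I R" and u: "u \<in> I" "u \<in> Units R"
  shows "I = carrier R"
proof (rule left_ideal_proper[OF I])
  have "inv u \<otimes> u \<in> I" using left_idealD(4)[OF I] u by blast
  then show "\<one> \<in> I" using u by simp
qed

lemma l_ann_left_ideal: "Y \<subseteq> carrier R \<Longrightarrow> left_ideal (l_ann R Y) R"
  by (rule left_ideal_by_closure) (auto simp: l_ann_def l_distr m_assoc subset_iff)

lemma l_ann_ideal:
  assumes "left_ideal Y R" shows "ideal (l_ann R Y) R"
proof (rule ideal_by_closure)
  note Y = left_idealD[OF assms]
  fix r x assume "r \<in> carrier R" "x \<in> l_ann R Y"
  then show "x \<otimes> r \<in> l_ann R Y" using Y(1,4) by (auto simp: l_ann_def m_assoc)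
qed (use left_idealD[OF assms] in \<open>auto simp: l_ann_def l_distr m_assoc\<close>)

text \<open>The sums \<open>K 0 + \<dots> + K n\<close> are direct because they can be split off one at a time along the
  chain \<open>M\<close>.\<close>

lemma independent_family_chain:
  assumes "\<And>n. left_ideal (M n) R" "\<And>n. M (Suc n) \<subseteq> M n" "\<And>n. K n \<subseteq> M n"
    "\<And>n. K n \<inter> M (Suc n) \<subseteq> {\<zero>}"
  shows "independent_family R K"
proof -
  have sum_mem: "finsum R f {..n} \<in> J"
    if J: "left_ideal J R" and f: "\<forall>i\<le>n. f i \<in> J" for f :: "nat \<Rightarrow> 'a" and n :: nat and J
    using f
  proof (induction n)
    case 0
    then show ?case using left_idealD(1)[OF J] by (simp add: finsum_0)
  next
    case (Suc n)
    have "f \<in> {..Suc n} \<rightarrow> carrier R" using Suc.prems left_idealD(1)[OF J] by auto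
    then show ?case using Suc left_idealD(3)[OF J] by (simp add: finsum_Suc)
  qed
  have "\<forall>i\<le>n. f i = \<zero>"
    if "\<And>n. left_ideal (M n) R" "\<And>n. M (Suc n) \<subseteq> M n" "\<And>n. K n \<subseteq> M n" "\<And>n. K n \<inter> M (Suc n) \<subseteq> {\<zero>}"
      "\<forall>i\<le>n. f i \<in> K i" "finsum R f {..n} = \<zero>" for n f and K M :: "nat \<Rightarrow> 'a set"
    using that
  proof (induction n arbitrary: f K M)
    case 0
    have "f 0 \<in> carrier R" using 0 left_idealD(1) by blast
    then show ?case using 0(6) by (simp add: finsum_0)
  next
    case (Suc n)
    have fM: "f i \<in> M i" if "i \<le> Suc n" for i using Suc.prems(3,5) that by blast
    then have c: "f i \<in> carrier R" if "i \<le> Suc n" for i using left_idealD(1)[OF Suc.prems(1)] that by blast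
    have M1: "M (Suc i) \<subseteq> M (Suc 0)" for i
      using lift_Suc_antimono_le[of "\<lambda>i. M (Suc i)" 0 i] Suc.prems(2) by simp
    let ?g = "\<lambda>i. f (Suc i)"
    have g: "finsum R ?g {..n} \<in> M (Suc 0)"
      by (rule sum_mem[OF Suc.prems(1)]) (use fM M1 in blast)
    note gc = left_idealD(1)[OF Suc.prems(1) g]
    have eq: "finsum R ?g {..n} \<oplus> f 0 = \<zero>"
      using Suc.prems(6) finsum_Suc2[of f n] c by simp
    have "f 0 = \<ominus> finsum R ?g {..n}"
      using minus_equality[OF _ gc c[of 0]] eq a_comm[OF gc c[of 0]] by simp
    then have "f 0 \<in> M (Suc 0)" using left_idealD(5)[OF Suc.prems(1) g] by simp
    then have f0: "f 0 = \<zero>" using Suc.prems(4)[of 0] Suc.prems(5) by blast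
    have "finsum R ?g {..n} = \<zero>" using eq f0 gc by simp
    moreover have "\<forall>i\<le>n. ?g i \<in> K (Suc i)" using Suc.prems(5) by simp
    ultimately have g0: "\<forall>i\<le>n. ?g i = \<zero>"
      by (intro Suc.IH[of "\<lambda>i. M (Suc i)" "\<lambda>i. K (Suc i)" ?g] Suc.prems(1-4))
    show ?case
    proof (intro allI impI)
      fix i assume "i \<le> Suc n"
      then show "f i = \<zero>" using f0 g0 by (cases i) simp_all
    qed
  qed
  with assms show ?thesis unfolding independent_family_def by blast
qed

end

text \<open>The usual condition of meeting every nonzero left ideal, tested on principal
  ones.\<close>

definition left_essential :: "('a, 'm) ring_scheme \<Rightarrow> 'a set \<Rightarrow> bool" where
  "left_essential R E \<longleftrightarrow> left_ideal E R \<and>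
     (\<forall>a\<in>carrier R. a \<noteq> \<zero>\<^bsub>R\<^esub> \<longrightarrow> (\<exists>r\<in>carrier R. r \<otimes>\<^bsub>R\<^esub> a \<in> E \<and> r \<otimes>\<^bsub>R\<^esub> a \<noteq> \<zero>\<^bsub>R\<^esub>))"

lemma left_essentialE:
  assumes "left_essential R E" "a \<in> carrier R" "a \<noteq> \<zero>\<^bsub>R\<^esub>"
  obtains r where "r \<in> carrier R" "r \<otimes>\<^bsub>R\<^esub> a \<in> E" "r \<otimes>\<^bsub>R\<^esub> a \<noteq> \<zero>\<^bsub>R\<^esub>"
  using assms unfolding left_essential_def by blast

context ring
begin

lemma left_essential_mono:
  "left_essential R E \<Longrightarrow> left_ideal D R \<Longrightarrow> E \<subseteq> D \<Longrightarrow> left_essential R D"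
  unfolding left_essential_def by blast

text \<open>If \<open>a \<otimes> b\<close> is zero then \<open>a\<close> already lies in the
  preimage; otherwise any multiplier that brings \<open>a \<otimes> b\<close> nontrivially into
  \<open>E\<close> also works for \<open>a\<close>.\<close>

lemma left_essential_preimage:
  assumes E: "left_essential R E" and b: "b \<in> carrier R"
  shows "left_essential R {x \<in> carrier R. x \<otimes> b \<in> E}"
proof -
  have L: "left_ideal E R" using E by (simp add: left_essential_def)
  note LD = left_idealD[OF L]
  have ideal: "left_ideal {x \<in> carrier R. x \<otimes> b \<in> E} R"
    by (rule left_ideal_by_closure) (use b LD in \<open>auto simp: l_distr m_assoc\<close>)
  have "\<exists>r\<in>carrier R. r \<otimes> a \<in> {x \<in> carrier R. x \<otimes> b \<in> E} \<and> r \<otimes> a \<noteq> \<zero>"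
    if a: "a \<in> carrier R" "a \<noteq> \<zero>" for a
  proof (cases "a \<otimes> b = \<zero>")
    case True
    then show ?thesis using a LD(2) by (intro bexI[of _ \<one>]) auto
  next
    case False
    obtain r where r: "r \<in> carrier R" "r \<otimes> (a \<otimes> b) \<in> E" "r \<otimes> (a \<otimes> b) \<noteq> \<zero>"
      using left_essentialE[OF E m_closed[OF a(1) b] False] by blast
    have "r \<otimes> a \<otimes> b = r \<otimes> (a \<otimes> b)" using r(1) a(1) b by (simp add: m_assoc)
    then show ?thesis using r a(1) b by (intro bexI[of _ r]) auto
  qed
  then show ?thesis using ideal unfolding left_essential_def by blast
qed

end

section \<open>Regular elements in essential one-sided ideals\<close>

locale semiprime_goldie = ring R for R (structure) +
  assumes semiprime_R: "semiprime R" and goldie_R: "goldie R"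
begin

lemma opp_semiprime_goldie: "semiprime_goldie (opp R)"
  by (rule semiprime_goldie.intro)
    (simp_all add: opp_ring ring_axioms semiprime_goldie_axioms_def semiprime_R goldie_R)

text \<open>The elementwise form of semiprimeness, \<open>aRa = 0\<close> implies
  \<open>a = 0\<close>.\<close>

lemma semiprime_elem:
  assumes a: "a \<in> carrier R" and z: "\<And>x. x \<in> carrier R \<Longrightarrow> a \<otimes> x \<otimes> a = \<zero>"
  shows "a = \<zero>"
proof -
  define J where "J = {x \<in> carrier R. \<forall>r\<in>carrier R. x \<otimes> r \<otimes> a = \<zero>}"
  \<comment> \<open>\<open>K\<close> is the part of \<open>J\<close> annihilated by \<open>J\<close>
    from the left, so its square is zero. It contains \<open>a\<close>, which avoids describing the
    ideal generated by \<open>a\<close>.\<close>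
  define K where "K = {x \<in> J. \<forall>j\<in>J. j \<otimes> x = \<zero>}"
  have J: "ideal J R"
  proof (rule ideal_by_closure)
    fix r x assume rx: "r \<in> carrier R" "x \<in> J"
    then have x: "x \<in> carrier R" "\<And>s. s \<in> carrier R \<Longrightarrow> x \<otimes> s \<otimes> a = \<zero>" by (auto simp: J_def)
    have "r \<otimes> x \<otimes> s \<otimes> a = r \<otimes> (x \<otimes> s \<otimes> a)" "x \<otimes> r \<otimes> s \<otimes> a = x \<otimes> (r \<otimes> s) \<otimes> a" if "s \<in> carrier R" for s
      using rx(1) x(1) a that by (simp_all add: m_assoc)
    then show "r \<otimes> x \<in> J" "x \<otimes> r \<in> J" using rx(1) x by (simp_all add: J_def)
  qed (use a in \<open>auto simp: J_def l_distr\<close>)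
  note JD = idealD[OF J]
  have "ideal K R"
  proof (rule ideal_by_closure)
    fix r x assume r: "r \<in> carrier R" and "x \<in> K"
    then have x: "x \<in> J" "\<And>j. j \<in> J \<Longrightarrow> j \<otimes> x = \<zero>" by (auto simp: K_def)
    have "j \<otimes> (r \<otimes> x) = \<zero>" if "j \<in> J" for j
      using x(2)[of "j \<otimes> r"] JD(5)[OF r that] JD(1) that r x(1) by (simp add: m_assoc)
    then show "r \<otimes> x \<in> K" using JD(4)[OF r x(1)] by (simp add: K_def)
    have "j \<otimes> (x \<otimes> r) = \<zero>" if "j \<in> J" for j
      using x(2)[OF that] JD(1) that r x(1) by (simp flip: m_assoc)
    then show "x \<otimes> r \<in> K" using JD(5)[OF r x(1)] by (simp add: K_def)
  next
    show "x \<oplus> y \<in> K" if "x \<in> K" "y \<in> K" for x y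
      using that JD(1,3) unfolding K_def by (simp add: r_distr)
  qed (use JD(1,2) in \<open>auto simp: K_def\<close>)
  moreover have "\<forall>i\<in>K. \<forall>j\<in>K. i \<otimes> j = \<zero>" by (auto simp: K_def)
  ultimately have "K = {\<zero>}" using semiprime_R unfolding semiprime_def by blast
  moreover have "a \<in> J" using a z by (simp add: J_def)
  moreover have "j \<otimes> a = \<zero>" if "j \<in> J" for j
  proof -
    have "j \<otimes> \<one> \<otimes> a = \<zero>" using that unfolding J_def by blast
    then show ?thesis using JD(1)[OF that] by simp
  qed
  ultimately show ?thesis unfolding K_def by blast
qed

lemma acc_l_ann: "acc_on {l_ann R Y | Y. Y \<subseteq> carrier R}"
  using goldie_R by (simp add: goldie_def left_goldie_def)

lemma acc_r_ann: "acc_on {r_ann R Y | Y. Y \<subseteq> carrier R}"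
  using goldie_R by (simp add: goldie_def right_goldie_def)

lemma no_infinite_independent_family:
  assumes "\<And>n. left_ideal (K n) R" "\<And>n. K n \<noteq> {\<zero>}"
  shows "\<not> independent_family R K"
proof
  assume "independent_family R K"
  then have "\<exists>L. (\<forall>n. left_ideal (L n) R \<and> L n \<noteq> {\<zero>}) \<and> independent_family R L"
    using assms by (intro exI[of _ K]) simp
  then show False using goldie_R by (simp add: goldie_def left_goldie_def finite_left_udim_def)
qed

lemma l_ann_maximal:
  assumes "\<And>a. a \<in> C \<Longrightarrow> a \<in> carrier R" "b \<in> C"
  obtains a where "a \<in> C" "\<And>c. c \<in> C \<Longrightarrow> l_ann R {a} \<subseteq> l_ann R {c} \<Longrightarrow> l_ann R {c} = l_ann R {a}"
proof -
  have "(\<lambda>a. l_ann R {a}) ` C \<subseteq> {l_ann R Y | Y. Y \<subseteq> carrier R}" using assms(1) by blast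
  from acc_on_maximal[OF acc_l_ann this imageI[OF assms(2)]] that show thesis
    by (smt (verit, best) image_iff)
qed

text \<open>Descending chains of left annihilators correspond to ascending chains of right annihilators.\<close>

lemma l_ann_minimal:
  assumes C: "\<And>a. a \<in> C \<Longrightarrow> a \<in> carrier R" and b: "b \<in> C"
  obtains a where "a \<in> C" "\<And>c. c \<in> C \<Longrightarrow> l_ann R {c} \<subseteq> l_ann R {a} \<Longrightarrow> l_ann R {c} = l_ann R {a}"
proof -
  define h where "h a = r_ann R (l_ann R {a})" for a
  have "h ` C \<subseteq> {r_ann R Y | Y. Y \<subseteq> carrier R}"
    unfolding h_def by (force simp: l_ann_def)
  then obtain M where M: "M \<in> h ` C" "\<And>B. B \<in> h ` C \<Longrightarrow> M \<subseteq> B \<Longrightarrow> B = M"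
    using acc_on_maximal[OF acc_r_ann _ imageI[OF b]] by blast
  obtain a where a: "a \<in> C" "M = h a" using M(1) by blast
  have inv: "l_ann R (h c) = l_ann R {c}" if "c \<in> C" for c
    using C[OF that] unfolding h_def l_ann_def r_ann_def by auto
  show thesis
  proof (rule that[OF a(1)])
    fix c assume c: "c \<in> C" "l_ann R {c} \<subseteq> l_ann R {a}"
    then have "h a \<subseteq> h c" unfolding h_def r_ann_def by blast
    then have "h c = h a" using M(2) a(2) c(1) by blast
    then show "l_ann R {c} = l_ann R {a}" using inv[OF c(1)] inv[OF a(1)] by simp
  qed
qed

text \<open>The left singular ideal vanishes. Among nonzero elements with essential left annihilator
  take \<open>a\<close> with a maximal one; a nonzero \<open>a x a\<close> would have the same
  annihilator, so \<open>a x a\<close> is always zero and semiprimeness applies.\<close>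

lemma left_nonsingular:
  assumes E: "left_essential R E" and b: "b \<in> carrier R" and Eb: "\<And>x. x \<in> E \<Longrightarrow> x \<otimes> b = \<zero>"
  shows "b = \<zero>"
proof (rule ccontr)
  assume "b \<noteq> \<zero>"
  define Z where "Z = {a \<in> carrier R. a \<noteq> \<zero> \<and> left_essential R (l_ann R {a})}"
  have "E \<subseteq> l_ann R {b}" using E left_idealD(1) Eb unfolding left_essential_def l_ann_def by blast
  then have "b \<in> Z"
    using left_essential_mono[OF E l_ann_left_ideal] b \<open>b \<noteq> \<zero>\<close> by (simp add: Z_def)
  then obtain a where a: "a \<in> Z" "\<And>c. c \<in> Z \<Longrightarrow> l_ann R {a} \<subseteq> l_ann R {c} \<Longrightarrow> l_ann R {c} = l_ann R {a}"
    using l_ann_maximal[of Z b] unfolding Z_def by blast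
  have ac: "a \<in> carrier R" "a \<noteq> \<zero>" "left_essential R (l_ann R {a})" using a(1) by (auto simp: Z_def)
  have "a \<otimes> x \<otimes> a = \<zero>" if x: "x \<in> carrier R" for x
  proof (rule ccontr)
    assume nz: "a \<otimes> x \<otimes> a \<noteq> \<zero>"
    have sub: "l_ann R {a} \<subseteq> l_ann R {a \<otimes> x \<otimes> a}"
      using ac(1) x by (auto simp: l_ann_def simp flip: m_assoc)
    have "left_essential R (l_ann R {a \<otimes> x \<otimes> a})"
      using left_essential_mono[OF ac(3) l_ann_left_ideal sub] ac(1) x by simp
    then have eq: "l_ann R {a \<otimes> x \<otimes> a} = l_ann R {a}"
      using a(2)[OF _ sub] nz ac(1) x by (simp add: Z_def)
    \<comment> \<open>Essentiality is applied to the preimage under right multiplication by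
      \<open>x\<close>: it gives \<open>r a\<close> nonzero although \<open>r a x a\<close> is zero,
      against the equality of the two annihilators.\<close>
    obtain r where r: "r \<in> carrier R" "r \<otimes> a \<in> {y \<in> carrier R. y \<otimes> x \<in> l_ann R {a}}" "r \<otimes> a \<noteq> \<zero>"
      using left_essentialE[OF left_essential_preimage[OF ac(3) x] ac(1,2)] by blast
    then have "r \<in> l_ann R {a \<otimes> x \<otimes> a}" using ac(1) x by (simp add: l_ann_def m_assoc)
    then have "r \<in> l_ann R {a}" using eq by simp
    then show False using r(3) by (simp add: l_ann_def)
  qed
  then show False using semiprime_elem ac by blast
qed

text \<open>Take \<open>a\<close> in \<open>L\<close> nonzero with maximal left annihilator and
  \<open>x\<close> with \<open>a x a\<close> nonzero; then \<open>a x a\<close> has the same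
  annihilator as \<open>a\<close>, and \<open>b = x a\<close> does what is wanted.\<close>

lemma exists_same_square_ann:
  assumes L: "left_ideal L R" and y: "y \<in> L" "y \<noteq> \<zero>"
  obtains b where "b \<in> L" "b \<noteq> \<zero>" "\<And>x. x \<in> carrier R \<Longrightarrow> x \<otimes> (b \<otimes> b) = \<zero> \<Longrightarrow> x \<otimes> b = \<zero>"
proof -
  note LD = left_idealD[OF L]
  define C where "C = {a \<in> L. a \<noteq> \<zero>}"
  obtain a where a: "a \<in> C" "\<And>c. c \<in> C \<Longrightarrow> l_ann R {a} \<subseteq> l_ann R {c} \<Longrightarrow> l_ann R {c} = l_ann R {a}"
    using l_ann_maximal[of C y] y LD(1) unfolding C_def by blast
  have ac: "a \<in> L" "a \<noteq> \<zero>" "a \<in> carrier R" using a(1) LD(1) by (auto simp: C_def)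
  obtain x where x: "x \<in> carrier R" "a \<otimes> x \<otimes> a \<noteq> \<zero>" using semiprime_elem ac by blast
  have "a \<otimes> x \<otimes> a \<in> C" using LD(4)[OF _ ac(1), of "a \<otimes> x"] x ac by (simp add: C_def)
  moreover have "l_ann R {a} \<subseteq> l_ann R {a \<otimes> x \<otimes> a}"
    using ac(3) x(1) by (auto simp: l_ann_def simp flip: m_assoc)
  ultimately have eq: "l_ann R {a \<otimes> x \<otimes> a} = l_ann R {a}" using a(2) by blast
  show thesis
  proof (rule that)
    show "x \<otimes> a \<in> L" using LD(4) x(1) ac(1) by blast
    show "x \<otimes> a \<noteq> \<zero>"
    proof
      assume "x \<otimes> a = \<zero>"
      then have "a \<otimes> x \<otimes> a = \<zero>" using ac(3) x(1) by (simp add: m_assoc)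
      then show False using x(2) by simp
    qed
    fix z assume z: "z \<in> carrier R" "z \<otimes> ((x \<otimes> a) \<otimes> (x \<otimes> a)) = \<zero>"
    then have "z \<otimes> x \<in> l_ann R {a \<otimes> x \<otimes> a}" using ac(3) x(1) by (simp add: l_ann_def m_assoc)
    then have "z \<otimes> x \<in> l_ann R {a}" using eq by simp
    then show "z \<otimes> (x \<otimes> a) = \<zero>" using z(1) ac(3) x(1) by (simp add: l_ann_def m_assoc)
  qed
qed

text \<open>If \<open>Ra\<close> met \<open>Rc\<close> trivially for a nonzero \<open>a\<close>, the
  left ideals \<open>R a c^n\<close> would form an infinite direct sum.\<close>

lemma principal_left_essential:
  assumes c: "c \<in> carrier R" and ann: "\<And>x. x \<in> carrier R \<Longrightarrow> x \<otimes> c = \<zero> \<Longrightarrow> x = \<zero>"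
  shows "left_essential R {r \<otimes> c | r. r \<in> carrier R}"
proof (rule ccontr)
  let ?p = "\<lambda>n::nat. c [^] n"
  have pc: "?p n \<in> carrier R" for n using c by simp
  assume "\<not> left_essential R {r \<otimes> c | r. r \<in> carrier R}"
  then obtain a where a: "a \<in> carrier R" "a \<noteq> \<zero>"
    and na: "\<And>r. r \<in> carrier R \<Longrightarrow> r \<otimes> a \<in> {r \<otimes> c | r. r \<in> carrier R} \<Longrightarrow> r \<otimes> a = \<zero>"
    using left_ideal_principal[OF c] unfolding left_essential_def by blast
  have cancel: "x = \<zero>" if "x \<in> carrier R" "x \<otimes> ?p n = \<zero>" for x n
    using that
  proof (induction n)
    case (Suc n)
    then have "(x \<otimes> ?p n) \<otimes> c = \<zero>" using c by (simp add: m_assoc)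
    then show ?case using Suc ann[of "x \<otimes> ?p n"] pc by simp
  qed simp
  let ?K = "\<lambda>n. {r \<otimes> (a \<otimes> ?p n) | r. r \<in> carrier R}" and ?M = "\<lambda>n. {r \<otimes> ?p n | r. r \<in> carrier R}"
  have p_Suc: "?p (Suc n) = c \<otimes> ?p n" for n using nat_pow_Suc2[OF c] by simp
  have "independent_family R ?K"
  proof (rule independent_family_chain[of ?M])
    show "left_ideal (?M n) R" for n by (rule left_ideal_principal[OF pc])
    show "?M (Suc n) \<subseteq> ?M n" for n
    proof
      fix x assume "x \<in> ?M (Suc n)"
      then obtain r where "r \<in> carrier R" "x = r \<otimes> ?p (Suc n)" by blast
      then have "x = r \<otimes> c \<otimes> ?p n" unfolding p_Suc using m_assoc[OF _ c pc] by simp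
      then show "x \<in> ?M n" using \<open>r \<in> carrier R\<close> c by blast
    qed
    show "?K n \<subseteq> ?M n" for n
    proof
      fix x assume "x \<in> ?K n"
      then obtain r where "r \<in> carrier R" "x = r \<otimes> (a \<otimes> ?p n)" by blast
      then show "x \<in> ?M n" using a(1) pc by (intro CollectI exI[of _ "r \<otimes> a"]) (simp add: m_assoc)
    qed
    show "?K n \<inter> ?M (Suc n) \<subseteq> {\<zero>}" for n
    proof
      fix x assume "x \<in> ?K n \<inter> ?M (Suc n)"
      then obtain r s where r: "r \<in> carrier R" "x = r \<otimes> (a \<otimes> ?p n)"
        and s: "s \<in> carrier R" "x = s \<otimes> ?p (Suc n)" by blast
      \<comment> \<open>Cancelling \<open>c^n\<close> on the right turns an element common to
        \<open>R a c^n\<close> and \<open>R c^(n+1)\<close> into one common to \<open>Ra\<close> and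
        \<open>Rc\<close>.\<close>
      have "(r \<otimes> a \<ominus> s \<otimes> c) \<otimes> ?p n = r \<otimes> (a \<otimes> ?p n) \<ominus> s \<otimes> ?p (Suc n)"
        unfolding p_Suc using r(1) s(1) a(1) c pc by (simp add: a_minus_def l_distr l_minus m_assoc)
      also have "\<dots> = \<zero>" unfolding r(2)[symmetric] s(2)[symmetric]
        using r a(1) pc by (simp add: a_minus_def r_neg)
      finally have "r \<otimes> a \<ominus> s \<otimes> c = \<zero>" using cancel r(1) s(1) a(1) c by simp
      then have "r \<otimes> a = s \<otimes> c" using r(1) s(1) a(1) c by simp
      then have "r \<otimes> a = \<zero>" using na[OF r(1)] s(1) by blast
      then have "x = \<zero>" using r a(1) pc by (simp flip: m_assoc)
      then show "x \<in> {\<zero>}" by simp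
    qed
  qed
  moreover have "left_ideal (?K n) R \<and> ?K n \<noteq> {\<zero>}" for n
  proof
    show "left_ideal (?K n) R" by (rule left_ideal_principal) (use a(1) pc in simp)
    have "a \<otimes> ?p n \<noteq> \<zero>" using cancel a by blast
    moreover have "a \<otimes> ?p n \<in> ?K n" using a(1) pc by (intro CollectI exI[of _ \<one>]) simp
    ultimately show "?K n \<noteq> {\<zero>}" by blast
  qed
  ultimately show False using no_infinite_independent_family[of ?K] by simp
qed

text \<open>Among the \<open>c\<close> in \<open>E\<close> whose square has the same left
  annihilator, one with minimal annihilator is left cancellable by zero only: otherwise some
  \<open>b\<close> with \<open>b c = 0\<close> could be added to it, and \<open>c + b\<close> would
  have a strictly smaller annihilator.\<close>

theorem left_essential_regular:
  assumes E: "left_essential R E"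
  obtains c where "c \<in> E" "c \<in> regular R"
proof -
  have LE: "left_ideal E R" using E by (simp add: left_essential_def)
  note ED = left_idealD[OF LE]
  define C where "C = {c \<in> E. \<forall>x\<in>carrier R. x \<otimes> (c \<otimes> c) = \<zero> \<longrightarrow> x \<otimes> c = \<zero>}"
  have "\<zero> \<in> C" using ED(2) by (simp add: C_def)
  then obtain c where c: "c \<in> C" "\<And>d. d \<in> C \<Longrightarrow> l_ann R {d} \<subseteq> l_ann R {c} \<Longrightarrow> l_ann R {d} = l_ann R {c}"
    using l_ann_minimal[of C \<zero>] ED(1) unfolding C_def by blast
  have cE: "c \<in> E" and cc: "\<And>x. x \<in> carrier R \<Longrightarrow> x \<otimes> (c \<otimes> c) = \<zero> \<Longrightarrow> x \<otimes> c = \<zero>"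
    using c(1) by (auto simp: C_def)
  note ccl = ED(1)[OF cE]
  have left: "y = \<zero>" if y: "y \<in> carrier R" "y \<otimes> c = \<zero>" for y
  proof (rule ccontr)
    assume "y \<noteq> \<zero>"
    define L where "L = {x \<in> E. x \<otimes> c = \<zero>}"
    have L: "left_ideal L R"
      unfolding L_def using ED ccl by (intro left_ideal_by_closure) (auto simp: l_distr m_assoc)
    obtain r where r: "r \<in> carrier R" "r \<otimes> y \<in> E" "r \<otimes> y \<noteq> \<zero>"
      using left_essentialE[OF E y(1) \<open>y \<noteq> \<zero>\<close>] by blast
    then have "r \<otimes> y \<in> L" using y ccl by (simp add: L_def m_assoc)
    then obtain b where b: "b \<in> L" "b \<noteq> \<zero>"
      "\<And>x. x \<in> carrier R \<Longrightarrow> x \<otimes> (b \<otimes> b) = \<zero> \<Longrightarrow> x \<otimes> b = \<zero>"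
      using exists_same_square_ann[OF L _ r(3)] by blast
    have bE: "b \<in> E" "b \<otimes> c = \<zero>" using b(1) by (auto simp: L_def)
    note bcl = ED(1)[OF bE(1)]
    \<comment> \<open>Because \<open>b c = 0\<close>, multiplying \<open>x (c + b) = 0\<close> by
      \<open>c\<close> leaves \<open>x c^2 = 0\<close>, hence \<open>x c = 0\<close>. The
      annihilator of the sum is therefore the intersection of the two.\<close>
    have one: "x \<otimes> c = \<zero> \<and> x \<otimes> b = \<zero>" if x: "x \<in> carrier R" "x \<otimes> (c \<oplus> b) = \<zero>" for x
    proof -
      have "x \<otimes> (c \<otimes> c) = x \<otimes> (c \<oplus> b) \<otimes> c"
        using x(1) bcl ccl bE(2) by (simp add: m_assoc l_distr)
      then have "x \<otimes> c = \<zero>" using cc[OF x(1)] x(2) ccl by simp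
      then show ?thesis using x bcl ccl by (simp add: r_distr)
    qed
    have two: "x \<otimes> (c \<oplus> b) = \<zero>" if x: "x \<in> carrier R" "x \<otimes> ((c \<oplus> b) \<otimes> (c \<oplus> b)) = \<zero>" for x
    proof -
      have "(x \<otimes> (c \<oplus> b)) \<otimes> (c \<oplus> b) = \<zero>" using x bcl ccl by (simp add: m_assoc)
      then have *: "x \<otimes> (c \<oplus> b) \<otimes> c = \<zero>" "x \<otimes> (c \<oplus> b) \<otimes> b = \<zero>"
        using one[of "x \<otimes> (c \<oplus> b)"] x(1) bcl ccl by simp_all
      have "x \<otimes> (c \<otimes> c) = x \<otimes> (c \<oplus> b) \<otimes> c"
        using x(1) bcl ccl bE(2) by (simp add: m_assoc l_distr)
      then have xc: "x \<otimes> c = \<zero>" using cc[OF x(1)] * by simp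
      have "x \<otimes> (c \<oplus> b) \<otimes> b = x \<otimes> c \<otimes> b \<oplus> x \<otimes> (b \<otimes> b)"
        using x(1) bcl ccl by (simp add: m_assoc l_distr r_distr)
      then have "x \<otimes> (b \<otimes> b) = \<zero>" using * xc x(1) bcl by simp
      then show ?thesis using b(3)[OF x(1)] xc x(1) bcl ccl by (simp add: r_distr)
    qed
    have "c \<oplus> b \<in> C" using ED(3)[OF cE bE(1)] two by (simp add: C_def)
    moreover have "l_ann R {c \<oplus> b} \<subseteq> l_ann R {c}" using one by (auto simp: l_ann_def)
    ultimately have "l_ann R {c \<oplus> b} = l_ann R {c}" using c(2) by blast
    moreover have "b \<in> l_ann R {c}" using bcl bE(2) by (simp add: l_ann_def)
    ultimately have "b \<in> l_ann R {c \<oplus> b}" by simp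
    then have "b \<otimes> (c \<oplus> b) = \<zero>" by (simp add: l_ann_def)
    then have "b \<otimes> b = \<zero>" using one bcl by blast
    then have "\<one> \<otimes> (b \<otimes> b) = \<zero>" by simp
    then have "\<one> \<otimes> b = \<zero>" by (rule b(3)[OF one_closed])
    then show False using b(2) bcl by simp
  qed
  \<comment> \<open>Now \<open>Rc\<close> is essential and annihilates \<open>x\<close>, so the
    other side follows from nonsingularity.\<close>
  have right: "x = \<zero>" if x: "x \<in> carrier R" "c \<otimes> x = \<zero>" for x
  proof (rule left_nonsingular[OF principal_left_essential[OF ccl left] x(1)])
    fix y assume "y \<in> {r \<otimes> c | r. r \<in> carrier R}"
    then show "y \<otimes> x = \<zero>" using x ccl by (auto simp: m_assoc)
  qed
  have "c \<in> regular R" unfolding regular_def using left right ccl by blast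
  then show thesis using that cE by blast
qed

lemma regularD:
  assumes "c \<in> regular R"
  shows "c \<in> carrier R" "x \<in> carrier R \<Longrightarrow> c \<otimes> x = \<zero> \<Longrightarrow> x = \<zero>" "x \<in> carrier R \<Longrightarrow> x \<otimes> c = \<zero> \<Longrightarrow> x = \<zero>"
  using assms unfolding regular_def by blast+

lemma regularI:
  assumes "c \<in> carrier R" "\<And>x. x \<in> carrier R \<Longrightarrow> c \<otimes> x = \<zero> \<Longrightarrow> x = \<zero>"
    "\<And>x. x \<in> carrier R \<Longrightarrow> x \<otimes> c = \<zero> \<Longrightarrow> x = \<zero>"
  shows "c \<in> regular R"
  using assms unfolding regular_def by blast

text \<open>The set of \<open>t\<close> with \<open>t r \<in> Rs\<close> is the preimage of an
  essential left ideal, hence essential, hence contains a regular element.\<close>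

lemma regular_left_ore:
  assumes nz: "\<one> \<noteq> \<zero>" shows "left_ore_set R (regular R)"
  unfolding left_ore_set_def
proof (intro conjI ballI)
  show "mult_set R (regular R)"
    unfolding mult_set_def
  proof (intro conjI ballI)
    show "s \<otimes> t \<in> regular R" if s: "s \<in> regular R" and t: "t \<in> regular R" for s t
    proof (rule regularI)
      note c = regularD(1)[OF s] regularD(1)[OF t]
      then show "s \<otimes> t \<in> carrier R" by simp
      fix x assume x: "x \<in> carrier R"
      show "x = \<zero>" if "s \<otimes> t \<otimes> x = \<zero>"
        using that x c regularD(2)[OF s, of "t \<otimes> x"] regularD(2)[OF t x] by (simp add: m_assoc)
      show "x = \<zero>" if "x \<otimes> (s \<otimes> t) = \<zero>"
        using that x c regularD(3)[OF t, of "x \<otimes> s"] regularD(3)[OF s x] by (simp add: m_assoc)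
    qed
    show "\<zero> \<notin> regular R"
    proof
      assume "\<zero> \<in> regular R"
      from regularD(2)[OF this one_closed] show False using nz by simp
    qed
    show "\<one> \<in> regular R" by (rule regularI) simp_all
    show "regular R \<subseteq> carrier R" using regularD(1) by blast
  qed
  fix r s assume r: "r \<in> carrier R" and s: "s \<in> regular R"
  have "left_essential R {x \<otimes> s | x. x \<in> carrier R}"
    by (rule principal_left_essential) (use regularD[OF s] in blast)+
  from left_essential_preimage[OF this r] left_essential_regular
  obtain t where "t \<in> {x \<in> carrier R. x \<otimes> r \<in> {x \<otimes> s | x. x \<in> carrier R}}" "t \<in> regular R" by blast
  then show "\<exists>t\<in>regular R. \<exists>a\<in>carrier R. t \<otimes> r = a \<otimes> s" by blast
qed

end

section \<open>Minimal primes of a semiprime Goldie ring\<close>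

text \<open>An antichain above every member of \<open>F\<close> is exactly the set of maximal
  elements; all maximality claims are reduced to this.\<close>

lemma maxl_eqI:
  assumes "M \<subseteq> F" "\<And>S. S \<in> F \<Longrightarrow> \<exists>T\<in>M. S \<subseteq> T" "\<And>S T. S \<in> M \<Longrightarrow> T \<in> M \<Longrightarrow> S \<subseteq> T \<Longrightarrow> S = T"
  shows "maxl F = M"
proof
  show "maxl F \<subseteq> M"
  proof
    fix S assume "S \<in> maxl F"
    then have S: "S \<in> F" "\<And>T. T \<in> F \<Longrightarrow> S \<subseteq> T \<Longrightarrow> T = S" by (auto simp: maxl_def)
    obtain T where "T \<in> M" "S \<subseteq> T" using assms(2)[OF S(1)] by blast
    then show "S \<in> M" using S(2)[of T] assms(1) by blast
  qed
  show "M \<subseteq> maxl F"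
  proof
    fix S assume S: "S \<in> M"
    have "T = S" if T: "T \<in> F" "S \<subseteq> T" for T
    proof -
      obtain U where U: "U \<in> M" "T \<subseteq> U" using assms(2)[OF T(1)] by blast
      then have "S = U" using assms(3)[OF S U(1)] T(2) by blast
      then show ?thesis using T(2) U(2) by blast
    qed
    then show "S \<in> maxl F" using S assms(1) by (auto simp: maxl_def)
  qed
qed

lemma nc_primeD:
  assumes "nc_prime R P"
  shows "ideal P R" "P \<noteq> carrier R"
    "ideal I R \<Longrightarrow> ideal J R \<Longrightarrow> (\<And>i j. i \<in> I \<Longrightarrow> j \<in> J \<Longrightarrow> i \<otimes>\<^bsub>R\<^esub> j \<in> P) \<Longrightarrow> I \<subseteq> P \<or> J \<subseteq> P"
  using assms unfolding nc_prime_def by blast+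

lemma opp_nc_prime: "nc_prime R P \<Longrightarrow> nc_prime (opp R) P"
  unfolding nc_prime_def by simp blast

lemma opp_min_primes [simp]: "min_primes (opp R) = min_primes R"
proof -
  have "nc_prime (opp R) P \<longleftrightarrow> nc_prime R P" for P
    using opp_nc_prime[of R P] opp_nc_prime[of "opp R" P] by auto
  then show ?thesis by (simp add: min_primes_def)
qed

context ring
begin

lemma Cp_iff:
  assumes "ideal P R"
  shows "c \<in> Cp R P \<longleftrightarrow> c \<in> carrier R \<and> (\<forall>x\<in>carrier R. (c \<otimes> x \<in> P \<longrightarrow> x \<in> P) \<and> (x \<otimes> c \<in> P \<longrightarrow> x \<in> P))"
proof -
  interpret P: ideal P R by fact
  have zero: "P +> y = P \<longleftrightarrow> y \<in> P" if "y \<in> carrier R" for y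
    using P.a_rcos_const P.a_rcos_self[OF that] by blast
  have carrier: "carrier (R Quot P) = (\<lambda>x. P +> x) ` carrier R"
    by (auto simp: FactRing_def A_RCOSETS_def')
  have mult: "(P +> a) \<otimes>\<^bsub>R Quot P\<^esub> (P +> b) = P +> (a \<otimes> b)" if "a \<in> carrier R" "b \<in> carrier R" for a b
    using P.rcoset_mult_add[OF that] by (simp add: FactRing_def)
  have zeroQ: "\<zero>\<^bsub>R Quot P\<^esub> = P" by (simp add: FactRing_def)
  show ?thesis
  proof (cases "c \<in> carrier R")
    case True
    then have "c \<in> Cp R P \<longleftrightarrow> (\<forall>y\<in>(\<lambda>x. P +> x) ` carrier R.
        ((P +> c) \<otimes>\<^bsub>R Quot P\<^esub> y = P \<longrightarrow> y = P) \<and> (y \<otimes>\<^bsub>R Quot P\<^esub> (P +> c) = P \<longrightarrow> y = P))"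
      unfolding Cp_def regular_def zeroQ carrier by blast
    also have "\<dots> \<longleftrightarrow> (\<forall>x\<in>carrier R.
        ((P +> c) \<otimes>\<^bsub>R Quot P\<^esub> (P +> x) = P \<longrightarrow> P +> x = P) \<and> ((P +> x) \<otimes>\<^bsub>R Quot P\<^esub> (P +> c) = P \<longrightarrow> P +> x = P))"
      by (rule ball_simps)
    also have "\<dots> \<longleftrightarrow> (\<forall>x\<in>carrier R. (c \<otimes> x \<in> P \<longrightarrow> x \<in> P) \<and> (x \<otimes> c \<in> P \<longrightarrow> x \<in> P))"
    proof (rule ball_cong[OF refl])
      fix x assume x: "x \<in> carrier R"
      show "((P +> c) \<otimes>\<^bsub>R Quot P\<^esub> (P +> x) = P \<longrightarrow> P +> x = P) \<and> ((P +> x) \<otimes>\<^bsub>R Quot P\<^esub> (P +> c) = P \<longrightarrow> P +> x = P)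
        \<longleftrightarrow> (c \<otimes> x \<in> P \<longrightarrow> x \<in> P) \<and> (x \<otimes> c \<in> P \<longrightarrow> x \<in> P)"
        by (simp only: mult[OF True x] mult[OF x True] zero[OF x] zero[OF m_closed[OF True x]] zero[OF m_closed[OF x True]])
    qed
    finally show ?thesis using True by simp
  qed (simp add: Cp_def)
qed

lemma CpD:
  assumes "ideal P R" "c \<in> Cp R P"
  shows "c \<in> carrier R" "x \<in> carrier R \<Longrightarrow> c \<otimes> x \<in> P \<Longrightarrow> x \<in> P" "x \<in> carrier R \<Longrightarrow> x \<otimes> c \<in> P \<Longrightarrow> x \<in> P"
  using assms(2) unfolding Cp_iff[OF assms(1)] by blast+

lemma CpI:
  assumes "ideal P R" "c \<in> carrier R" "\<And>x. x \<in> carrier R \<Longrightarrow> c \<otimes> x \<in> P \<Longrightarrow> x \<in> P"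
    "\<And>x. x \<in> carrier R \<Longrightarrow> x \<otimes> c \<in> P \<Longrightarrow> x \<in> P"
  shows "c \<in> Cp R P"
  unfolding Cp_iff[OF assms(1)] using assms(2-) by blast

lemma opp_Cp:
  assumes P: "ideal P R" shows "Cp (opp R) P = Cp R P"
proof (rule Set.set_eqI)
  have P': "ideal P (opp R)" using P by simp
  show "c \<in> Cp (opp R) P \<longleftrightarrow> c \<in> Cp R P" for c
    unfolding Cp_iff[OF P] ring.Cp_iff[OF opp_ring[OF ring_axioms] P'] opp_simps by blast
qed

lemma Cp_mult_set:
  assumes P: "ideal P R" "P \<noteq> carrier R" shows "mult_set R (Cp R P)"
  unfolding mult_set_def
proof (intro conjI ballI)
  show "Cp R P \<subseteq> carrier R" using CpD(1)[OF P(1)] by blast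
  show "\<one> \<in> Cp R P" by (rule CpI[OF P(1)]) simp_all
  show "\<zero> \<notin> Cp R P"
  proof
    assume "\<zero> \<in> Cp R P"
    from CpD(2)[OF P(1) this one_closed] have "\<one> \<in> P" using idealD(2)[OF P(1)] by simp
    then show False using left_ideal_proper[OF ideal_imp_left_ideal[OF P(1)]] P(2) by blast
  qed
  fix s t assume st: "s \<in> Cp R P" "t \<in> Cp R P"
  note c = CpD(1)[OF P(1) st(1)] CpD(1)[OF P(1) st(2)]
  show "s \<otimes> t \<in> Cp R P"
  proof (rule CpI[OF P(1)])
    fix x assume x: "x \<in> carrier R"
    show "x \<in> P" if "s \<otimes> t \<otimes> x \<in> P"
      using that x c CpD(2)[OF P(1) st(1), of "t \<otimes> x"] CpD(2)[OF P(1) st(2) x] by (simp add: m_assoc)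
    show "x \<in> P" if "x \<otimes> (s \<otimes> t) \<in> P"
      using that x c CpD(3)[OF P(1) st(2), of "x \<otimes> s"] CpD(3)[OF P(1) st(1) x] by (simp add: m_assoc)
  qed (use c in simp)
qed

end

section \<open>Annihilator ideals and minimal primes\<close>

context semiprime_goldie
begin

text \<open>For \<open>x\<close> with \<open>x I = 0\<close>, the product
  \<open>(i x) y (i x)\<close> contains the factor \<open>x (y i)\<close>, which is zero, so
  \<open>i x\<close> is zero by semiprimeness.\<close>

lemma l_ann_subset_r_ann:
  assumes I: "ideal I R" shows "l_ann R I \<subseteq> r_ann R I"
proof
  note ID = idealD[OF I]
  fix x assume "x \<in> l_ann R I"
  then have x: "x \<in> carrier R" "\<And>y. y \<in> I \<Longrightarrow> x \<otimes> y = \<zero>" by (auto simp: l_ann_def)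
  have "i \<otimes> x = \<zero>" if i: "i \<in> I" for i
  proof (rule semiprime_elem)
    show "i \<otimes> x \<in> carrier R" using ID(1)[OF i] x(1) by simp
    fix y assume y: "y \<in> carrier R"
    have "i \<otimes> x \<otimes> y \<otimes> (i \<otimes> x) = i \<otimes> (x \<otimes> (y \<otimes> i)) \<otimes> x"
      using ID(1)[OF i] x(1) y by (simp add: m_assoc)
    then show "i \<otimes> x \<otimes> y \<otimes> (i \<otimes> x) = \<zero>" using x(2)[OF ID(4)[OF y i]] ID(1)[OF i] x(1) by simp
  qed
  then show "x \<in> r_ann R I" using x(1) by (simp add: r_ann_def)
qed

lemma l_ann_eq_r_ann: "ideal I R \<Longrightarrow> l_ann R I = r_ann R I"
  using l_ann_subset_r_ann[of I] semiprime_goldie.l_ann_subset_r_ann[OF opp_semiprime_goldie, of I] by auto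

abbreviation ann :: "'a set \<Rightarrow> 'a set" where "ann I \<equiv> l_ann R I"

lemma ann_ideal: "ideal I R \<Longrightarrow> ideal (ann I) R"
  by (rule l_ann_ideal[OF ideal_imp_left_ideal])

lemma annD:
  assumes "ideal I R" "b \<in> ann I"
  shows "b \<in> carrier R" "x \<in> I \<Longrightarrow> b \<otimes> x = \<zero>" "x \<in> I \<Longrightarrow> x \<otimes> b = \<zero>"
proof -
  show "b \<in> carrier R" "x \<in> I \<Longrightarrow> b \<otimes> x = \<zero>" using assms(2) by (auto simp: l_ann_def)
  have "b \<in> r_ann R I" using assms l_ann_eq_r_ann by blast
  then show "x \<in> I \<Longrightarrow> x \<otimes> b = \<zero>" by (auto simp: r_ann_def)
qed

lemma annI: "b \<in> carrier R \<Longrightarrow> (\<And>x. x \<in> I \<Longrightarrow> b \<otimes> x = \<zero>) \<Longrightarrow> b \<in> ann I"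
  by (simp add: l_ann_def)

lemma annI': "ideal I R \<Longrightarrow> b \<in> carrier R \<Longrightarrow> (\<And>x. x \<in> I \<Longrightarrow> x \<otimes> b = \<zero>) \<Longrightarrow> b \<in> ann I"
  by (simp add: l_ann_eq_r_ann r_ann_def)

lemma ann_disjoint:
  assumes I: "ideal I R" and x: "x \<in> I" "x \<in> ann I" shows "x = \<zero>"
proof (rule semiprime_elem)
  show xc: "x \<in> carrier R" using idealD(1)[OF I x(1)] .
  fix y assume y: "y \<in> carrier R"
  then show "x \<otimes> y \<otimes> x = \<zero>" using annD(2)[OF I x(2) idealD(4)[OF I y x(1)]] xc by (simp add: m_assoc)
qed

lemma ann_antimono: "I \<subseteq> J \<Longrightarrow> ann J \<subseteq> ann I"
  by (auto simp: l_ann_def)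

lemma ann_ann_superset:
  assumes I: "ideal I R" shows "I \<subseteq> ann (ann I)"
proof
  fix x assume x: "x \<in> I"
  show "x \<in> ann (ann I)"
    by (rule annI) (use idealD(1)[OF I x] annD(3)[OF I _ x] in auto)
qed

lemma ann_ann_ann: "ideal I R \<Longrightarrow> ann (ann (ann I)) = ann I"
  using ann_antimono[OF ann_ann_superset] ann_ann_superset[OF ann_ideal] by blast

text \<open>\<open>I + ann I\<close> is essential: an element not annihilated by \<open>I\<close> is
  moved into \<open>I\<close> by some element of \<open>I\<close>, and any other element lies in
  \<open>ann I\<close>.\<close>

lemma sum_ann_regular:
  assumes I: "ideal I R"
  obtains x b where "x \<in> I" "b \<in> ann I" "x \<oplus> b \<in> regular R"
proof -
  note B = ann_ideal[OF I]
  note ID = idealD[OF I] and BD = idealD[OF B]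
  define E where "E = {x \<oplus> b | x b. x \<in> I \<and> b \<in> ann I}"
  have memI: "x \<oplus> b \<in> E" if "x \<in> I" "b \<in> ann I" for x b using that unfolding E_def by blast
  have memD: "\<exists>x b. x \<in> I \<and> b \<in> ann I \<and> z = x \<oplus> b" if "z \<in> E" for z using that unfolding E_def by blast
  have "left_ideal E R"
    unfolding E_def by (rule left_ideal_sum[OF ideal_imp_left_ideal[OF I] ideal_imp_left_ideal[OF B]])
  moreover have "\<exists>r\<in>carrier R. r \<otimes> a \<in> E \<and> r \<otimes> a \<noteq> \<zero>" if a: "a \<in> carrier R" "a \<noteq> \<zero>" for a
  proof (cases "\<exists>x\<in>I. x \<otimes> a \<noteq> \<zero>")
    case True
    then obtain x where x: "x \<in> I" "x \<otimes> a \<noteq> \<zero>" by blast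
    then have "x \<otimes> a \<in> E" using memI[OF ID(5)[OF a(1) x(1)] BD(2)] ID(1) a(1) by simp
    then show ?thesis using x ID(1) by blast
  next
    case False
    then have "a \<in> ann I" using annI'[OF I a(1)] by blast
    then have "\<one> \<otimes> a \<in> E" using memI[OF ID(2), of a] a(1) by simp
    then show ?thesis using a by (intro bexI[of _ \<one>]) simp_all
  qed
  ultimately have "left_essential R E" unfolding left_essential_def by blast
  from left_essential_regular[OF this] obtain c where "c \<in> E" "c \<in> regular R" by blast
  then show thesis using memD that by blast
qed

text \<open>If \<open>y\<close> kills \<open>ann I\<close>, multiplying it by the regular element
  \<open>x + b\<close> leaves only \<open>y x\<close>, which is in \<open>I\<close>; then the
  regular factor cancels modulo \<open>I\<close>.\<close>

lemma ann_ann_eqI: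
  assumes I: "ideal I R" and c: "\<And>r c. r \<in> carrier R \<Longrightarrow> c \<in> regular R \<Longrightarrow> r \<otimes> c \<in> I \<Longrightarrow> r \<in> I"
  shows "ann (ann I) = I"
proof
  obtain x b where xb: "x \<in> I" "b \<in> ann I" "x \<oplus> b \<in> regular R" using sum_ann_regular[OF I] by blast
  note cl = idealD(1)[OF I xb(1)] annD(1)[OF I xb(2)]
  show "ann (ann I) \<subseteq> I"
  proof
    fix y assume y: "y \<in> ann (ann I)"
    note yc = annD(1)[OF ann_ideal[OF I] y]
    have "y \<otimes> (x \<oplus> b) = y \<otimes> x"
      using annD(2)[OF ann_ideal[OF I] y xb(2)] yc cl by (simp add: r_distr)
    then have "y \<otimes> (x \<oplus> b) \<in> I" using idealD(4)[OF I yc xb(1)] by simp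
    then show "y \<in> I" using c[OF yc xb(3)] by blast
  qed
qed (rule ann_ann_superset[OF I])

definition ann_ideals :: "'a set set" where
  "ann_ideals = {I. ideal I R \<and> ann (ann I) = I \<and> I \<noteq> carrier R}"

lemma ann_idealsD:
  assumes "I \<in> ann_ideals" shows "ideal I R" "ann (ann I) = I" "I \<noteq> carrier R"
  using assms by (auto simp: ann_ideals_def)

lemma max_ann_ideal_above:
  assumes "I \<in> ann_ideals" obtains P where "P \<in> maxl ann_ideals" "I \<subseteq> P"
proof -
  have "ann_ideals \<subseteq> {l_ann R Y | Y. Y \<subseteq> carrier R}"
  proof
    fix J assume "J \<in> ann_ideals"
    note J = ann_idealsD[OF this]
    have "ann J \<subseteq> carrier R" by (auto simp: l_ann_def)
    then show "J \<in> {l_ann R Y | Y. Y \<subseteq> carrier R}" using J(2) by blast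
  qed
  then have sub: "{J \<in> ann_ideals. I \<subseteq> J} \<subseteq> {l_ann R Y | Y. Y \<subseteq> carrier R}" by blast
  have "I \<in> {J \<in> ann_ideals. I \<subseteq> J}" using assms by simp
  from acc_on_maximal[OF acc_l_ann sub this] obtain P where P: "P \<in> {J \<in> ann_ideals. I \<subseteq> J}"
    "\<And>B. B \<in> {J \<in> ann_ideals. I \<subseteq> J} \<Longrightarrow> P \<subseteq> B \<Longrightarrow> B = P" by blast
  then have "P \<in> maxl ann_ideals" unfolding maxl_def by blast
  then show thesis using that P(1) by blast
qed

lemma max_annD:
  assumes "P \<in> maxl ann_ideals"
  shows "ideal P R" "ann (ann P) = P" "P \<noteq> carrier R" "Q \<in> ann_ideals \<Longrightarrow> P \<subseteq> Q \<Longrightarrow> Q = P"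
  using assms unfolding maxl_def ann_ideals_def by blast+

lemma ann_neq_carrier:
  assumes I: "ideal I R" "x \<in> I" "x \<noteq> \<zero>" shows "ann I \<noteq> carrier R"
proof
  assume "ann I = carrier R"
  then have "\<one> \<otimes> x = \<zero>" using annD(2)[OF I(1) _ I(2), of \<one>] by simp
  then show False using I idealD(1)[OF I(1,2)] by simp
qed

text \<open>If \<open>IJ \<subseteq> P\<close>, then \<open>ann (J \<inter> ann P)\<close> is an
  annihilator ideal containing both \<open>I\<close> and \<open>P\<close>. It is proper unless
  \<open>J \<inter> ann P = 0\<close>, in which case \<open>J\<close> kills \<open>ann P\<close> and
  lies in \<open>P\<close>; if proper, it equals \<open>P\<close> by maximality.\<close>

lemma max_ann_prime:
  assumes P: "P \<in> maxl ann_ideals" shows "nc_prime R P"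
proof -
  note PD = max_annD[OF P]
  note B = ann_ideal[OF PD(1)]
  have "I \<subseteq> P \<or> J \<subseteq> P" if IJ: "ideal I R" "ideal J R" "\<forall>i\<in>I. \<forall>j\<in>J. i \<otimes> j \<in> P" for I J
  proof (rule disjCI)
    assume nJ: "\<not> J \<subseteq> P"
    note K = i_intersect[OF IJ(2) B]
    have "I \<subseteq> ann (J \<inter> ann P)"
    proof
      fix i assume i: "i \<in> I"
      show "i \<in> ann (J \<inter> ann P)"
      proof (rule annI[OF idealD(1)[OF IJ(1) i]])
        fix z assume z: "z \<in> J \<inter> ann P"
        have "i \<otimes> z \<in> ann P" using idealD(4)[OF B idealD(1)[OF IJ(1) i]] z by blast
        moreover have "i \<otimes> z \<in> P" using IJ(3) i z by blast
        ultimately show "i \<otimes> z = \<zero>" using ann_disjoint[OF PD(1)] by blast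
      qed
    qed
    moreover have "P \<subseteq> ann (J \<inter> ann P)" using ann_antimono[of "J \<inter> ann P" "ann P"] PD(2) by blast
    moreover have "ann (J \<inter> ann P) \<noteq> carrier R"
    proof
      assume eq: "ann (J \<inter> ann P) = carrier R"
      have z: "z = \<zero>" if "z \<in> J \<inter> ann P" for z
        using ann_neq_carrier[OF K that] eq by blast
      have "J \<subseteq> ann (ann P)"
      proof
        fix j assume j: "j \<in> J"
        show "j \<in> ann (ann P)"
        proof (rule annI[OF idealD(1)[OF IJ(2) j]])
          fix b assume b: "b \<in> ann P"
          show "j \<otimes> b = \<zero>"
            using z idealD(5)[OF IJ(2) idealD(1)[OF B b] j] idealD(4)[OF B idealD(1)[OF IJ(2) j] b] by blast
        qed
      qed
      then show False using nJ PD(2) by blast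
    qed
    ultimately show "I \<subseteq> P"
      using PD(4)[of "ann (J \<inter> ann P)"] ann_ideal[OF K] ann_ann_ann[OF K] unfolding ann_ideals_def by blast
  qed
  then show ?thesis using PD unfolding nc_prime_def by blast
qed

text \<open>The product of \<open>P\<close> and \<open>ann P\<close> is zero, so a prime
  \<open>Q\<close> contains one of them. \<open>ann P\<close> inside \<open>P\<close> would have to
  vanish and make \<open>P\<close> the whole ring.\<close>

lemma prime_below_max_ann:
  assumes P: "P \<in> maxl ann_ideals" and Q: "nc_prime R Q" "Q \<subseteq> P"
  shows "Q = P"
proof -
  note PD = max_annD[OF P] and QD = nc_primeD[OF Q(1)]
  have "P \<subseteq> Q \<or> ann P \<subseteq> Q"
    by (rule QD(3)[OF PD(1) ann_ideal[OF PD(1)]])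
      (use annD(3)[OF PD(1)] idealD(2)[OF QD(1)] in simp)
  moreover have False if "ann P \<subseteq> Q"
  proof -
    have "ann P = {\<zero>}"
      using ann_disjoint[OF PD(1)] that Q(2) idealD(2)[OF ann_ideal[OF PD(1)]] by blast
    then have "ann (ann P) = carrier R" by (auto simp: l_ann_def)
    then show False using PD(2,3) by simp
  qed
  ultimately show ?thesis using Q(2) by blast
qed

text \<open>Intersecting with the carrier gives the empty family the whole ring as its intersection,
  the starting point of the inductions.\<close>

lemma finite_Inter_ideal:
  assumes "T \<subseteq> maxl ann_ideals" shows "ideal (carrier R \<inter> \<Inter>T) R"
proof (rule ideal_by_closure)
  have T: "ideal P R" if "P \<in> T" for P using assms max_annD(1) that by blast
  show "\<zero> \<in> carrier R \<inter> \<Inter>T" using idealD(2)[OF T] by simp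
  show "x \<oplus> y \<in> carrier R \<inter> \<Inter>T" if "x \<in> carrier R \<inter> \<Inter>T" "y \<in> carrier R \<inter> \<Inter>T" for x y
    using that idealD(3)[OF T] by simp
  show "r \<otimes> x \<in> carrier R \<inter> \<Inter>T" "x \<otimes> r \<in> carrier R \<inter> \<Inter>T" if "r \<in> carrier R" "x \<in> carrier R \<inter> \<Inter>T" for r x
    using that idealD(4,5)[OF T] by simp_all
qed simp

text \<open>Choose a finite \<open>T\<close> for which the annihilator of the intersection is
  maximal. Adding a further \<open>P\<close> cannot enlarge it, so the intersection lies below every
  maximal annihilator ideal.\<close>

lemma max_ann_finite_Inter:
  obtains T where "finite T" "T \<subseteq> maxl ann_ideals" "carrier R \<inter> \<Inter>T = {\<zero>}"
proof -
  define D where "D T = carrier R \<inter> \<Inter>T" for T :: "'a set set"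
  define Ts where "Ts = {T. finite T \<and> T \<subseteq> maxl ann_ideals}"
  have Did: "ideal (D T) R" if "T \<in> Ts" for T
    unfolding D_def using finite_Inter_ideal that unfolding Ts_def by blast
  have sub: "(\<lambda>T. ann (D T)) ` Ts \<subseteq> {l_ann R Y | Y. Y \<subseteq> carrier R}" unfolding D_def by blast
  have mem: "ann (D {}) \<in> (\<lambda>T. ann (D T)) ` Ts" unfolding Ts_def by blast
  from acc_on_maximal[OF acc_l_ann sub mem]
  obtain M where M: "M \<in> (\<lambda>T. ann (D T)) ` Ts" "\<And>B. B \<in> (\<lambda>T. ann (D T)) ` Ts \<Longrightarrow> M \<subseteq> B \<Longrightarrow> B = M" by blast
  obtain T where T: "T \<in> Ts" "M = ann (D T)" using M(1) by blast
  note DT = Did[OF T(1)]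
  have sub: "D T \<subseteq> P" if P: "P \<in> maxl ann_ideals" for P
  proof -
    have i: "insert P T \<in> Ts" using T(1) P by (simp add: Ts_def)
    have "ann (D T) \<subseteq> ann (D (insert P T))" by (rule ann_antimono) (auto simp: D_def)
    then have eq: "ann (D (insert P T)) = ann (D T)" using M(2) T(2) i by blast
    have "D T \<subseteq> ann (ann (D T))" by (rule ann_ann_superset[OF DT])
    also have "\<dots> = ann (ann (D (insert P T)))" using eq by simp
    also have "\<dots> \<subseteq> ann (ann P)" by (intro ann_antimono) (auto simp: D_def)
    also have "\<dots> = P" by (rule max_annD(2)[OF P])
    finally show ?thesis .
  qed
  have "x = \<zero>" if x: "x \<in> D T" for x
  proof (rule ccontr)
    assume "x \<noteq> \<zero>"
    then have "ann (D T) \<in> ann_ideals"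
      using ann_ideal[OF DT] ann_ann_ann[OF DT] ann_neq_carrier[OF DT x] by (simp add: ann_ideals_def)
    then obtain P where P: "P \<in> maxl ann_ideals" "ann (D T) \<subseteq> P" using max_ann_ideal_above by blast
    \<comment> \<open>A nonzero intersection would put its annihilator under some \<open>P\<close>;
      as the intersection lies in \<open>P\<close>, also \<open>ann P\<close> lies in that
      annihilator, hence in \<open>P\<close>, which is impossible for a proper
      \<open>P\<close>.\<close>
    have "ann P \<subseteq> P" using ann_antimono[OF sub[OF P(1)]] P(2) by blast
    then have "ann P = {\<zero>}"
      using ann_disjoint[OF max_annD(1)[OF P(1)]] idealD(2)[OF ann_ideal[OF max_annD(1)[OF P(1)]]] by blast
    then have "ann (ann P) = carrier R" by (auto simp: l_ann_def)
    then show False using max_annD(2,3)[OF P(1)] by simp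
  qed
  then have "carrier R \<inter> \<Inter>T = {\<zero>}" using idealD(2)[OF DT] unfolding D_def by blast
  then show thesis using that T(1) unfolding Ts_def by blast
qed

lemma prime_contains_max_ann:
  assumes Q: "nc_prime R Q" and T: "finite T" "T \<subseteq> maxl ann_ideals" "carrier R \<inter> \<Inter>T \<subseteq> Q"
  shows "\<exists>P\<in>T. P \<subseteq> Q"
  using T
proof (induction T)
  case empty
  have "Q \<subseteq> carrier R" using idealD(1)[OF nc_primeD(1)[OF Q]] by blast
  then have "Q = carrier R" using empty.prems(2) by simp
  then show ?case using nc_primeD(2)[OF Q] by simp
next
  case (insert P T)
  have T: "P \<in> maxl ann_ideals" "T \<subseteq> maxl ann_ideals" using insert.prems(1) by simp_all
  note P = max_annD(1)[OF T(1)] and D = finite_Inter_ideal[OF T(2)]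
  have "P \<subseteq> Q \<or> carrier R \<inter> \<Inter>T \<subseteq> Q"
  proof (rule nc_primeD(3)[OF Q P D])
    fix i j assume i: "i \<in> P" and j: "j \<in> carrier R \<inter> \<Inter>T"
    have "i \<otimes> j \<in> P" using idealD(5)[OF P _ i] j by blast
    moreover have "i \<otimes> j \<in> carrier R \<inter> \<Inter>T" using idealD(4)[OF D idealD(1)[OF P i] j] .
    ultimately show "i \<otimes> j \<in> Q" using insert.prems(2) by blast
  qed
  then show ?case using insert.IH[OF T(2)] by blast
qed

text \<open>Finitely many maximal annihilator ideals intersect in zero, so every prime contains one
  of them; they are prime and have no smaller prime below them.\<close>

lemma min_primes_eq: "min_primes R = maxl ann_ideals"
proof
  obtain T where T: "finite T" "T \<subseteq> maxl ann_ideals" "carrier R \<inter> \<Inter>T = {\<zero>}" using max_ann_finite_Inter by blast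
  show "min_primes R \<subseteq> maxl ann_ideals"
  proof
    fix Q assume "Q \<in> min_primes R"
    then have Q: "nc_prime R Q" "\<And>P. nc_prime R P \<Longrightarrow> P \<subseteq> Q \<Longrightarrow> P = Q"
      unfolding min_primes_def minl_def by blast+
    have "carrier R \<inter> \<Inter>T \<subseteq> Q" using T(3) idealD(2)[OF nc_primeD(1)[OF Q(1)]] by simp
    then obtain P where "P \<in> T" "P \<subseteq> Q" using prime_contains_max_ann[OF Q(1) T(1,2)] by blast
    then show "Q \<in> maxl ann_ideals" using Q(2)[of P] max_ann_prime[of P] T(2) by blast
  qed
  show "maxl ann_ideals \<subseteq> min_primes R"
    using max_ann_prime prime_below_max_ann unfolding min_primes_def minl_def by blast
qed

lemma min_primes_finite: "finite (min_primes R)"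
  and min_primes_Inter: "carrier R \<inter> \<Inter>(min_primes R) = {\<zero>}"
proof -
  obtain T where T: "finite T" "T \<subseteq> maxl ann_ideals" "carrier R \<inter> \<Inter>T = {\<zero>}" using max_ann_finite_Inter by blast
  have "Q \<in> T" if Q: "Q \<in> maxl ann_ideals" for Q
  proof -
    have "carrier R \<inter> \<Inter>T \<subseteq> Q" using T(3) idealD(2)[OF max_annD(1)[OF Q]] by simp
    then obtain P where "P \<in> T" "P \<subseteq> Q" using prime_contains_max_ann[OF max_ann_prime[OF Q] T(1,2)] by blast
    then show ?thesis using prime_below_max_ann[OF Q max_ann_prime] T(2) by blast
  qed
  then have "T = min_primes R" using T(2) min_primes_eq by blast
  then show "finite (min_primes R)" "carrier R \<inter> \<Inter>(min_primes R) = {\<zero>}" using T by blast+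
qed

lemma min_primeD:
  assumes "P \<in> min_primes R"
  shows "nc_prime R P" "ideal P R" "P \<noteq> carrier R" "ann (ann P) = P"
    "Q \<in> min_primes R \<Longrightarrow> Q \<subseteq> P \<Longrightarrow> Q = P"
proof -
  have P: "P \<in> maxl ann_ideals" using assms min_primes_eq by simp
  show "nc_prime R P" "ideal P R" "P \<noteq> carrier R" "ann (ann P) = P"
    by (fact max_ann_prime[OF P] max_annD(1,2,3)[OF P])+
  show "Q = P" if "Q \<in> min_primes R" "Q \<subseteq> P"
    using prime_below_max_ann[OF P max_ann_prime] that unfolding min_primes_eq by blast
qed

text \<open>Since \<open>P = ann (ann P)\<close>, membership can be tested by multiplying with
  elements of \<open>ann P\<close>. This replaces computations modulo \<open>P\<close> by equations
  in \<open>R\<close>, where regular elements cancel.\<close>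

lemma min_prime_memI:
  assumes "P \<in> min_primes R" "x \<in> carrier R" "\<And>b. b \<in> ann P \<Longrightarrow> x \<otimes> b = \<zero>"
  shows "x \<in> P"
  using annI[of x "ann P"] assms(2,3) min_primeD(4)[OF assms(1)] by blast

lemma min_prime_memI':
  assumes "P \<in> min_primes R" "x \<in> carrier R" "\<And>b. b \<in> ann P \<Longrightarrow> b \<otimes> x = \<zero>"
  shows "x \<in> P"
  using annI'[OF ann_ideal[OF min_primeD(2)[OF assms(1)]] assms(2,3)] min_primeD(4)[OF assms(1)] by blast

lemma ann_subset_other:
  assumes P: "P \<in> min_primes R" and Q: "Q \<in> min_primes R" "P \<noteq> Q"
  shows "ann P \<subseteq> Q"
proof -
  note PD = min_primeD[OF P] and QD = min_primeD[OF Q(1)]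
  have "P \<subseteq> Q \<or> ann P \<subseteq> Q"
    by (rule nc_primeD(3)[OF QD(1) PD(2) ann_ideal[OF PD(2)]])
      (use annD(3)[OF PD(2)] idealD(2)[OF QD(2)] in simp)
  then show ?thesis using QD(5)[OF P] Q(2) by blast
qed

lemma regular_subset_Cp:
  assumes P: "P \<in> min_primes R" shows "regular R \<subseteq> Cp R P"
proof
  note PD = min_primeD[OF P]
  note B = ann_ideal[OF PD(2)]
  fix c assume c: "c \<in> regular R"
  note cc = regularD(1)[OF c]
  show "c \<in> Cp R P"
  proof (rule CpI[OF PD(2) cc])
    fix x assume x: "x \<in> carrier R"
    show "x \<in> P" if cx: "c \<otimes> x \<in> P"
    proof (rule min_prime_memI[OF P x])
      fix b assume b: "b \<in> ann P"
      have "c \<otimes> (x \<otimes> b) = \<zero>" using annD(3)[OF PD(2) b cx] cc x annD(1)[OF PD(2) b] by (simp add: m_assoc)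
      then show "x \<otimes> b = \<zero>" using regularD(2)[OF c] x annD(1)[OF PD(2) b] by simp
    qed
    show "x \<in> P" if xc: "x \<otimes> c \<in> P"
    proof (rule min_prime_memI'[OF P x])
      fix b assume b: "b \<in> ann P"
      have "(b \<otimes> x) \<otimes> c = \<zero>" using annD(2)[OF PD(2) b xc] cc x annD(1)[OF PD(2) b] by (simp add: m_assoc)
      then show "b \<otimes> x = \<zero>" using regularD(3)[OF c] x annD(1)[OF PD(2) b] by simp
    qed
  qed
qed

text \<open>That \<open>b\<close> is regular modulo \<open>P\<close>: if \<open>b z\<close> is in
  \<open>P\<close> it lies in \<open>P \<inter> ann P\<close>, so it is zero; \<open>x\<close> kills
  \<open>ann P\<close>, so the regular sum kills \<open>z w\<close> for every \<open>w\<close> in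
  \<open>ann P\<close>.\<close>

lemma min_prime_regular_decomp:
  assumes P: "P \<in> min_primes R"
  obtains b x where "b \<in> ann P" "b \<in> Cp R P" "x \<in> P" "b \<oplus> x \<in> regular R"
proof -
  note PD = min_primeD[OF P]
  note B = ann_ideal[OF PD(2)]
  obtain x b where xb: "x \<in> P" "b \<in> ann P" "x \<oplus> b \<in> regular R" using sum_ann_regular[OF PD(2)] by blast
  note xc = idealD(1)[OF PD(2) xb(1)] and bc = annD(1)[OF PD(2) xb(2)]
  have "b \<in> Cp R P"
  proof (rule CpI[OF PD(2) bc])
    fix z assume z: "z \<in> carrier R"
    show "z \<in> P" if bz: "b \<otimes> z \<in> P"
    proof (rule min_prime_memI[OF P z])
      fix w assume w: "w \<in> ann P"
      note wc = annD(1)[OF PD(2) w]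
      have bz0: "b \<otimes> z = \<zero>" using ann_disjoint[OF PD(2) bz idealD(5)[OF B z xb(2)]] .
      have xzw: "x \<otimes> (z \<otimes> w) = \<zero>" using annD(3)[OF PD(2) idealD(4)[OF B z w] xb(1)] .
      have "(x \<oplus> b) \<otimes> (z \<otimes> w) = x \<otimes> (z \<otimes> w) \<oplus> b \<otimes> z \<otimes> w"
        using xc bc z wc by (simp add: l_distr m_assoc)
      then have "(x \<oplus> b) \<otimes> (z \<otimes> w) = \<zero>" unfolding bz0 xzw using wc by simp
      then show "z \<otimes> w = \<zero>" using regularD(2)[OF xb(3)] z wc by simp
    qed
    show "z \<in> P" if zb: "z \<otimes> b \<in> P"
    proof (rule min_prime_memI'[OF P z])
      fix w assume w: "w \<in> ann P"
      note wc = annD(1)[OF PD(2) w]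
      have zb0: "z \<otimes> b = \<zero>" using ann_disjoint[OF PD(2) zb idealD(4)[OF B z xb(2)]] .
      have wzx: "w \<otimes> z \<otimes> x = \<zero>" using annD(2)[OF PD(2) idealD(5)[OF B z w] xb(1)] .
      have "(w \<otimes> z) \<otimes> (x \<oplus> b) = w \<otimes> z \<otimes> x \<oplus> w \<otimes> (z \<otimes> b)"
        using xc bc z wc by (simp add: r_distr m_assoc)
      then have "(w \<otimes> z) \<otimes> (x \<oplus> b) = \<zero>" unfolding zb0 wzx using wc by simp
      then show "w \<otimes> z = \<zero>" using regularD(3)[OF xb(3)] z wc by simp
    qed
  qed
  moreover have "b \<oplus> x \<in> regular R" using xb(3) a_comm[OF xc bc] by simp
  ultimately show thesis using that xb by blast
qed

text \<open>An element regular modulo \<open>P\<close> need not be regular in \<open>R\<close>.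
  Multiplying it by \<open>b\<close> moves it into \<open>ann P\<close>, and \<open>x\<close>
  supplies the missing component in \<open>P\<close>.\<close>

lemma Cp_lift_regular:
  assumes P: "P \<in> min_primes R" and s: "s \<in> Cp R P"
  obtains b x where "b \<in> ann P" "b \<in> Cp R P" "x \<in> P" "b \<otimes> s \<oplus> x \<in> regular R"
proof -
  note PD = min_primeD[OF P]
  note B = ann_ideal[OF PD(2)]
  obtain b x where b: "b \<in> ann P" "b \<in> Cp R P" and x: "x \<in> P" and reg: "b \<oplus> x \<in> regular R"
    using min_prime_regular_decomp[OF P] by blast
  note sc = CpD(1)[OF PD(2) s] and bc = annD(1)[OF PD(2) b(1)] and xc = idealD(1)[OF PD(2) x]
  \<comment> \<open>\<open>P\<close> and \<open>ann P\<close> meet in zero, so an equation in their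
    sum splits into its two components.\<close>
  have split: "u = \<zero> \<and> v = \<zero>" if u: "u \<in> ann P" and v: "v \<in> P" and uv: "u \<oplus> v = \<zero>" for u v
  proof -
    note uc = annD(1)[OF PD(2) u] and vc = idealD(1)[OF PD(2) v]
    have "u = \<ominus> v" using minus_equality[OF uv vc uc] by simp
    then have "u \<in> P" using idealD(6)[OF PD(2) v] by simp
    then have "u = \<zero>" using ann_disjoint[OF PD(2)] u by blast
    then show ?thesis using uv vc by simp
  qed
  have "b \<otimes> s \<oplus> x \<in> regular R"
  proof (rule regularI)
    show "b \<otimes> s \<oplus> x \<in> carrier R" using bc sc xc by simp
    fix y assume y: "y \<in> carrier R"
    show "y = \<zero>" if "(b \<otimes> s \<oplus> x) \<otimes> y = \<zero>"
    proof -
      have "b \<otimes> (s \<otimes> y) \<oplus> x \<otimes> y = \<zero>" using that y bc sc xc by (simp add: l_distr m_assoc)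
      moreover have "b \<otimes> (s \<otimes> y) \<in> ann P" using idealD(5)[OF B _ b(1)] sc y by simp
      ultimately have z: "b \<otimes> (s \<otimes> y) = \<zero>" "x \<otimes> y = \<zero>"
        using split idealD(5)[OF PD(2) y x] by blast+
      then have "s \<otimes> y \<in> P" using CpD(2)[OF PD(2) b(2)] sc y idealD(2)[OF PD(2)] by simp
      then have "y \<in> P" using CpD(2)[OF PD(2) s y] by simp
      then have "(b \<oplus> x) \<otimes> y = \<zero>" using annD(2)[OF PD(2) b(1)] z(2) bc xc y by (simp add: l_distr)
      then show ?thesis using regularD(2)[OF reg y] by simp
    qed
    show "y = \<zero>" if "y \<otimes> (b \<otimes> s \<oplus> x) = \<zero>"
    proof -
      have "(y \<otimes> b) \<otimes> s \<oplus> y \<otimes> x = \<zero>" using that y bc sc xc by (simp add: r_distr m_assoc)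
      moreover have yb: "y \<otimes> b \<in> ann P" using idealD(4)[OF B y b(1)] .
      then have "(y \<otimes> b) \<otimes> s \<in> ann P" using idealD(5)[OF B sc] by simp
      ultimately have z: "(y \<otimes> b) \<otimes> s = \<zero>" "y \<otimes> x = \<zero>"
        using split idealD(4)[OF PD(2) y x] by blast+
      then have "y \<otimes> b \<in> P" using CpD(3)[OF PD(2) s] bc y idealD(2)[OF PD(2)] by simp
      then have "y \<otimes> b = \<zero>" using ann_disjoint[OF PD(2) _ yb] by simp
      then have "y \<otimes> (b \<oplus> x) = \<zero>" using z(2) bc xc y by (simp add: r_distr)
      then show ?thesis using regularD(3)[OF reg y] by simp
    qed
  qed
  then show thesis using that b x by blast
qed

section \<open>Ore conditions and torsion for the sets \<open>Cp R P\<close>\<close>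

lemma one_neq_zero:
  assumes "P \<in> min_primes R" shows "\<one> \<noteq> \<zero>"
  using mult_setD(3,4)[OF Cp_mult_set[OF min_primeD(2,3)[OF assms]]] by metis

lemma Cp_left_ore:
  assumes P: "P \<in> min_primes R" shows "left_ore_set R (Cp R P)"
  unfolding left_ore_set_def
proof (intro conjI ballI)
  note PD = min_primeD[OF P]
  note mult = Cp_mult_set[OF PD(2,3)]
  show "mult_set R (Cp R P)" by (rule mult)
  fix r s assume r: "r \<in> carrier R" and s: "s \<in> Cp R P"
  note sc = CpD(1)[OF PD(2) s]
  obtain b x where b: "b \<in> ann P" "b \<in> Cp R P" and x: "x \<in> P" and reg: "b \<otimes> s \<oplus> x \<in> regular R"
    using Cp_lift_regular[OF P s] by blast
  note bc = annD(1)[OF PD(2) b(1)] and xc = idealD(1)[OF PD(2) x]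
  obtain t a where t: "t \<in> regular R" and a: "a \<in> carrier R" and eq: "t \<otimes> r = a \<otimes> (b \<otimes> s \<oplus> x)"
    using left_ore_setE[OF regular_left_ore[OF one_neq_zero[OF P]] r reg] by blast
  note tc = regularD(1)[OF t]
  \<comment> \<open>Multiplying the Ore equation by \<open>b\<close> removes the correction
    \<open>a x\<close>, which lies in \<open>P\<close>; what remains is a left multiple of
    \<open>s\<close>.\<close>
  have "b \<otimes> t \<otimes> r = b \<otimes> (t \<otimes> r)" using bc tc r by (simp add: m_assoc)
  also have "\<dots> = b \<otimes> a \<otimes> b \<otimes> s \<oplus> b \<otimes> (a \<otimes> x)"
    unfolding eq using bc a sc xc by (simp add: r_distr m_assoc)
  also have "\<dots> = b \<otimes> a \<otimes> b \<otimes> s"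
    using annD(2)[OF PD(2) b(1) idealD(4)[OF PD(2) a x]] bc a sc by simp
  finally have "b \<otimes> t \<otimes> r = b \<otimes> a \<otimes> b \<otimes> s" .
  moreover have "b \<otimes> t \<in> Cp R P" using mult_setD(2)[OF mult b(2)] regular_subset_Cp[OF P] t by blast
  moreover have "b \<otimes> a \<otimes> b \<in> carrier R" using a bc by simp
  ultimately show "\<exists>t\<in>Cp R P. \<exists>a\<in>carrier R. t \<otimes> r = a \<otimes> s" by blast
qed

lemma Cp_right_ore:
  assumes P: "P \<in> min_primes R" shows "left_ore_set (opp R) (Cp R P)"
  using semiprime_goldie.Cp_left_ore[OF opp_semiprime_goldie, of P] P opp_Cp[OF min_primeD(2)[OF P]] by simp

text \<open>One element \<open>b\<close> of \<open>ann P \<inter> Cp R P\<close> kills all of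
  \<open>P\<close> from both sides, so it is a uniform witness for reversibility.\<close>

lemma Cp_den_set:
  assumes P: "P \<in> min_primes R" shows "den_set R (Cp R P)"
proof -
  note PD = min_primeD[OF P]
  obtain b x where b: "b \<in> ann P" "b \<in> Cp R P" using min_prime_regular_decomp[OF P] by blast
  have "\<exists>t\<in>Cp R P. t \<otimes> r = \<zero>" "\<exists>t\<in>Cp R P. r \<otimes> t = \<zero>" if "r \<in> P" for r
    using that b annD(2,3)[OF PD(2) b(1)] by blast+
  moreover have "r \<in> P" if "r \<in> carrier R" "s \<in> Cp R P" "r \<otimes> s = \<zero> \<or> s \<otimes> r = \<zero>" for r s
    using that CpD(2,3)[OF PD(2) that(2,1)] idealD(2)[OF PD(2)] by auto
  ultimately show ?thesis
    using Cp_left_ore[OF P] Cp_right_ore[OF P] unfolding den_set_def ore_set_iff by blast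
qed

lemma ass_Cp:
  assumes P: "P \<in> min_primes R" shows "ass R (Cp R P) = P"
proof -
  note PD = min_primeD[OF P]
  interpret D: right_denominators R "Cp R P"
    by unfold_locales (use Cp_right_ore[OF P] Cp_den_set[OF P] in \<open>auto simp: den_set_def\<close>)
  obtain b x where b: "b \<in> ann P" "b \<in> Cp R P" using min_prime_regular_decomp[OF P] by blast
  have "D.torsion = P"
  proof
    show "D.torsion \<subseteq> P"
      unfolding D.torsion_def using CpD(3)[OF PD(2)] idealD(2)[OF PD(2)] by fastforce
    show "P \<subseteq> D.torsion"
      unfolding D.torsion_def using annD(3)[OF PD(2) b(1)] b(2) idealD(1)[OF PD(2)] by blast
  qed
  then show ?thesis using D.ass_eq_torsion by simp
qed

section \<open>Comparison of multiplicative sets with the sets \<open>Cp R P\<close>\<close>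

lemma Cp_subset_imp_eq:
  assumes P: "P \<in> min_primes R" and Q: "Q \<in> min_primes R" and sub: "Cp R P \<subseteq> Cp R Q"
  shows "P = Q"
proof -
  have "localization R (Cp R Q)" by unfold_locales (use CpD(1)[OF min_primeD(2)[OF Q]] in blast)
  from ass_mono[OF this sub] have "P \<subseteq> Q" using ass_Cp P Q by simp
  then show ?thesis using min_primeD(5)[OF Q P] by simp
qed

text \<open>Take a minimal prime \<open>P\<close> above \<open>I\<close>. If \<open>s r\<close> is
  in \<open>P\<close> and \<open>b\<close> in \<open>ann P\<close>, then \<open>s r b = 0\<close>,
  so cancelling \<open>s\<close> modulo \<open>I\<close> puts \<open>r b\<close> into
  \<open>P\<close>; it also lies in \<open>ann P\<close>, hence vanishes.\<close>

lemma subset_Cp_of_regular_mod: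
  assumes I: "I \<in> ann_ideals" and S: "S \<subseteq> carrier R"
    and left: "\<And>s r. s \<in> S \<Longrightarrow> r \<in> carrier R \<Longrightarrow> s \<otimes> r \<in> I \<Longrightarrow> r \<in> I"
    and right: "\<And>s r. s \<in> S \<Longrightarrow> r \<in> carrier R \<Longrightarrow> r \<otimes> s \<in> I \<Longrightarrow> r \<in> I"
  shows "\<exists>P\<in>min_primes R. S \<subseteq> Cp R P"
proof -
  obtain P where P: "P \<in> min_primes R" "I \<subseteq> P" using max_ann_ideal_above[OF I] min_primes_eq by blast
  note PD = min_primeD[OF P(1)]
  note B = ann_ideal[OF PD(2)]
  note I0 = idealD(2)[OF ann_idealsD(1)[OF I]]
  have "s \<in> Cp R P" if s: "s \<in> S" for s
  proof (rule CpI[OF PD(2)])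
    show sc: "s \<in> carrier R" using S s by blast
    fix r assume r: "r \<in> carrier R"
    show "r \<in> P" if sr: "s \<otimes> r \<in> P"
    proof (rule min_prime_memI[OF P(1) r])
      fix b assume b: "b \<in> ann P"
      note bc = annD(1)[OF PD(2) b]
      have "s \<otimes> (r \<otimes> b) = \<zero>" using annD(3)[OF PD(2) b sr] sc r bc by (simp add: m_assoc)
      then have "r \<otimes> b \<in> P" using left[OF s, of "r \<otimes> b"] I0 P(2) r bc by auto
      then show "r \<otimes> b = \<zero>" using ann_disjoint[OF PD(2) _ idealD(4)[OF B r b]] by simp
    qed
    show "r \<in> P" if rs: "r \<otimes> s \<in> P"
    proof (rule min_prime_memI'[OF P(1) r])
      fix b assume b: "b \<in> ann P"
      note bc = annD(1)[OF PD(2) b]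
      have "(b \<otimes> r) \<otimes> s = \<zero>" using annD(2)[OF PD(2) b rs] sc r bc by (simp add: m_assoc)
      then have "b \<otimes> r \<in> P" using right[OF s, of "b \<otimes> r"] I0 P(2) r bc by auto
      then show "b \<otimes> r = \<zero>" using ann_disjoint[OF PD(2) _ idealD(5)[OF B r b]] by simp
    qed
  qed
  then show ?thesis using P(1) by blast
qed

text \<open>Choose \<open>t\<close> in \<open>S\<close> with maximal right annihilator. The Ore
  condition \<open>u t = a s\<close> puts the right annihilator of any \<open>s\<close> into that of
  \<open>u t\<close>, which by maximality equals that of \<open>t\<close>.\<close>

lemma left_ore_max_r_ann:
  assumes S: "left_ore_set R S"
  obtains t where "t \<in> S" "\<And>s r. s \<in> S \<Longrightarrow> r \<in> carrier R \<Longrightarrow> s \<otimes> r = \<zero> \<Longrightarrow> t \<otimes> r = \<zero>"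
proof -
  have M: "mult_set R S" using S by (simp add: left_ore_set_def)
  note Sc = subsetD[OF mult_setD(1)[OF M]]
  have "(\<lambda>t. r_ann R {t}) ` S \<subseteq> {r_ann R Y | Y. Y \<subseteq> carrier R}" using Sc by blast
  from acc_on_maximal[OF acc_r_ann this imageI[OF mult_setD(3)[OF M]]]
  obtain A where A: "A \<in> (\<lambda>t. r_ann R {t}) ` S" "\<And>B. B \<in> (\<lambda>t. r_ann R {t}) ` S \<Longrightarrow> A \<subseteq> B \<Longrightarrow> B = A" by blast
  obtain t where t: "t \<in> S" "A = r_ann R {t}" using A(1) by blast
  have "t \<otimes> r = \<zero>" if s: "s \<in> S" and r: "r \<in> carrier R" and sr: "s \<otimes> r = \<zero>" for s r
  proof -
    obtain u a where ua: "u \<in> S" "a \<in> carrier R" "u \<otimes> t = a \<otimes> s"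
      using left_ore_setE[OF S Sc[OF t(1)] s] by blast
    note c = Sc[OF ua(1)] Sc[OF t(1)] Sc[OF s]
    have "r_ann R {t} \<subseteq> r_ann R {u \<otimes> t}" using c by (auto simp: r_ann_def m_assoc)
    then have eq: "r_ann R {u \<otimes> t} = r_ann R {t}" using A(2) t(2) mult_setD(2)[OF M ua(1) t(1)] by blast
    have "u \<otimes> t \<otimes> r = \<zero>" unfolding ua(3) using ua(2) c r sr by (simp add: m_assoc)
    then have "r \<in> r_ann R {u \<otimes> t}" using r by (simp add: r_ann_def)
    then show ?thesis unfolding eq by (simp add: r_ann_def)
  qed
  then show thesis using that t(1) by blast
qed

text \<open>The elements killed by \<open>S\<close> from the left and from the right coincide, and
  both sides are realized by single elements \<open>t\<close> and \<open>u\<close>. The resulting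
  ideal is an annihilator ideal because \<open>t\<close> annihilates it, and \<open>S\<close>
  cancels modulo it.\<close>

lemma ore_set_subset_Cp:
  assumes S: "ore_set R S" shows "\<exists>P\<in>min_primes R. S \<subseteq> Cp R P"
proof -
  have L: "left_ore_set R S" and Ro: "left_ore_set (opp R) S" using S by (simp_all add: ore_set_iff)
  have M: "mult_set R S" using L by (simp add: left_ore_set_def)
  note Sc = subsetD[OF mult_setD(1)[OF M]]
  obtain t where t: "t \<in> S" "\<And>s r. s \<in> S \<Longrightarrow> r \<in> carrier R \<Longrightarrow> s \<otimes> r = \<zero> \<Longrightarrow> t \<otimes> r = \<zero>"
    using left_ore_max_r_ann[OF L] by blast
  obtain u where u: "u \<in> S" "\<And>s r. s \<in> S \<Longrightarrow> r \<in> carrier R \<Longrightarrow> r \<otimes> s = \<zero> \<Longrightarrow> u \<in> S \<and> r \<otimes> u = \<zero>"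
    using semiprime_goldie.left_ore_max_r_ann[OF opp_semiprime_goldie Ro] by auto
  note tc = Sc[OF t(1)] and uc = Sc[OF u(1)]
  define I where "I = {r \<in> carrier R. t \<otimes> r = \<zero>}"
  have left: "r \<in> I" if "s \<in> S" "r \<in> carrier R" "s \<otimes> r \<in> I" for s r
  proof -
    have "(t \<otimes> s) \<otimes> r = \<zero>" using that Sc[OF that(1)] tc by (simp add: I_def m_assoc)
    then show ?thesis using t(2)[OF mult_setD(2)[OF M t(1) that(1)] that(2)] that(2) by (simp add: I_def)
  qed
  have Iu: "r \<in> I \<longleftrightarrow> r \<otimes> u = \<zero>" if r: "r \<in> carrier R" for r
  proof
    assume "r \<in> I"
    then have tr: "t \<otimes> r = \<zero>" by (simp add: I_def)
    obtain v a where va: "v \<in> S" "a \<in> carrier R" "r \<otimes> v = t \<otimes> a"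
    proof -
      show thesis using left_ore_setE[OF Ro, of r t] r t(1) that by auto
    qed
    text \<open>\<open>t\<close> and \<open>t\<^sup>2\<close> have the same right annihilator.\<close>
    have "(t \<otimes> t) \<otimes> a = t \<otimes> r \<otimes> v" using va r tc Sc[OF va(1)] by (simp add: m_assoc)
    then have "(t \<otimes> t) \<otimes> a = \<zero>" using tr Sc[OF va(1)] by simp
    then have "t \<otimes> a = \<zero>" using t(2)[OF mult_setD(2)[OF M t(1) t(1)] va(2)] by simp
    then show "r \<otimes> u = \<zero>" using u(2)[OF va(1) r] va(3) by simp
  next
    assume ru: "r \<otimes> u = \<zero>"
    obtain v a where va: "v \<in> S" "a \<in> carrier R" "v \<otimes> r = a \<otimes> u" using left_ore_setE[OF L r u(1)] by blast
    \<comment> \<open>The mirror image: now \<open>u\<close> and its square have the same left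
      annihilator, since \<open>u\<close> already realizes the largest one.\<close>
    have "a \<otimes> (u \<otimes> u) = v \<otimes> (r \<otimes> u)" using va r uc Sc[OF va(1)] by (simp flip: m_assoc)
    then have "a \<otimes> (u \<otimes> u) = \<zero>" using ru Sc[OF va(1)] by simp
    then have "a \<otimes> u = \<zero>" using u(2)[OF mult_setD(2)[OF M u(1) u(1)] va(2)] by simp
    then have "t \<otimes> r = \<zero>" using t(2)[OF va(1) r] va(3) by simp
    then show "r \<in> I" using r by (simp add: I_def)
  qed
  have right: "r \<in> I" if "s \<in> S" "r \<in> carrier R" "r \<otimes> s \<in> I" for s r
  proof -
    have "r \<otimes> (s \<otimes> u) = \<zero>" using that Iu[of "r \<otimes> s"] Sc[OF that(1)] uc by (simp add: m_assoc)
    then show ?thesis using u(2)[OF mult_setD(2)[OF M that(1) u(1)] that(2)] Iu[OF that(2)] by simp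
  qed
  have I: "ideal I R"
  proof (rule ideal_by_closure)
    fix r x assume r: "r \<in> carrier R" and x: "x \<in> I"
    have xc: "x \<in> carrier R" using x by (simp add: I_def)
    have "t \<otimes> (x \<otimes> r) = \<zero>" using x r tc by (simp add: I_def flip: m_assoc)
    then show "x \<otimes> r \<in> I" using xc r by (simp add: I_def)
    have "r \<otimes> x \<otimes> u = \<zero>" using Iu[OF xc] x xc r uc by (simp add: m_assoc)
    then show "r \<otimes> x \<in> I" using Iu[of "r \<otimes> x"] xc r by simp
  qed (use tc in \<open>auto simp: I_def r_distr\<close>)
  have "t \<in> ann I" by (rule annI[OF tc]) (simp add: I_def)
  then have "ann (ann I) \<subseteq> I"
    using annD[OF ann_ideal[OF I]] unfolding I_def by blast
  then have "ann (ann I) = I" using ann_ann_superset[OF I] by blast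
  moreover have "\<one> \<notin> I" using tc t(1) mult_setD(4)[OF M] by (auto simp: I_def)
  then have "I \<noteq> carrier R" by blast
  ultimately have "I \<in> ann_ideals" using I by (simp add: ann_ideals_def)
  from subset_Cp_of_regular_mod[OF this mult_setD(1)[OF M] left right] show ?thesis .
qed

text \<open>Modulo the kernel the elements of \<open>S\<close> cancel because their images are
  units. As regular elements belong to \<open>S\<close>, the kernel is an annihilator ideal by
  \<open>ann_ann_eqI\<close>, and it is proper since the localization is nonzero.\<close>

lemma nonzero_Loc_subset_Cp:
  assumes M: "mult_set R S" and reg: "regular R \<subseteq> S" and nz: "\<one>\<^bsub>Loc R S\<^esub> \<noteq> \<zero>\<^bsub>Loc R S\<^esub>"
  shows "\<exists>P\<in>min_primes R. S \<subseteq> Cp R P"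
proof -
  interpret localization R S by unfold_locales (rule mult_setD(1)[OF M])
  note I = ass_ideal
  have ass_iff: "r \<in> ass R S \<longleftrightarrow> loc_map R S r = \<zero>\<^bsub>L\<^esub>" if "r \<in> carrier R" for r
    using that by (simp add: ass_def)
  have left: "r \<in> ass R S" if s: "s \<in> S" and r: "r \<in> carrier R" and sr: "s \<otimes> r \<in> ass R S" for s r
  proof -
    have sc: "s \<in> carrier R" using S_carrier s by blast
    note h = loc_map.hom_closed[OF sc] loc_map.hom_closed[OF r] loc_x_closed[OF s]
    have z: "loc_map R S s \<otimes>\<^bsub>L\<^esub> loc_map R S r = \<zero>\<^bsub>L\<^esub>"
      using sr ass_iff[OF m_closed[OF sc r]] loc_map.hom_mult[OF sc r] by simp
    have "loc_map R S r = (loc_x R S s \<otimes>\<^bsub>L\<^esub> loc_map R S s) \<otimes>\<^bsub>L\<^esub> loc_map R S r"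
      unfolding loc_map_x(2)[OF s] using h by simp
    also have "\<dots> = loc_x R S s \<otimes>\<^bsub>L\<^esub> (loc_map R S s \<otimes>\<^bsub>L\<^esub> loc_map R S r)" by (rule L.m_assoc[OF h(3,1,2)])
    also have "\<dots> = \<zero>\<^bsub>L\<^esub>" unfolding z using h by simp
    finally show ?thesis using ass_iff[OF r] by simp
  qed
  have right: "r \<in> ass R S" if s: "s \<in> S" and r: "r \<in> carrier R" and rs: "r \<otimes> s \<in> ass R S" for s r
  proof -
    have sc: "s \<in> carrier R" using S_carrier s by blast
    note h = loc_map.hom_closed[OF sc] loc_map.hom_closed[OF r] loc_x_closed[OF s]
    have z: "loc_map R S r \<otimes>\<^bsub>L\<^esub> loc_map R S s = \<zero>\<^bsub>L\<^esub>"
      using rs ass_iff[OF m_closed[OF r sc]] loc_map.hom_mult[OF r sc] by simp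
    have "loc_map R S r = loc_map R S r \<otimes>\<^bsub>L\<^esub> (loc_map R S s \<otimes>\<^bsub>L\<^esub> loc_x R S s)"
      unfolding loc_map_x(1)[OF s] using h by simp
    also have "\<dots> = (loc_map R S r \<otimes>\<^bsub>L\<^esub> loc_map R S s) \<otimes>\<^bsub>L\<^esub> loc_x R S s" by (rule L.m_assoc[OF h(2,1,3), symmetric])
    also have "\<dots> = \<zero>\<^bsub>L\<^esub>" unfolding z using h by simp
    finally show ?thesis using ass_iff[OF r] by simp
  qed
  have "ann (ann (ass R S)) = ass R S"
    by (rule ann_ann_eqI[OF I]) (use right reg in blast)
  moreover have "\<one> \<notin> ass R S" using ass_iff[OF one_closed] nz by simp
  then have "ass R S \<noteq> carrier R" by blast
  ultimately have "ass R S \<in> ann_ideals" using I by (simp add: ann_ideals_def)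
  from subset_Cp_of_regular_mod[OF this S_carrier left right] show ?thesis .
qed

end

section \<open>Localization at a minimal prime\<close>

context ring
begin

text \<open>A left ideal maximal among those meeting \<open>L\<close> trivially. Zorn's lemma
  provides it because the ring to which this is applied is not yet known to satisfy a chain
  condition.\<close>

lemma left_complement:
  assumes L: "left_ideal L R"
  obtains K where "left_ideal K R" "K \<inter> L \<subseteq> {\<zero>}"
    "left_essential R {x \<oplus> y | x y. x \<in> L \<and> y \<in> K}"
proof -
  define Ks where "Ks = {K. left_ideal K R \<and> K \<inter> L \<subseteq> {\<zero>}}"
  have "{\<zero>} \<in> Ks" unfolding Ks_def using left_ideal_by_closure[of "{\<zero>}"] by auto
  then have ne: "Ks \<noteq> {}" by blast
  have "\<exists>K\<in>Ks. \<forall>K'\<in>Ks. K \<subseteq> K' \<longrightarrow> K' = K"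
  proof (rule subset_Zorn_nonempty[OF ne])
    fix C assume C: "C \<noteq> {}" "subset.chain Ks C"
    then have CK: "\<And>K. K \<in> C \<Longrightarrow> left_ideal K R \<and> K \<inter> L \<subseteq> {\<zero>}"
      and lin: "\<And>U V. U \<in> C \<Longrightarrow> V \<in> C \<Longrightarrow> U \<subseteq> V \<or> V \<subseteq> U"
      unfolding subset_chain_def Ks_def by blast+
    have "left_ideal (\<Union>C) R"
    proof (rule left_ideal_by_closure)
      show "\<Union>C \<subseteq> carrier R" using CK left_idealD(1) by blast
      show "\<zero> \<in> \<Union>C" using C(1) CK left_idealD(2) by blast
      show "r \<otimes> x \<in> \<Union>C" if "r \<in> carrier R" "x \<in> \<Union>C" for r x
        using that CK left_idealD(4) by blast
      fix x y assume "x \<in> \<Union>C" "y \<in> \<Union>C"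
      then obtain U V where UV: "U \<in> C" "V \<in> C" "x \<in> U" "y \<in> V" by blast
      then obtain Z where "Z \<in> C" "x \<in> Z" "y \<in> Z" using lin[OF UV(1,2)] by blast
      then show "x \<oplus> y \<in> \<Union>C" using CK left_idealD(3)[of Z x y] by blast
    qed
    then show "\<Union>C \<in> Ks" unfolding Ks_def using CK by blast
  qed
  then obtain K where Ks: "K \<in> Ks" and max_Ks: "\<forall>K'\<in>Ks. K \<subseteq> K' \<longrightarrow> K' = K" by (rule bexE)
  have K: "left_ideal K R" "K \<inter> L \<subseteq> {\<zero>}" using Ks by (simp_all add: Ks_def)
  have max: "K' = K" if "left_ideal K' R" "K' \<inter> L \<subseteq> {\<zero>}" "K \<subseteq> K'" for K'
    using max_Ks that by (simp add: Ks_def)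
  note LD = left_idealD[OF L] and KD = left_idealD[OF K(1)]
  let ?E = "{x \<oplus> y | x y. x \<in> L \<and> y \<in> K}"
  have "\<exists>r\<in>carrier R. r \<otimes> a \<in> ?E \<and> r \<otimes> a \<noteq> \<zero>" if a: "a \<in> carrier R" "a \<noteq> \<zero>" for a
  proof (rule ccontr)
    assume "\<not> ?thesis"
    then have none: "r \<otimes> a = \<zero>" if "r \<in> carrier R" "r \<otimes> a \<in> ?E" for r using that by blast
    let ?K = "{x \<oplus> y | x y. x \<in> K \<and> y \<in> {r \<otimes> a | r. r \<in> carrier R}}"
    have mem: "k \<oplus> r \<otimes> a \<in> ?K" if "k \<in> K" "r \<in> carrier R" for k r using that by blast
    \<comment> \<open>If \<open>Ra\<close> met \<open>L + K\<close> trivially, \<open>K\<close>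
      could be enlarged by \<open>Ra\<close>: an element \<open>k + r a\<close> of \<open>L\<close>
      has \<open>r a\<close> in \<open>L + K\<close>, so \<open>r a = 0\<close> and the element lies
      in both \<open>K\<close> and \<open>L\<close>.\<close>
    have "?K \<inter> L \<subseteq> {\<zero>}"
    proof
      fix z assume z: "z \<in> ?K \<inter> L"
      then obtain k r where k: "k \<in> K" "r \<in> carrier R" "z = k \<oplus> r \<otimes> a" by blast
      note kc = KD(1)[OF k(1)]
      have "r \<otimes> a = z \<oplus> \<ominus> k" unfolding k(3) using kc k(2) a(1) by (simp add: a_ac r_neg2)
      then have "r \<otimes> a \<in> ?E" using z KD(5)[OF k(1)] by blast
      then have "r \<otimes> a = \<zero>" by (rule none[OF k(2)])
      then have "z = k" using k(3) kc by simp
      then show "z \<in> {\<zero>}" using z k(1) K(2) by blast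
    qed
    moreover have "K \<subseteq> ?K"
    proof
      fix k assume k: "k \<in> K"
      have "k \<oplus> \<zero> \<otimes> a = k" using KD(1)[OF k] a(1) by simp
      then show "k \<in> ?K" using mem[OF k zero_closed] by simp
    qed
    ultimately have "?K = K" using max left_ideal_sum[OF K(1) left_ideal_principal[OF a(1)]] by blast
    moreover have "\<zero> \<oplus> \<one> \<otimes> a \<in> ?K" by (rule mem[OF KD(2) one_closed])
    ultimately have "a \<in> K" using a(1) by simp
    then have "\<zero> \<oplus> a \<in> ?E" using LD(2) by blast
    then have "\<one> \<otimes> a \<in> ?E" using a(1) by simp
    then have "\<one> \<otimes> a = \<zero>" by (rule none[OF one_closed])
    then show False using a by simp
  qed
  then have "left_essential R ?E"
    unfolding left_essential_def using left_ideal_sum[OF L K(1)] by blast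
  then show thesis using that K by blast
qed

end

text \<open>Collects what is needed of the localization at \<open>Cp R P\<close>. The target ring is
  arbitrary so that the results apply both to \<open>Loc R (Cp R P)\<close> and, over
  \<open>opp R\<close>, to its opposite.\<close>

locale min_prime_fractions = semiprime_goldie R + \<phi>: ring_hom_ring R A \<phi>
  for R (structure) and A and \<phi> +
  fixes P
  assumes P: "P \<in> min_primes R"
    and units: "\<phi> ` Cp R P \<subseteq> Units A"
    and fractions: "left_fractions R A \<phi> (Cp R P) = carrier A"
    and kernel: "r \<in> carrier R \<Longrightarrow> \<phi> r = \<zero>\<^bsub>A\<^esub> \<longleftrightarrow> r \<in> P"
begin

lemmas PD = min_primeD[OF P]

lemma fractionE:
  assumes "u \<in> carrier A"
  obtains s r where "s \<in> Cp R P" "r \<in> carrier R" "\<phi> s \<otimes>\<^bsub>A\<^esub> u = \<phi> r"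
  using assms that fractions unfolding left_fractions_def by blast

lemma unit_cancel:
  assumes s: "s \<in> Cp R P" and u: "u \<in> carrier A" and z: "\<phi> s \<otimes>\<^bsub>A\<^esub> u = \<zero>\<^bsub>A\<^esub>"
  shows "u = \<zero>\<^bsub>A\<^esub>"
proof -
  have U: "\<phi> s \<in> Units A" using units s by blast
  have "u = inv\<^bsub>A\<^esub> (\<phi> s) \<otimes>\<^bsub>A\<^esub> \<phi> s \<otimes>\<^bsub>A\<^esub> u" using U u by simp
  also have "\<dots> = inv\<^bsub>A\<^esub> (\<phi> s) \<otimes>\<^bsub>A\<^esub> (\<phi> s \<otimes>\<^bsub>A\<^esub> u)"
    by (rule \<phi>.S.m_assoc) (use U u in \<open>simp_all add: \<phi>.S.Units_closed\<close>)
  also have "\<dots> = \<zero>\<^bsub>A\<^esub>" unfolding z using U by simp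
  finally show ?thesis .
qed

lemma nonzero_fractionE:
  assumes u: "u \<in> carrier A" "u \<noteq> \<zero>\<^bsub>A\<^esub>"
  obtains s r where "s \<in> Cp R P" "r \<in> carrier R" "\<phi> s \<otimes>\<^bsub>A\<^esub> u = \<phi> r" "r \<notin> P"
proof -
  obtain s r where sr: "s \<in> Cp R P" "r \<in> carrier R" "\<phi> s \<otimes>\<^bsub>A\<^esub> u = \<phi> r" using fractionE[OF u(1)] by blast
  have "r \<notin> P"
  proof
    assume "r \<in> P"
    then have "\<phi> s \<otimes>\<^bsub>A\<^esub> u = \<zero>\<^bsub>A\<^esub>" using kernel[OF sr(2)] sr(3) by simp
    then show False using unit_cancel[OF sr(1) u(1)] u(2) by blast
  qed
  then show thesis using that sr by blast
qed

lemma pullback_left_ideal: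
  assumes "left_ideal L A" shows "left_ideal {r \<in> carrier R. \<phi> r \<in> L} R"
  by (rule left_ideal_by_closure)
    (use \<phi>.S.left_idealD(2,3,4)[OF assms] in simp_all)

lemma pullback_essential_unit:
  assumes L: "left_ideal L A" and ess: "left_essential R {r \<in> carrier R. \<phi> r \<in> L}"
  shows "L = carrier A"
proof -
  obtain c where c: "c \<in> {r \<in> carrier R. \<phi> r \<in> L}" "c \<in> regular R" using left_essential_regular[OF ess] by blast
  have "\<phi> c \<in> Units A" using units regular_subset_Cp[OF P] c(2) by blast
  then show ?thesis using \<phi>.S.left_ideal_unit[OF L] c(1) by blast
qed

text \<open>The preimage of an essential left ideal is essential in \<open>R\<close>, so it contains
  a regular element, whose image is a unit. Together with complements this means that every left
  ideal is a direct summand.\<close>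

lemma essential_eq_carrier:
  assumes E: "left_essential A E" shows "E = carrier A"
proof (rule pullback_essential_unit)
  show L: "left_ideal E A" using E by (simp add: left_essential_def)
  let ?I = "{r \<in> carrier R. \<phi> r \<in> E}"
  have "\<exists>r\<in>carrier R. r \<otimes> a \<in> ?I \<and> r \<otimes> a \<noteq> \<zero>" if a: "a \<in> carrier R" "a \<noteq> \<zero>" for a
  proof (cases "a \<in> P")
    case True
    then have "\<phi> a \<in> E" using kernel[OF a(1)] \<phi>.S.left_idealD(2)[OF L] by simp
    then show ?thesis using a by (intro bexI[of _ \<one>]) simp_all
  next
    case False
    then obtain u where u: "u \<in> carrier A" "u \<otimes>\<^bsub>A\<^esub> \<phi> a \<in> E" "u \<otimes>\<^bsub>A\<^esub> \<phi> a \<noteq> \<zero>\<^bsub>A\<^esub>"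
      using left_essentialE[OF E \<phi>.hom_closed[OF a(1)]] kernel[OF a(1)] by blast
    obtain s r where sr: "s \<in> Cp R P" "r \<in> carrier R" "\<phi> s \<otimes>\<^bsub>A\<^esub> u = \<phi> r" using fractionE[OF u(1)] by blast
    have sc: "\<phi> s \<in> carrier A" using CpD(1)[OF PD(2) sr(1)] by simp
    have eq: "\<phi> (r \<otimes> a) = \<phi> s \<otimes>\<^bsub>A\<^esub> (u \<otimes>\<^bsub>A\<^esub> \<phi> a)"
      using sr(2,3) a(1) u(1) sc by (simp flip: \<phi>.S.m_assoc)
    have "\<phi> (r \<otimes> a) \<in> E" unfolding eq by (rule \<phi>.S.left_idealD(4)[OF L sc u(2)])
    moreover have "r \<otimes> a \<noteq> \<zero>"
    proof
      assume "r \<otimes> a = \<zero>"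
      then have "\<phi> s \<otimes>\<^bsub>A\<^esub> (u \<otimes>\<^bsub>A\<^esub> \<phi> a) = \<zero>\<^bsub>A\<^esub>" using eq by simp
      then show False using unit_cancel[OF sr(1), of "u \<otimes>\<^bsub>A\<^esub> \<phi> a"] u a(1) by simp
    qed
    ultimately show ?thesis using sr(2) a(1) by blast
  qed
  then show "left_essential R ?I" unfolding left_essential_def using pullback_left_ideal[OF L] by blast
qed

lemma dcc_left_ideals: "dcc_on {I. left_ideal I A}"
  unfolding dcc_on_def
proof
  assume "\<exists>f :: nat \<Rightarrow> 'c set. (\<forall>n. f n \<in> {I. left_ideal I A}) \<and> (\<forall>n. f (Suc n) \<subset> f n)"
  then obtain L :: "nat \<Rightarrow> 'c set" where L: "\<And>n. left_ideal (L n) A" "\<And>n. L (Suc n) \<subset> L n" by blast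
  have "\<exists>K. left_ideal K A \<and> K \<inter> L (Suc n) \<subseteq> {\<zero>\<^bsub>A\<^esub>} \<and> (\<exists>k\<in>K. k \<in> L n \<and> k \<noteq> \<zero>\<^bsub>A\<^esub>)" for n
  proof -
    obtain K where K: "left_ideal K A" "K \<inter> L (Suc n) \<subseteq> {\<zero>\<^bsub>A\<^esub>}"
      "left_essential A {x \<oplus>\<^bsub>A\<^esub> y | x y. x \<in> L (Suc n) \<and> y \<in> K}"
      using \<phi>.S.left_complement[OF L(1)] by blast
    obtain y where y: "y \<in> L n" "y \<notin> L (Suc n)" using L(2) by blast
    \<comment> \<open>As \<open>L (Suc n) + K\<close> is everything, an element of
      \<open>L n\<close> outside \<open>L (Suc n)\<close> has a nonzero component in
      \<open>K\<close>, and that component is again in \<open>L n\<close>.\<close>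
    note yc = \<phi>.S.left_idealD(1)[OF L(1) y(1)]
    then have "y \<in> {x \<oplus>\<^bsub>A\<^esub> y | x y. x \<in> L (Suc n) \<and> y \<in> K}" using essential_eq_carrier[OF K(3)] by simp
    then obtain l k where lk: "l \<in> L (Suc n)" "k \<in> K" "y = l \<oplus>\<^bsub>A\<^esub> k" by blast
    note lc = \<phi>.S.left_idealD(1)[OF L(1) lk(1)] and kc = \<phi>.S.left_idealD(1)[OF K(1) lk(2)]
    have "l \<in> L n" using lk(1) L(2) by blast
    then have "\<ominus>\<^bsub>A\<^esub> l \<oplus>\<^bsub>A\<^esub> y \<in> L n"
      using \<phi>.S.left_idealD(3)[OF L(1) \<phi>.S.left_idealD(5)[OF L(1)] y(1)] by blast
    moreover have "\<ominus>\<^bsub>A\<^esub> l \<oplus>\<^bsub>A\<^esub> y = k" unfolding lk(3) using lc kc by (simp add: \<phi>.S.r_neg1)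
    ultimately have "k \<in> L n" by simp
    moreover have "k \<noteq> \<zero>\<^bsub>A\<^esub>" using y(2) lk lc by auto
    ultimately show ?thesis using K(1,2) lk(2) by blast
  qed
  then obtain K where K: "\<And>n. left_ideal (K n) A" "\<And>n. K n \<inter> L (Suc n) \<subseteq> {\<zero>\<^bsub>A\<^esub>}"
    "\<And>n. \<exists>k\<in>K n. k \<in> L n \<and> k \<noteq> \<zero>\<^bsub>A\<^esub>" by metis
  define M where "M n = {r \<in> carrier R. \<phi> r \<in> L n}" for n
  \<comment> \<open>Cutting the preimage down to \<open>ann P\<close> makes \<open>\<phi>\<close>
    injective on it, because \<open>P \<inter> ann P\<close> is zero; the direct sum then takes
    place in \<open>R\<close> itself.\<close>
  define N where "N n = {b \<in> ann P. \<phi> b \<in> L n \<and> \<phi> b \<in> K n}" for n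
  note B = ann_ideal[OF PD(2)]
  have "independent_family R N"
  proof (rule independent_family_chain[of M])
    show "left_ideal (M n) R" for n unfolding M_def by (rule pullback_left_ideal[OF L(1)])
    show "M (Suc n) \<subseteq> M n" for n unfolding M_def using L(2) by blast
    show "N n \<subseteq> M n" for n unfolding M_def N_def using annD(1)[OF PD(2)] by blast
    show "N n \<inter> M (Suc n) \<subseteq> {\<zero>}" for n
    proof
      fix b assume b: "b \<in> N n \<inter> M (Suc n)"
      then have bc: "b \<in> carrier R" "b \<in> ann P" unfolding M_def N_def by blast+
      have "\<phi> b = \<zero>\<^bsub>A\<^esub>" using b K(2)[of n] unfolding M_def N_def by blast
      then have "b \<in> P" using kernel[OF bc(1)] by simp
      then show "b \<in> {\<zero>}" using ann_disjoint[OF PD(2) _ bc(2)] by simp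
    qed
  qed
  moreover have "left_ideal (N n) R" for n
  proof (rule left_ideal_by_closure)
    note BD = idealD[OF B] and KD = \<phi>.S.left_idealD[OF K(1)[of n]] and LD = \<phi>.S.left_idealD[OF L(1)[of n]]
    show "N n \<subseteq> carrier R" unfolding N_def using BD(1) by blast
    show "\<zero> \<in> N n" unfolding N_def using BD(2) KD(2) LD(2) by simp
    show "x \<oplus> y \<in> N n" if "x \<in> N n" "y \<in> N n" for x y
      using that BD(1,3) KD(3) LD(3) unfolding N_def by simp
    show "r \<otimes> x \<in> N n" if "r \<in> carrier R" "x \<in> N n" for r x
      using that BD(1,4) KD(4) LD(4) unfolding N_def by simp
  qed
  moreover have "N n \<noteq> {\<zero>}" for n
  proof -
    obtain k where k: "k \<in> K n" "k \<in> L n" "k \<noteq> \<zero>\<^bsub>A\<^esub>" using K(3) by blast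
    note kc = \<phi>.S.left_idealD(1)[OF K(1) k(1)]
    obtain s r where sr: "s \<in> Cp R P" "r \<in> carrier R" "\<phi> s \<otimes>\<^bsub>A\<^esub> k = \<phi> r" "r \<notin> P"
      using nonzero_fractionE[OF kc k(3)] by blast
    have sc: "\<phi> s \<in> carrier A" using CpD(1)[OF PD(2) sr(1)] by simp
    have r: "\<phi> r \<in> K n" "\<phi> r \<in> L n"
      unfolding sr(3)[symmetric]
      by (rule \<phi>.S.left_idealD(4)[OF K(1) sc k(1)], rule \<phi>.S.left_idealD(4)[OF L(1) sc k(2)])
    \<comment> \<open>The numerator \<open>r\<close> of \<open>k\<close> is outside
      \<open>P\<close>, so some element of \<open>ann P\<close> does not kill it; the product is a
      nonzero element of \<open>N n\<close>.\<close>
    obtain b where b: "b \<in> ann P" "b \<otimes> r \<noteq> \<zero>" using min_prime_memI'[OF P sr(2)] sr(4) by blast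
    note bc = annD(1)[OF PD(2) b(1)]
    have "b \<otimes> r \<in> N n"
      unfolding N_def using idealD(5)[OF B sr(2) b(1)] bc sr(2)
        \<phi>.S.left_idealD(4)[OF K(1) \<phi>.hom_closed[OF bc] r(1)]
        \<phi>.S.left_idealD(4)[OF L(1) \<phi>.hom_closed[OF bc] r(2)] by simp
    then show ?thesis using b(2) by blast
  qed
  ultimately show False using no_infinite_independent_family[of N] by simp
qed

text \<open>A nonzero ideal of \<open>A\<close> has a preimage not contained in \<open>P\<close>.
  Primeness makes this preimage essential, so it contains a regular element and the ideal contains a
  unit.\<close>

lemma simple: "simple_ring A"
  unfolding simple_ring_def
proof (intro conjI allI impI)
  have "\<one> \<notin> P" using left_ideal_proper[OF ideal_imp_left_ideal[OF PD(2)]] PD(3) by blast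
  then show "\<one>\<^bsub>A\<^esub> \<noteq> \<zero>\<^bsub>A\<^esub>" using kernel[OF one_closed] by simp
  fix I assume I: "ideal I A"
  note ID = \<phi>.S.idealD[OF I]
  show "I = {\<zero>\<^bsub>A\<^esub>} \<or> I = carrier A"
  proof (rule disjCI)
    assume nI: "I \<noteq> carrier A"
    have "u = \<zero>\<^bsub>A\<^esub>" if u: "u \<in> I" for u
    proof (rule ccontr)
      assume "u \<noteq> \<zero>\<^bsub>A\<^esub>"
      then obtain s r where sr: "s \<in> Cp R P" "r \<in> carrier R" "\<phi> s \<otimes>\<^bsub>A\<^esub> u = \<phi> r" "r \<notin> P"
        using nonzero_fractionE[OF ID(1)[OF u]] by blast
      have "\<phi> s \<in> carrier A" using CpD(1)[OF PD(2) sr(1)] by simp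
      then have rI: "\<phi> r \<in> I" unfolding sr(3)[symmetric] using ID(4) u by blast
      let ?I = "{r \<in> carrier R. \<phi> r \<in> I}"
      \<comment> \<open>The right annihilator of the preimage modulo \<open>P\<close>. Primeness
        gives \<open>J \<subseteq> P\<close>, so every \<open>a\<close> outside \<open>P\<close> is
        moved by the preimage to something outside \<open>P\<close>, in particular nonzero.\<close>
      define J where "J = {z \<in> carrier R. \<forall>i\<in>?I. i \<otimes> z \<in> P}"
      have I': "ideal ?I R"
        by (rule ideal_by_closure) (use ID(2-5) in simp_all)
      have J: "ideal J R"
      proof (rule ideal_by_closure)
        fix x z assume x: "x \<in> carrier R" and "z \<in> J"
        then have z: "z \<in> carrier R" "\<And>i. i \<in> ?I \<Longrightarrow> i \<otimes> z \<in> P" by (auto simp: J_def)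
        have "i \<otimes> (x \<otimes> z) \<in> P" if i: "i \<in> ?I" for i
          using z(2)[OF idealD(5)[OF I' x i]] idealD(1)[OF I' i] x z(1) by (simp add: m_assoc)
        then show "x \<otimes> z \<in> J" using x z(1) by (simp add: J_def)
        have "i \<otimes> (z \<otimes> x) \<in> P" if i: "i \<in> ?I" for i
          using idealD(5)[OF PD(2) x z(2)[OF i]] idealD(1)[OF I' i] x z(1) by (simp add: m_assoc)
        then show "z \<otimes> x \<in> J" using x z(1) by (simp add: J_def)
      next
        show "x \<oplus> z \<in> J" if "x \<in> J" "z \<in> J" for x z
          using that idealD(3)[OF PD(2)] unfolding J_def by (simp add: r_distr)
        show "\<zero> \<in> J" using idealD(2)[OF PD(2)] by (simp add: J_def)
      qed (auto simp: J_def)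
      have "?I \<subseteq> P \<or> J \<subseteq> P" by (rule nc_primeD(3)[OF PD(1) I' J]) (auto simp: J_def)
      then have JP: "J \<subseteq> P" using rI sr(2,4) by blast
      have "\<exists>r\<in>carrier R. r \<otimes> a \<in> ?I \<and> r \<otimes> a \<noteq> \<zero>" if a: "a \<in> carrier R" "a \<noteq> \<zero>" for a
      proof (cases "a \<in> P")
        case True
        then have "\<phi> a \<in> I" using kernel[OF a(1)] ID(2) by simp
        then show ?thesis using a by (intro bexI[of _ \<one>]) simp_all
      next
        case False
        then have "a \<notin> J" using JP by blast
        then obtain i where i: "i \<in> ?I" "i \<otimes> a \<notin> P" using a(1) unfolding J_def by blast
        have "i \<otimes> a \<in> ?I" by (rule idealD(5)[OF I' a(1) i(1)])
        moreover have "i \<otimes> a \<noteq> \<zero>" using i(2) idealD(2)[OF PD(2)] by auto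
        ultimately show ?thesis using i(1) by blast
      qed
      then have "left_essential R ?I"
        unfolding left_essential_def using ideal_imp_left_ideal[OF I'] by blast
      then show False using pullback_essential_unit[OF \<phi>.S.ideal_imp_left_ideal[OF I]] nI by blast
    qed
    then show "I = {\<zero>\<^bsub>A\<^esub>}" using ID(2) by blast
  qed
qed

end

section \<open>Localizations at minimal primes and the maximal sets\<close>

context semiprime_goldie
begin

lemma localization_Cp: "P \<in> min_primes R \<Longrightarrow> localization R (Cp R P)"
  by unfold_locales (use CpD(1)[OF min_primeD(2)] in blast)

lemma min_prime_fractions_Loc:
  assumes P: "P \<in> min_primes R"
  shows "min_prime_fractions R (Loc R (Cp R P)) (loc_map R (Cp R P)) P"
proof -
  interpret localization R "Cp R P" by (rule localization_Cp[OF P])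
  have "loc_map R (Cp R P) r = \<zero>\<^bsub>L\<^esub> \<longleftrightarrow> r \<in> P" if "r \<in> carrier R" for r
    using that ass_Cp[OF P] unfolding ass_def by blast
  then show ?thesis
    by (intro min_prime_fractions.intro min_prime_fractions_axioms.intro semiprime_goldie_axioms
        loc_map.ring_hom_ring_axioms P loc_map_Units Loc_left_fractions[OF Cp_left_ore[OF P]])
qed

lemma min_prime_fractions_opp_Loc:
  assumes P: "P \<in> min_primes R"
  shows "min_prime_fractions (opp R) (opp (Loc R (Cp R P))) (loc_map R (Cp R P)) P"
proof -
  interpret localization R "Cp R P" by (rule localization_Cp[OF P])
  have ker: "loc_map R (Cp R P) r = \<zero>\<^bsub>L\<^esub> \<longleftrightarrow> r \<in> P" if "r \<in> carrier R" for r
    using that ass_Cp[OF P] unfolding ass_def by blast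
  have Cp: "Cp (opp R) P = Cp R P" by (rule opp_Cp[OF min_primeD(2)[OF P]])
  have "Units (opp L) = Units L" unfolding Units_def by auto
  then show ?thesis
    using loc_map_Units ker P Loc_right_fractions[OF Cp_right_ore[OF P]]
    by (intro min_prime_fractions.intro min_prime_fractions_axioms.intro opp_semiprime_goldie
        loc_map.opp_ring_hom_ring) (simp_all add: Cp)
qed

lemma Loc_Cp_simple: "P \<in> min_primes R \<Longrightarrow> simple_ring (Loc R (Cp R P))"
  using min_prime_fractions.simple[OF min_prime_fractions_Loc] .

lemma Loc_Cp_artinian:
  assumes P: "P \<in> min_primes R" shows "artinian (Loc R (Cp R P))"
  using min_prime_fractions.dcc_left_ideals[OF min_prime_fractions_Loc[OF P]]
    min_prime_fractions.dcc_left_ideals[OF min_prime_fractions_opp_Loc[OF P]]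
  by (simp add: artinian_def)

lemma Loc_Cp_nonzero:
  assumes P: "P \<in> min_primes R" shows "\<one>\<^bsub>Loc R (Cp R P)\<^esub> \<noteq> \<zero>\<^bsub>Loc R (Cp R P)\<^esub>"
  using Loc_Cp_simple[OF P] by (simp add: simple_ring_def)

lemma Cp_localizable:
  assumes P: "P \<in> min_primes R"
  shows "left_localizable R (Cp R P)" "right_localizable R (Cp R P)"
  using localization.left_localizableI[OF localization_Cp[OF P] Cp_left_ore[OF P] Loc_Cp_nonzero[OF P]]
    localization.right_localizableI[OF localization_Cp[OF P] Cp_right_ore[OF P] Loc_Cp_nonzero[OF P]]
  by blast+

lemma maxl_above_regular:
  assumes F: "\<And>P. P \<in> min_primes R \<Longrightarrow> Cp R P \<in> F"
    "\<And>S. S \<in> F \<Longrightarrow> mult_set R S \<and> \<one>\<^bsub>Loc R S\<^esub> \<noteq> \<zero>\<^bsub>Loc R S\<^esub>"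
  shows "{S \<in> maxl F. regular R \<subseteq> S} = Cp R ` min_primes R"
proof -
  \<comment> \<open>Containing the regular elements passes to supersets, so restricting to such sets
    commutes with taking maximal elements.\<close>
  have "{S \<in> maxl F. regular R \<subseteq> S} = maxl {S \<in> F. regular R \<subseteq> S}"
    unfolding maxl_def by blast
  also have "\<dots> = Cp R ` min_primes R"
  proof (rule maxl_eqI)
    show "Cp R ` min_primes R \<subseteq> {S \<in> F. regular R \<subseteq> S}" using F(1) regular_subset_Cp by blast
    show "\<exists>T\<in>Cp R ` min_primes R. S \<subseteq> T" if "S \<in> {S \<in> F. regular R \<subseteq> S}" for S
      using nonzero_Loc_subset_Cp[of S] F(2)[of S] that by blast
    show "S = T" if "S \<in> Cp R ` min_primes R" "T \<in> Cp R ` min_primes R" "S \<subseteq> T" for S T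
      using that Cp_subset_imp_eq by blast
  qed
  finally show ?thesis .
qed

lemma maxl_Ore_eq: "maxl (Ore R) = Cp R ` min_primes R"
proof (rule maxl_eqI)
  show "Cp R ` min_primes R \<subseteq> Ore R" using Cp_den_set by (auto simp: Ore_def den_set_def)
  show "\<exists>T\<in>Cp R ` min_primes R. S \<subseteq> T" if "S \<in> Ore R" for S
    using ore_set_subset_Cp[of S] that by (simp add: Ore_def)
  show "S = T" if "S \<in> Cp R ` min_primes R" "T \<in> Cp R ` min_primes R" "S \<subseteq> T" for S T
    using that Cp_subset_imp_eq by blast
qed

lemma maxl_Den_eq: "maxl (Den R) = Cp R ` min_primes R"
proof (rule maxl_eqI)
  show "Cp R ` min_primes R \<subseteq> Den R" using Cp_den_set by (auto simp: Den_def)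
  show "\<exists>T\<in>Cp R ` min_primes R. S \<subseteq> T" if "S \<in> Den R" for S
    using ore_set_subset_Cp[of S] that by (simp add: Den_def den_set_def)
  show "S = T" if "S \<in> Cp R ` min_primes R" "T \<in> Cp R ` min_primes R" "S \<subseteq> T" for S T
    using that Cp_subset_imp_eq by blast
qed

lemma ass_maxl_Ore: "{ass R S | S. S \<in> maxl (Ore R)} = min_primes R"
  unfolding maxl_Ore_eq using ass_Cp by force

lemma maxl_ass_Ore: "maxl {ass R S | S. S \<in> Ore R} = min_primes R"
proof (rule maxl_eqI)
  show "min_primes R \<subseteq> {ass R S | S. S \<in> Ore R}"
    using ass_Cp Cp_den_set unfolding Ore_def den_set_def by blast
  show "\<exists>T\<in>min_primes R. I \<subseteq> T" if I: "I \<in> {ass R S | S. S \<in> Ore R}" for I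
  proof -
    obtain S where S: "I = ass R S" "ore_set R S" using I by (auto simp: Ore_def)
    obtain P where P: "P \<in> min_primes R" "S \<subseteq> Cp R P" using ore_set_subset_Cp[OF S(2)] by blast
    show ?thesis using ass_mono[OF localization_Cp[OF P(1)] P(2)] ass_Cp[OF P(1)] P(1) S(1) by blast
  qed
  show "S = T" if "S \<in> min_primes R" "T \<in> min_primes R" "S \<subseteq> T" for S T
    using min_primeD(5)[OF that(2,1,3)] .
qed

end

section \<open>The classical quotient ring as a product of localizations\<close>

locale semiprime_goldie_quotient = semiprime_goldie R + localization R "regular R" for R (structure)
begin

definition proj :: "'a set \<Rightarrow> (('a + 'a) list \<Rightarrow> int) set \<Rightarrow> (('a + 'a) list \<Rightarrow> int) set" where
  "proj P = (SOME \<psi>. \<psi> \<in> ring_hom L (Loc R (Cp R P)) \<and>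
     (\<forall>r\<in>carrier R. \<psi> (loc_map R (regular R) r) = loc_map R (Cp R P) r))"

lemma proj:
  assumes P: "P \<in> min_primes R"
  shows "proj P \<in> ring_hom L (Loc R (Cp R P))"
    "r \<in> carrier R \<Longrightarrow> proj P (loc_map R (regular R) r) = loc_map R (Cp R P) r"
proof -
  have "\<exists>\<psi>. \<psi> \<in> ring_hom L (Loc R (Cp R P)) \<and>
     (\<forall>r\<in>carrier R. \<psi> (loc_map R (regular R) r) = loc_map R (Cp R P) r)"
    using Loc_mono[OF localization_Cp[OF P] regular_subset_Cp[OF P]] by metis
  from someI_ex[OF this, folded proj_def]
  show "proj P \<in> ring_hom L (Loc R (Cp R P))"
    "r \<in> carrier R \<Longrightarrow> proj P (loc_map R (regular R) r) = loc_map R (Cp R P) r" by blast+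
qed

text \<open>Write the element with numerator \<open>r\<close> over a regular denominator. Vanishing
  in all localizations puts \<open>r\<close> into every minimal prime, and these intersect in
  zero.\<close>

lemma proj_kernel:
  assumes u: "u \<in> carrier L" and z: "\<And>P. P \<in> min_primes R \<Longrightarrow> proj P u = \<zero>\<^bsub>Loc R (Cp R P)\<^esub>"
  shows "u = \<zero>\<^bsub>L\<^esub>"
proof (cases "\<one> = \<zero>")
  case True
  then have "\<one>\<^bsub>L\<^esub> = \<zero>\<^bsub>L\<^esub>" using loc_map.hom_one loc_map.hom_zero by simp
  then have "\<one>\<^bsub>L\<^esub> \<otimes>\<^bsub>L\<^esub> u = \<zero>\<^bsub>L\<^esub>" using u by simp
  then show ?thesis using u by simp
next
  case False
  have "u \<in> left_fractions R L (loc_map R (regular R)) (regular R)"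
    using Loc_left_fractions[OF regular_left_ore[OF False]] u by simp
  then obtain s r where sr: "s \<in> regular R" "r \<in> carrier R" "loc_map R (regular R) s \<otimes>\<^bsub>L\<^esub> u = loc_map R (regular R) r"
    unfolding left_fractions_def by blast
  note sc = regularD(1)[OF sr(1)]
  have "r \<in> P" if P: "P \<in> min_primes R" for P
  proof -
    interpret P: localization R "Cp R P" by (rule localization_Cp[OF P])
    have "loc_map R (Cp R P) r = proj P (loc_map R (regular R) s \<otimes>\<^bsub>L\<^esub> u)"
      unfolding sr(3) using proj(2)[OF P sr(2)] by simp
    also have "\<dots> = proj P (loc_map R (regular R) s) \<otimes>\<^bsub>P.L\<^esub> proj P u"
      by (rule ring_hom_mult[OF proj(1)[OF P] loc_map.hom_closed[OF sc] u])
    also have "\<dots> = \<zero>\<^bsub>P.L\<^esub>" unfolding z[OF P] proj(2)[OF P sc] using P.loc_map.hom_closed[OF sc] by simp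
    finally have "r \<in> ass R (Cp R P)" using sr(2) by (simp add: ass_def)
    then show ?thesis using ass_Cp[OF P] by simp
  qed
  then have "r \<in> carrier R \<inter> \<Inter>(min_primes R)" using sr(2) by blast
  then have r0: "r = \<zero>" using min_primes_Inter by blast
  note x = loc_x_closed[OF sr(1)]
  have "u = (loc_x R (regular R) s \<otimes>\<^bsub>L\<^esub> loc_map R (regular R) s) \<otimes>\<^bsub>L\<^esub> u"
    unfolding loc_map_x(2)[OF sr(1)] using u by simp
  also have "\<dots> = loc_x R (regular R) s \<otimes>\<^bsub>L\<^esub> (loc_map R (regular R) s \<otimes>\<^bsub>L\<^esub> u)"
    by (rule L.m_assoc[OF x loc_map.hom_closed[OF sc] u])
  also have "\<dots> = \<zero>\<^bsub>L\<^esub>" unfolding sr(3) r0 using x by simp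
  finally show ?thesis .
qed

text \<open>A Chinese remainder argument: an element with numerator \<open>r\<close> and denominator
  \<open>s\<close> over \<open>P\<close> is lifted so that all other components vanish, since the
  chosen \<open>b\<close> lies in every minimal prime other than \<open>P\<close>.\<close>

lemma proj_lift_one:
  assumes P: "P \<in> min_primes R" and v: "v \<in> carrier (Loc R (Cp R P))"
  obtains q where "q \<in> carrier L" "proj P q = v"
    "\<And>Q. Q \<in> min_primes R \<Longrightarrow> Q \<noteq> P \<Longrightarrow> proj Q q = \<zero>\<^bsub>Loc R (Cp R Q)\<^esub>"
proof -
  note PD = min_primeD[OF P]
  interpret F: min_prime_fractions R "Loc R (Cp R P)" "loc_map R (Cp R P)" P
    by (rule min_prime_fractions_Loc[OF P])
  let ?A = "Loc R (Cp R P)" and ?\<phi> = "loc_map R (Cp R P)" and ?q = "loc_map R (regular R)"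
  obtain s r where sr: "s \<in> Cp R P" "r \<in> carrier R" "?\<phi> s \<otimes>\<^bsub>?A\<^esub> v = ?\<phi> r" using F.fractionE[OF v] by blast
  obtain b x where b: "b \<in> ann P" "b \<in> Cp R P" and x: "x \<in> P" and d: "b \<otimes> s \<oplus> x \<in> regular R"
    using Cp_lift_regular[OF P sr(1)] by blast
  note sc = CpD(1)[OF PD(2) sr(1)] and bc = annD(1)[OF PD(2) b(1)] and xc = idealD(1)[OF PD(2) x]
    and dc = regularD(1)[OF d]
  let ?d = "b \<otimes> s \<oplus> x"
  \<comment> \<open>Modulo \<open>P\<close> the denominator \<open>b s + x\<close> is
    \<open>b s\<close>, so the factor \<open>b\<close> cancels against the numerator
    \<open>b r\<close> and \<open>v\<close> results.\<close>
  define q where "q = loc_x R (regular R) ?d \<otimes>\<^bsub>L\<^esub> ?q (b \<otimes> r)"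
  have brc: "b \<otimes> r \<in> carrier R" using bc sr(2) by simp
  note h = loc_map.hom_closed[OF brc] loc_map.hom_closed[OF dc] loc_x_closed[OF d]
  have q: "q \<in> carrier L" unfolding q_def using h by simp
  have "?q ?d \<otimes>\<^bsub>L\<^esub> q = (?q ?d \<otimes>\<^bsub>L\<^esub> loc_x R (regular R) ?d) \<otimes>\<^bsub>L\<^esub> ?q (b \<otimes> r)"
    unfolding q_def by (rule L.m_assoc[OF h(2,3,1), symmetric])
  then have dq: "?q ?d \<otimes>\<^bsub>L\<^esub> q = ?q (b \<otimes> r)" unfolding loc_map_x(1)[OF d] using h by simp
  have projq: "loc_map R (Cp R Q) ?d \<otimes>\<^bsub>Loc R (Cp R Q)\<^esub> proj Q q = loc_map R (Cp R Q) (b \<otimes> r)"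
    if Q: "Q \<in> min_primes R" for Q
    using ring_hom_mult[OF proj(1)[OF Q] h(2) q] unfolding dq proj(2)[OF Q brc] proj(2)[OF Q dc] by simp
  show thesis
  proof (rule that[OF q])
    have pq: "proj P q \<in> carrier ?A" by (rule ring_hom_closed[OF proj(1)[OF P] q])
    have dC: "?d \<in> Cp R P" using regular_subset_Cp[OF P] d by blast
    have "?\<phi> ?d = ?\<phi> b \<otimes>\<^bsub>?A\<^esub> ?\<phi> s \<oplus>\<^bsub>?A\<^esub> ?\<phi> x" using bc sc xc by simp
    also have "?\<phi> x = \<zero>\<^bsub>?A\<^esub>" using F.kernel[OF xc] x by simp
    finally have "?\<phi> ?d = ?\<phi> b \<otimes>\<^bsub>?A\<^esub> ?\<phi> s" using bc sc by simp
    then have "?\<phi> ?d \<otimes>\<^bsub>?A\<^esub> v = ?\<phi> b \<otimes>\<^bsub>?A\<^esub> (?\<phi> s \<otimes>\<^bsub>?A\<^esub> v)"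
      using F.\<phi>.S.m_assoc[OF F.\<phi>.hom_closed[OF bc] F.\<phi>.hom_closed[OF sc] v] by simp
    also have "\<dots> = ?\<phi> (b \<otimes> r)" unfolding sr(3) using bc sr(2) by simp
    also have "\<dots> = ?\<phi> ?d \<otimes>\<^bsub>?A\<^esub> proj P q" using projq[OF P] by simp
    finally have eq: "?\<phi> ?d \<otimes>\<^bsub>?A\<^esub> v = ?\<phi> ?d \<otimes>\<^bsub>?A\<^esub> proj P q" .
    have "?\<phi> ?d \<in> Units ?A" using F.units dC by blast
    then show "proj P q = v" using F.\<phi>.S.Units_l_cancel[OF _ v pq] eq by simp
  next
    fix Q assume Q: "Q \<in> min_primes R" "Q \<noteq> P"
    interpret G: min_prime_fractions R "Loc R (Cp R Q)" "loc_map R (Cp R Q)" Q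
      by (rule min_prime_fractions_Loc[OF Q(1)])
    have "b \<in> Q" using ann_subset_other[OF P Q(1)] Q(2) b(1) by blast
    then have "b \<otimes> r \<in> Q" by (rule idealD(5)[OF min_primeD(2)[OF Q(1)] sr(2)])
    then have z: "loc_map R (Cp R Q) (b \<otimes> r) = \<zero>\<^bsub>Loc R (Cp R Q)\<^esub>" using G.kernel[OF brc] by simp
    have dC: "?d \<in> Cp R Q" using regular_subset_Cp[OF Q(1)] d by blast
    show "proj Q q = \<zero>\<^bsub>Loc R (Cp R Q)\<^esub>"
      by (rule G.unit_cancel[OF dC ring_hom_closed[OF proj(1)[OF Q(1)] q]]) (simp only: projq[OF Q(1)] z)
  qed
qed

lemma proj_lift:
  assumes T: "finite T" "T \<subseteq> min_primes R" and f: "\<And>P. P \<in> T \<Longrightarrow> f P \<in> carrier (Loc R (Cp R P))"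
  shows "\<exists>q\<in>carrier L. \<forall>P\<in>min_primes R. proj P q = (if P \<in> T then f P else \<zero>\<^bsub>Loc R (Cp R P)\<^esub>)"
  using T f
proof (induction T)
  case empty
  have "proj P \<zero>\<^bsub>L\<^esub> = \<zero>\<^bsub>Loc R (Cp R P)\<^esub>" if P: "P \<in> min_primes R" for P
  proof -
    interpret P: localization R "Cp R P" by (rule localization_Cp[OF P])
    show ?thesis by (rule ring_hom_zero[OF proj(1)[OF P] L.ring_axioms P.L.ring_axioms])
  qed
  then show ?case by (intro bexI[of _ "\<zero>\<^bsub>L\<^esub>"]) simp_all
next
  case (insert P T)
  have "\<exists>q\<in>carrier L. \<forall>P\<in>min_primes R. proj P q = (if P \<in> T then f P else \<zero>\<^bsub>Loc R (Cp R P)\<^esub>)"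
    by (rule insert.IH) (use insert.prems in simp_all)
  then obtain q where q: "q \<in> carrier L"
    "\<And>Q. Q \<in> min_primes R \<Longrightarrow> proj Q q = (if Q \<in> T then f Q else \<zero>\<^bsub>Loc R (Cp R Q)\<^esub>)" by blast
  have P: "P \<in> min_primes R" "f P \<in> carrier (Loc R (Cp R P))" using insert.prems by simp_all
  obtain p where p: "p \<in> carrier L" "proj P p = f P"
    "\<And>Q. Q \<in> min_primes R \<Longrightarrow> Q \<noteq> P \<Longrightarrow> proj Q p = \<zero>\<^bsub>Loc R (Cp R Q)\<^esub>"
    using proj_lift_one[OF P] by blast
  show ?case
  proof (intro bexI ballI)
    show "q \<oplus>\<^bsub>L\<^esub> p \<in> carrier L" using q(1) p(1) by simp
    fix Q assume Q: "Q \<in> min_primes R"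
    interpret Q: localization R "Cp R Q" by (rule localization_Cp[OF Q])
    have sum: "proj Q (q \<oplus>\<^bsub>L\<^esub> p) = proj Q q \<oplus>\<^bsub>Q.L\<^esub> proj Q p"
      by (rule ring_hom_add[OF proj(1)[OF Q] q(1) p(1)])
    note c = ring_hom_closed[OF proj(1)[OF Q] q(1)]
    show "proj Q (q \<oplus>\<^bsub>L\<^esub> p) = (if Q \<in> insert P T then f Q else \<zero>\<^bsub>Q.L\<^esub>)"
    proof (cases "Q = P")
      case True
      have "proj Q q = \<zero>\<^bsub>Q.L\<^esub>" using q(2)[OF Q] True insert.hyps(2) by simp
      then have "proj Q (q \<oplus>\<^bsub>L\<^esub> p) = proj Q p"
        unfolding sum using Q.L.l_zero[OF ring_hom_closed[OF proj(1)[OF Q] p(1)]] by simp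
      then show ?thesis using True p(2) by simp
    next
      case False
      then show ?thesis unfolding sum p(3)[OF Q False] using q(2)[OF Q] c by simp
    qed
  qed
qed

lemma Qcl_iso_prod: "Qcl R \<simeq> prod_ring (Cp R ` min_primes R) (Loc R)"
proof -
  let ?M = "Cp R ` min_primes R"
  \<comment> \<open>The product is indexed by the sets \<open>Cp R P\<close>; since such a set
    determines its prime, the prime can be recovered from the index.\<close>
  define pr where "pr = (\<lambda>C\<in>?M. THE P. P \<in> min_primes R \<and> Cp R P = C)"
  have pr: "pr (Cp R P) = P" if P: "P \<in> min_primes R" for P
    unfolding pr_def using P Cp_subset_imp_eq by (auto intro!: the_equality)
  define \<Phi> where "\<Phi> u = (\<lambda>C\<in>?M. proj (pr C) u)" for u
  have \<Phi>: "\<Phi> u (Cp R P) = proj P u" if "P \<in> min_primes R" for u P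
    using that by (simp add: \<Phi>_def pr)
  have "\<Phi> \<in> ring_hom L (prod_ring ?M (Loc R))"
  proof (rule ring_hom_memI)
    fix u v assume u: "u \<in> carrier L" and v: "v \<in> carrier L"
    show "\<Phi> u \<in> carrier (prod_ring ?M (Loc R))"
      using u ring_hom_closed[OF proj(1) u] by (auto simp: \<Phi>_def prod_ring_def pr)
    show "\<Phi> (u \<otimes>\<^bsub>L\<^esub> v) = \<Phi> u \<otimes>\<^bsub>prod_ring ?M (Loc R)\<^esub> \<Phi> v"
      unfolding prod_ring_def \<Phi>_def
      by (auto intro!: restrict_ext simp: pr ring_hom_mult[OF proj(1) u v])
    show "\<Phi> (u \<oplus>\<^bsub>L\<^esub> v) = \<Phi> u \<oplus>\<^bsub>prod_ring ?M (Loc R)\<^esub> \<Phi> v"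
      unfolding prod_ring_def \<Phi>_def
      by (auto intro!: restrict_ext simp: pr ring_hom_add[OF proj(1) u v])
  next
    show "\<Phi> \<one>\<^bsub>L\<^esub> = \<one>\<^bsub>prod_ring ?M (Loc R)\<^esub>"
      unfolding prod_ring_def \<Phi>_def
      by (auto intro!: restrict_ext simp: pr ring_hom_one[OF proj(1)])
  qed
  moreover have "bij_betw \<Phi> (carrier L) (carrier (prod_ring ?M (Loc R)))"
    unfolding bij_betw_def
  proof
    show "inj_on \<Phi> (carrier L)"
    proof (rule inj_onI)
      fix u v assume u: "u \<in> carrier L" and v: "v \<in> carrier L" and eq: "\<Phi> u = \<Phi> v"
      have "u \<ominus>\<^bsub>L\<^esub> v = \<zero>\<^bsub>L\<^esub>"
      proof (rule proj_kernel)
        show "u \<ominus>\<^bsub>L\<^esub> v \<in> carrier L" using u v by simp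
        fix P assume P: "P \<in> min_primes R"
        interpret P: localization R "Cp R P" by (rule localization_Cp[OF P])
        interpret h: ring_hom_ring L P.L "proj P"
          by (rule ring_hom_ringI2[OF L.ring_axioms P.L.ring_axioms proj(1)[OF P]])
        have "proj P u = proj P v" using eq \<Phi>[OF P] by metis
        then have "proj P u \<oplus>\<^bsub>P.L\<^esub> \<ominus>\<^bsub>P.L\<^esub> proj P v = \<zero>\<^bsub>P.L\<^esub>" using h.hom_closed[OF v] by (simp add: P.L.r_neg)
        then show "proj P (u \<ominus>\<^bsub>L\<^esub> v) = \<zero>\<^bsub>P.L\<^esub>" using u v by (simp add: a_minus_def)
      qed
      then show "u = v" using u v by simp
    qed
    show "\<Phi> ` carrier L = carrier (prod_ring ?M (Loc R))"
    proof
      show "\<Phi> ` carrier L \<subseteq> carrier (prod_ring ?M (Loc R))"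
        using ring_hom_closed[OF proj(1)] by (auto simp: \<Phi>_def prod_ring_def pr)
      show "carrier (prod_ring ?M (Loc R)) \<subseteq> \<Phi> ` carrier L"
      proof
        fix f assume "f \<in> carrier (prod_ring ?M (Loc R))"
        then have f: "\<And>P. P \<in> min_primes R \<Longrightarrow> f (Cp R P) \<in> carrier (Loc R (Cp R P))" "f \<in> extensional ?M"
          by (auto simp: prod_ring_def PiE_def)
        from proj_lift[OF min_primes_finite subset_refl, of "\<lambda>P. f (Cp R P)"] f(1)
        obtain q where q: "q \<in> carrier L"
          "\<And>P. P \<in> min_primes R \<Longrightarrow> proj P q = f (Cp R P)" by auto
        have "f = \<Phi> q"
        proof (rule extensionalityI[OF f(2)])
          show "\<Phi> q \<in> extensional ?M" by (simp add: \<Phi>_def)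
          fix C assume "C \<in> ?M"
          then obtain P where "P \<in> min_primes R" "C = Cp R P" by blast
          then show "f C = \<Phi> q C" using \<Phi> q(2) by simp
        qed
        then show "f \<in> \<Phi> ` carrier L" using q(1) by blast
      qed
    qed
  qed
  ultimately have "\<Phi> \<in> ring_iso L (prod_ring ?M (Loc R))" unfolding ring_iso_def by simp
  then show ?thesis unfolding is_ring_iso_def Qcl_def by blast
qed

end

theorem theorem1p11:
  fixes R :: "('a, 'm) ring_scheme"
  assumes "ring R" and "semiprime R" and "goldie R"
  shows "(maxl (Ore R) = maxl (Den R) \<and>
          maxl (Ore R) = {Cp R P | P. P \<in> min_primes R} \<and>
          maxl (Ore R) = {S \<in> maxl (L_l R). regular R \<subseteq> S} \<and>
          maxl (Ore R) = {S \<in> maxl (L_r R). regular R \<subseteq> S} \<and>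
          maxl (Ore R) = {S \<in> maxl (L_lr R). regular R \<subseteq> S})
       \<and> (\<forall>S\<in>maxl (Ore R). simple_ring (Loc R S) \<and> artinian (Loc R S))
       \<and> Qcl R \<simeq> prod_ring (maxl (Ore R)) (Loc R)
       \<and> (maxl {ass R S | S. S \<in> Ore R} = {ass R S | S. S \<in> maxl (Ore R)} \<and>
          {ass R S | S. S \<in> maxl (Ore R)} = min_primes R \<and>
          (\<forall>S\<in>maxl (Ore R). \<forall>T\<in>maxl (Ore R). ass R S \<subseteq> ass R T \<longrightarrow> S = T))"
proof -
  interpret semiprime_goldie R
    by (rule semiprime_goldie.intro) (use assms in \<open>simp_all add: semiprime_goldie_axioms_def\<close>)
  interpret Q: semiprime_goldie_quotient R
    by unfold_locales (use regularD(1) in blast)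
  have "{S \<in> maxl (L_l R). regular R \<subseteq> S} = Cp R ` min_primes R"
    by (rule maxl_above_regular) (use Cp_localizable in \<open>auto simp: L_l_def left_localizable_def\<close>)
  moreover have "{S \<in> maxl (L_r R). regular R \<subseteq> S} = Cp R ` min_primes R"
    by (rule maxl_above_regular) (use Cp_localizable in \<open>auto simp: L_r_def right_localizable_def\<close>)
  moreover have "{S \<in> maxl (L_lr R). regular R \<subseteq> S} = Cp R ` min_primes R"
    by (rule maxl_above_regular)
      (use Cp_localizable in \<open>auto simp: L_lr_def localizable_def left_localizable_def\<close>)
  moreover have "S = T" if ST: "S \<in> maxl (Ore R)" "T \<in> maxl (Ore R)" "ass R S \<subseteq> ass R T" for S T
  proof -
    obtain P P' where P: "P \<in> min_primes R" "S = Cp R P" "P' \<in> min_primes R" "T = Cp R P'"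
      using ST(1,2) unfolding maxl_Ore_eq by blast
    then show ?thesis using ST(3) ass_Cp min_primeD(5)[OF P(3,1)] by simp
  qed
  moreover have "simple_ring (Loc R S) \<and> artinian (Loc R S)" if "S \<in> maxl (Ore R)" for S
    using that Loc_Cp_simple Loc_Cp_artinian unfolding maxl_Ore_eq by blast
  moreover have "{Cp R P | P. P \<in> min_primes R} = Cp R ` min_primes R" by blast
  ultimately show ?thesis
    using Q.Qcl_iso_prod unfolding maxl_Ore_eq maxl_Den_eq ass_maxl_Ore[unfolded maxl_Ore_eq] maxl_ass_Ore
    by (intro conjI ballI impI) simp_all
qed

end
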